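(* Let $G$ be an amenable Hausdorff topological group, locally compact or SIN, acting continuously by isometries on a pointed metric space $(\mathcal{M},d,0)$ with bounded orbits; let $M$ be a bi-invariant mean on $G$ and $X=\mathcal{F}(\mathcal{M})$. Let $R_G:X\to X^{**}$, $R_G(\mu)(f)=M(g\mapsto f(T_g\mu))$, and $\widetilde{P_G}:=R_G^*\circ\kappa_{X^*}:\mathrm{Lip}_0(\mathcal{M})\to\mathrm{Lip}_0(\mathcal{M})$. Then $R_G[X]$ is a closed subspace of $X^{**}$ linearly isometric to $\mathcal{F}(\mathcal{M}/G)$, $\widetilde{P_G}$ is a projection of norm at most 1 with $\widetilde{P_G}[\mathrm{Lip}_0(\mathcal{M})]=\mathrm{Lip}_0^G(\mathcal{M})$, and $\ker R_G=\overline{\mathrm{span}}\{\delta(gx)-\delta(x):x\in\mathcal{M},g\in G\}$. In particular: (1) $\mathrm{Lip}_0(\mathcal{M}/G)$ is isometric to a $1$-complemented subspace of $\mathrm{Lip}_0(\mathcal{M})$; (2) if $\mathrm{Lip}_0^G(\mathcal{M})\cap(I_G)^\perp=\{0\}$, where $I_G=\{\mu\in X:T_g\mu=\mu\ \forall g\in G\}$, then $I_G$ is $1$-complemented in $\mathcal{F}(\mathcal{M})$.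
   Context: $\mathrm{Lip}_0(N)$: real Lipschitz functions on a pointed metric space $N$ vanishing at the base point, normed by the Lipschitz constant; $\delta(m)$ evaluation at $m$; $\mathcal{F}(N)=\overline{\mathrm{span}}\{\delta(m):m\in N\}\subset\mathrm{Lip}_0(N)^*$, with $\mathcal{F}(N)^*=\mathrm{Lip}_0(N)$. $\kappa_Z$ is the canonical embedding $Z\to Z^{**}$; $A^\perp$ is the annihilator in the dual. For $g\in G$, $T_g$ is the linear isometry of $\mathcal{F}(\mathcal{M})$ with $T_g\delta(m)=\delta(gm)-\delta(g0)$ (the linear part of the affine isometric action $A_g\mu=T_g\mu+\delta(g0)$). $\mathcal{M}/G=\{[Gx]:x\in\mathcal{M}\}$ with $[Gx]=\overline{Gx}$, metric $d_{\mathcal{M}/G}([Gx],[Gy])=\inf\{d(x',y'):x'\in[Gx],y'\in[Gy]\}$ (the Hausdorff distance), base point $[G0]$. $\mathrm{Lip}_0^G(\mathcal{M})=\{f\in\mathrm{Lip}_0(\mathcal{M}):f(gx)=f(x)\ \forall g,x\}$. A bi-invariant mean is a positive normalized linear functional invariant under left and right translations (on bounded uniformly continuous functions for SIN $G$; on $L_\infty(G)$ for locally compact amenable $G$). SIN: every neighborhood $U$ of $e$ contains a neighborhood $V$ of $e$ with $gVg^{-1}=V$ for all $g$. *)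

theory Defs
  imports "HOL-Analysis.Analysis" "HOL-Algebra.Group_Action"
begin

text \<open>All objects are represented concretely. Real functions on the carrier S are
  extended by 0 outside S. The dual X* of X = F(S) is identified with Lip0(S) via
  the duality pairing mu f; the bidual X** = Lip0(S)* is represented by bounded linear
  functionals on Lip0(S), i.e. by the same representation as Lip0(S)*, which contains X.\<close>

definition lipc :: "'a set \<Rightarrow> ('a \<Rightarrow> 'a \<Rightarrow> real) \<Rightarrow> ('a \<Rightarrow> real) \<Rightarrow> real" where
  "lipc S d f = Sup (insert 0 {\<bar>f x - f y\<bar> / d x y | x y. x \<in> S \<and> y \<in> S \<and> x \<noteq> y})"

definition Lip0 :: "'a set \<Rightarrow> ('a \<Rightarrow> 'a \<Rightarrow> real) \<Rightarrow> 'a \<Rightarrow> ('a \<Rightarrow> real) set" where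
  "Lip0 S d z = {f. f z = 0 \<and> (\<forall>x. x \<notin> S \<longrightarrow> f x = 0) \<and>
                    (\<exists>L. \<forall>x\<in>S. \<forall>y\<in>S. \<bar>f x - f y\<bar> \<le> L * d x y)}"

definition dnorm :: "'a set \<Rightarrow> ('a \<Rightarrow> 'a \<Rightarrow> real) \<Rightarrow> 'a \<Rightarrow> (('a \<Rightarrow> real) \<Rightarrow> real) \<Rightarrow> real" where
  "dnorm S d z \<phi> = Sup (insert 0 {\<bar>\<phi> f\<bar> | f. f \<in> Lip0 S d z \<and> lipc S d f \<le> 1})"

definition LipDual :: "'a set \<Rightarrow> ('a \<Rightarrow> 'a \<Rightarrow> real) \<Rightarrow> 'a \<Rightarrow> (('a \<Rightarrow> real) \<Rightarrow> real) set" where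
  "LipDual S d z = {\<phi>. (\<forall>f. f \<notin> Lip0 S d z \<longrightarrow> \<phi> f = 0) \<and>
     (\<forall>f\<in>Lip0 S d z. \<forall>h\<in>Lip0 S d z. \<forall>a b. \<phi> (\<lambda>x. a * f x + b * h x) = a * \<phi> f + b * \<phi> h) \<and>
     (\<exists>C. \<forall>f\<in>Lip0 S d z. \<bar>\<phi> f\<bar> \<le> C * lipc S d f)}"

definition delta :: "'a set \<Rightarrow> ('a \<Rightarrow> 'a \<Rightarrow> real) \<Rightarrow> 'a \<Rightarrow> 'a \<Rightarrow> (('a \<Rightarrow> real) \<Rightarrow> real)" where
  "delta S d z m = (\<lambda>f. if f \<in> Lip0 S d z then f m else 0)"

definition lincomb :: "('b \<Rightarrow> real) set \<Rightarrow> ('b \<Rightarrow> real) set" where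
  "lincomb A = {(\<lambda>t. \<Sum>i<n. c i * u i t) | (n::nat) c u. \<forall>i<n. u i \<in> A}"

definition cspan :: "'a set \<Rightarrow> ('a \<Rightarrow> 'a \<Rightarrow> real) \<Rightarrow> 'a \<Rightarrow> (('a \<Rightarrow> real) \<Rightarrow> real) set
                      \<Rightarrow> (('a \<Rightarrow> real) \<Rightarrow> real) set" where
  "cspan S d z A = {\<phi> \<in> LipDual S d z. \<forall>\<epsilon>>0. \<exists>\<psi>\<in>lincomb A. dnorm S d z (\<lambda>f. \<phi> f - \<psi> f) < \<epsilon>}"

definition FreeSp :: "'a set \<Rightarrow> ('a \<Rightarrow> 'a \<Rightarrow> real) \<Rightarrow> 'a \<Rightarrow> (('a \<Rightarrow> real) \<Rightarrow> real) set" where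
  "FreeSp S d z = cspan S d z (delta S d z ` S)"

definition lin_subspace :: "('b \<Rightarrow> real) set \<Rightarrow> bool" where
  "lin_subspace A \<longleftrightarrow> (\<lambda>_. 0) \<in> A \<and> (\<forall>x\<in>A. \<forall>y\<in>A. \<forall>a b. (\<lambda>t. a * x t + b * y t) \<in> A)"

definition closed_subspace_dual :: "'a set \<Rightarrow> ('a \<Rightarrow> 'a \<Rightarrow> real) \<Rightarrow> 'a \<Rightarrow> (('a \<Rightarrow> real) \<Rightarrow> real) set \<Rightarrow> bool" where
  "closed_subspace_dual S d z A \<longleftrightarrow> A \<subseteq> LipDual S d z \<and> lin_subspace A \<and>
     (\<forall>\<phi>\<in>LipDual S d z. (\<forall>\<epsilon>>0. \<exists>\<psi>\<in>A. dnorm S d z (\<lambda>f. \<phi> f - \<psi> f) < \<epsilon>) \<longrightarrow> \<phi> \<in> A)"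

definition lin_iso_onto :: "('a \<Rightarrow> real) set \<Rightarrow> (('a \<Rightarrow> real) \<Rightarrow> real) \<Rightarrow> ('b \<Rightarrow> real) set
     \<Rightarrow> (('b \<Rightarrow> real) \<Rightarrow> real) \<Rightarrow> (('a \<Rightarrow> real) \<Rightarrow> ('b \<Rightarrow> real)) \<Rightarrow> bool" where
  "lin_iso_onto A nA B nB U \<longleftrightarrow> bij_betw U A B \<and>
     (\<forall>x\<in>A. \<forall>y\<in>A. \<forall>a b. U (\<lambda>t. a * x t + b * y t) = (\<lambda>s. a * U x s + b * U y s)) \<and>
     (\<forall>x\<in>A. nB (U x) = nA x)"

definition is_projection :: "('b \<Rightarrow> real) set \<Rightarrow> (('b \<Rightarrow> real) \<Rightarrow> ('b \<Rightarrow> real)) \<Rightarrow> bool" where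
  "is_projection A P \<longleftrightarrow> (\<forall>x\<in>A. P x \<in> A) \<and>
     (\<forall>x\<in>A. \<forall>y\<in>A. \<forall>a b. P (\<lambda>t. a * x t + b * y t) = (\<lambda>s. a * P x s + b * P y s)) \<and>
     (\<forall>x\<in>A. P (P x) = P x)"

definition top_group :: "('g, 'c) monoid_scheme \<Rightarrow> 'g topology \<Rightarrow> bool" where
  "top_group G T \<longleftrightarrow> group G \<and> topspace T = carrier G \<and>
     continuous_map (prod_topology T T) T (\<lambda>p. fst p \<otimes>\<^bsub>G\<^esub> snd p) \<and>
     continuous_map T T (\<lambda>x. inv\<^bsub>G\<^esub> x)"

definition nbhd_one :: "('g, 'c) monoid_scheme \<Rightarrow> 'g topology \<Rightarrow> 'g set \<Rightarrow> bool" where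
  "nbhd_one G T V \<longleftrightarrow> V \<subseteq> topspace T \<and> (\<exists>W. openin T W \<and> \<one>\<^bsub>G\<^esub> \<in> W \<and> W \<subseteq> V)"

definition SIN_group :: "('g, 'c) monoid_scheme \<Rightarrow> 'g topology \<Rightarrow> bool" where
  "SIN_group G T \<longleftrightarrow> (\<forall>U. nbhd_one G T U \<longrightarrow> (\<exists>V. nbhd_one G T V \<and> V \<subseteq> U \<and>
      (\<forall>g\<in>carrier G. (\<lambda>v. g \<otimes>\<^bsub>G\<^esub> v \<otimes>\<^bsub>G\<^esub> inv\<^bsub>G\<^esub> g) ` V = V)))"

definition bounded_on_group :: "('g, 'c) monoid_scheme \<Rightarrow> ('g \<Rightarrow> real) \<Rightarrow> bool" where
  "bounded_on_group G f \<longleftrightarrow> (\<exists>C. \<forall>x\<in>carrier G. \<bar>f x\<bar> \<le> C) \<and> (\<forall>x. x \<notin> carrier G \<longrightarrow> f x = 0)"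

definition unif_cont_l :: "('g, 'c) monoid_scheme \<Rightarrow> 'g topology \<Rightarrow> ('g \<Rightarrow> real) \<Rightarrow> bool" where
  "unif_cont_l G T f \<longleftrightarrow> (\<forall>\<epsilon>>0. \<exists>V. nbhd_one G T V \<and>
     (\<forall>x\<in>carrier G. \<forall>y\<in>carrier G. inv\<^bsub>G\<^esub> x \<otimes>\<^bsub>G\<^esub> y \<in> V \<longrightarrow> \<bar>f x - f y\<bar> < \<epsilon>))"

definition unif_cont_r :: "('g, 'c) monoid_scheme \<Rightarrow> 'g topology \<Rightarrow> ('g \<Rightarrow> real) \<Rightarrow> bool" where
  "unif_cont_r G T f \<longleftrightarrow> (\<forall>\<epsilon>>0. \<exists>V. nbhd_one G T V \<and>
     (\<forall>x\<in>carrier G. \<forall>y\<in>carrier G. y \<otimes>\<^bsub>G\<^esub> inv\<^bsub>G\<^esub> x \<in> V \<longrightarrow> \<bar>f x - f y\<bar> < \<epsilon>))"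

definition ltrans :: "('g, 'c) monoid_scheme \<Rightarrow> 'g \<Rightarrow> ('g \<Rightarrow> real) \<Rightarrow> ('g \<Rightarrow> real)" where
  "ltrans G g f = restrict (\<lambda>x. f (g \<otimes>\<^bsub>G\<^esub> x)) (carrier G)"

definition rtrans :: "('g, 'c) monoid_scheme \<Rightarrow> 'g \<Rightarrow> ('g \<Rightarrow> real) \<Rightarrow> ('g \<Rightarrow> real)" where
  "rtrans G g f = restrict (\<lambda>x. f (x \<otimes>\<^bsub>G\<^esub> g)) (carrier G)"

definition mean_on :: "('g, 'c) monoid_scheme \<Rightarrow> ('g \<Rightarrow> real) set \<Rightarrow> (('g \<Rightarrow> real) \<Rightarrow> real) \<Rightarrow> bool" where
  "mean_on G D m \<longleftrightarrow>
     (\<forall>f\<in>D. \<forall>h\<in>D. \<forall>a b. m (\<lambda>x. a * f x + b * h x) = a * m f + b * m h) \<and>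
     (\<forall>f\<in>D. (\<forall>x\<in>carrier G. 0 \<le> f x) \<longrightarrow> 0 \<le> m f) \<and>
     m (restrict (\<lambda>_. 1) (carrier G)) = 1"

text \<open>Amenability of a topological group: a left-invariant mean on the bounded
  uniformly continuous functions (uniformity x^-1 y in V, preserved by left translation).\<close>
definition amenable_group :: "('g, 'c) monoid_scheme \<Rightarrow> 'g topology \<Rightarrow> bool" where
  "amenable_group G T \<longleftrightarrow> (let D = {f. bounded_on_group G f \<and> unif_cont_l G T f} in
     \<exists>m. mean_on G D m \<and> (\<forall>g\<in>carrier G. \<forall>f\<in>D. m (ltrans G g f) = m f))"

definition bi_inv_mean_BUC :: "('g, 'c) monoid_scheme \<Rightarrow> 'g topology \<Rightarrow> (('g \<Rightarrow> real) \<Rightarrow> real) \<Rightarrow> bool" where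
  "bi_inv_mean_BUC G T m \<longleftrightarrow>
     (let D = {f. bounded_on_group G f \<and> unif_cont_l G T f \<and> unif_cont_r G T f} in
      mean_on G D m \<and> (\<forall>g\<in>carrier G. \<forall>f\<in>D. m (ltrans G g f) = m f \<and> m (rtrans G g f) = m f))"

definition haar_measure :: "('g, 'c) monoid_scheme \<Rightarrow> 'g topology \<Rightarrow> 'g measure \<Rightarrow> bool" where
  "haar_measure G T \<mu> \<longleftrightarrow> space \<mu> = carrier G \<and>
     sets \<mu> = sigma_sets (carrier G) {U. openin T U} \<and>
     (\<forall>K. compactin T K \<longrightarrow> emeasure \<mu> K < \<infinity>) \<and>
     (\<forall>U. openin T U \<and> U \<noteq> {} \<longrightarrow> emeasure \<mu> U > 0) \<and>
     (\<forall>A\<in>sets \<mu>. emeasure \<mu> A = (INF U\<in>{U. openin T U \<and> A \<subseteq> U}. emeasure \<mu> U)) \<and>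
     (\<forall>U. openin T U \<longrightarrow> emeasure \<mu> U = (SUP K\<in>{K. compactin T K \<and> K \<subseteq> U}. emeasure \<mu> K)) \<and>
     (\<forall>g\<in>carrier G. \<forall>A\<in>sets \<mu>. emeasure \<mu> ((\<lambda>x. g \<otimes>\<^bsub>G\<^esub> x) ` A) = emeasure \<mu> A)"

definition Linf :: "'g measure \<Rightarrow> ('g \<Rightarrow> real) set" where
  "Linf \<mu> = {f. f \<in> borel_measurable \<mu> \<and> (\<exists>C. AE x in \<mu>. \<bar>f x\<bar> \<le> C)}"

definition bi_inv_mean_Linf :: "('g, 'c) monoid_scheme \<Rightarrow> 'g measure \<Rightarrow> (('g \<Rightarrow> real) \<Rightarrow> real) \<Rightarrow> bool" where
  "bi_inv_mean_Linf G \<mu> m \<longleftrightarrow>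
     (\<forall>f\<in>Linf \<mu>. \<forall>h\<in>Linf \<mu>. (AE x in \<mu>. f x = h x) \<longrightarrow> m f = m h) \<and>
     (\<forall>f\<in>Linf \<mu>. \<forall>h\<in>Linf \<mu>. \<forall>a b. m (\<lambda>x. a * f x + b * h x) = a * m f + b * m h) \<and>
     (\<forall>f\<in>Linf \<mu>. (AE x in \<mu>. 0 \<le> f x) \<longrightarrow> 0 \<le> m f) \<and>
     m (\<lambda>_. 1) = 1 \<and>
     (\<forall>g\<in>carrier G. \<forall>f\<in>Linf \<mu>. m (\<lambda>x. f (g \<otimes>\<^bsub>G\<^esub> x)) = m f \<and> m (\<lambda>x. f (x \<otimes>\<^bsub>G\<^esub> g)) = m f)"

text \<open>T_g mu: the linear isometry of F(M) with T_g delta(m) = delta(gm) - delta(g0),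
  written via its action on Lip0(M): (T_g mu)(f) = mu(x |-> f(gx) - f(g0)).\<close>
definition Tact :: "'m set \<Rightarrow> ('m \<Rightarrow> 'm \<Rightarrow> real) \<Rightarrow> 'm \<Rightarrow> ('g \<Rightarrow> 'm \<Rightarrow> 'm) \<Rightarrow> 'g
                     \<Rightarrow> (('m \<Rightarrow> real) \<Rightarrow> real) \<Rightarrow> (('m \<Rightarrow> real) \<Rightarrow> real)" where
  "Tact S d z \<phi> g \<mu> = (\<lambda>f. if f \<in> Lip0 S d z
       then \<mu> (\<lambda>x. if x \<in> S then f (\<phi> g x) - f (\<phi> g z) else 0) else 0)"

definition RG :: "('g, 'c) monoid_scheme \<Rightarrow> (('g \<Rightarrow> real) \<Rightarrow> real) \<Rightarrow> 'm set \<Rightarrow> ('m \<Rightarrow> 'm \<Rightarrow> real) \<Rightarrow> 'm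
                  \<Rightarrow> ('g \<Rightarrow> 'm \<Rightarrow> 'm) \<Rightarrow> (('m \<Rightarrow> real) \<Rightarrow> real) \<Rightarrow> (('m \<Rightarrow> real) \<Rightarrow> real)" where
  "RG G Mn S d z \<phi> \<mu> = (\<lambda>f. if f \<in> Lip0 S d z
       then Mn (restrict (\<lambda>g. Tact S d z \<phi> g \<mu> f) (carrier G)) else 0)"

definition kappa_dual :: "('m \<Rightarrow> real) \<Rightarrow> ((('m \<Rightarrow> real) \<Rightarrow> real) \<Rightarrow> real)" where
  "kappa_dual f = (\<lambda>\<Psi>. \<Psi> f)"

definition RG_adj :: "('g, 'c) monoid_scheme \<Rightarrow> (('g \<Rightarrow> real) \<Rightarrow> real) \<Rightarrow> 'm set \<Rightarrow> ('m \<Rightarrow> 'm \<Rightarrow> real) \<Rightarrow> 'm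
     \<Rightarrow> ('g \<Rightarrow> 'm \<Rightarrow> 'm) \<Rightarrow> ((('m \<Rightarrow> real) \<Rightarrow> real) \<Rightarrow> real) \<Rightarrow> ((('m \<Rightarrow> real) \<Rightarrow> real) \<Rightarrow> real)" where
  "RG_adj G Mn S d z \<phi> \<Phi> = (\<lambda>\<mu>. \<Phi> (RG G Mn S d z \<phi> \<mu>))"

text \<open>Identification F(M)* = Lip0(M): a functional Lambda on F(M) corresponds to m |-> Lambda(delta m).\<close>
definition dual_to_lip :: "'m set \<Rightarrow> ('m \<Rightarrow> 'm \<Rightarrow> real) \<Rightarrow> 'm \<Rightarrow> ((('m \<Rightarrow> real) \<Rightarrow> real) \<Rightarrow> real) \<Rightarrow> ('m \<Rightarrow> real)" where
  "dual_to_lip S d z \<Lambda> = (\<lambda>m. if m \<in> S then \<Lambda> (delta S d z m) else 0)"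

definition PG_tilde :: "('g, 'c) monoid_scheme \<Rightarrow> (('g \<Rightarrow> real) \<Rightarrow> real) \<Rightarrow> 'm set \<Rightarrow> ('m \<Rightarrow> 'm \<Rightarrow> real) \<Rightarrow> 'm
     \<Rightarrow> ('g \<Rightarrow> 'm \<Rightarrow> 'm) \<Rightarrow> ('m \<Rightarrow> real) \<Rightarrow> ('m \<Rightarrow> real)" where
  "PG_tilde G Mn S d z \<phi> f = dual_to_lip S d z (RG_adj G Mn S d z \<phi> (kappa_dual f))"

definition Lip0G :: "('g, 'c) monoid_scheme \<Rightarrow> 'm set \<Rightarrow> ('m \<Rightarrow> 'm \<Rightarrow> real) \<Rightarrow> 'm \<Rightarrow> ('g \<Rightarrow> 'm \<Rightarrow> 'm) \<Rightarrow> ('m \<Rightarrow> real) set" where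
  "Lip0G G S d z \<phi> = {f \<in> Lip0 S d z. \<forall>g\<in>carrier G. \<forall>x\<in>S. f (\<phi> g x) = f x}"

definition IG :: "('g, 'c) monoid_scheme \<Rightarrow> 'm set \<Rightarrow> ('m \<Rightarrow> 'm \<Rightarrow> real) \<Rightarrow> 'm \<Rightarrow> ('g \<Rightarrow> 'm \<Rightarrow> 'm)
                  \<Rightarrow> (('m \<Rightarrow> real) \<Rightarrow> real) set" where
  "IG G S d z \<phi> = {\<mu> \<in> FreeSp S d z. \<forall>g\<in>carrier G. Tact S d z \<phi> g \<mu> = \<mu>}"

definition annihilator :: "'m set \<Rightarrow> ('m \<Rightarrow> 'm \<Rightarrow> real) \<Rightarrow> 'm \<Rightarrow> (('m \<Rightarrow> real) \<Rightarrow> real) set \<Rightarrow> ('m \<Rightarrow> real) set" where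
  "annihilator S d z A = {f \<in> Lip0 S d z. \<forall>\<mu>\<in>A. \<mu> f = 0}"

definition orbit_cl :: "('g, 'c) monoid_scheme \<Rightarrow> 'm set \<Rightarrow> ('m \<Rightarrow> 'm \<Rightarrow> real) \<Rightarrow> ('g \<Rightarrow> 'm \<Rightarrow> 'm) \<Rightarrow> 'm \<Rightarrow> 'm set" where
  "orbit_cl G S d \<phi> x = (Metric_space.mtopology S d) closure_of (orbit G \<phi> x)"

definition quot_space :: "('g, 'c) monoid_scheme \<Rightarrow> 'm set \<Rightarrow> ('m \<Rightarrow> 'm \<Rightarrow> real) \<Rightarrow> ('g \<Rightarrow> 'm \<Rightarrow> 'm) \<Rightarrow> 'm set set" where
  "quot_space G S d \<phi> = orbit_cl G S d \<phi> ` S"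

definition quot_dist :: "('m \<Rightarrow> 'm \<Rightarrow> real) \<Rightarrow> 'm set \<Rightarrow> 'm set \<Rightarrow> real" where
  "quot_dist d A B = Inf {d x y | x y. x \<in> A \<and> y \<in> B}"

end

theory Submission
  imports Defs
begin

text \<open>Averaging a Lipschitz function over the group, \<open>P f x = M (g \<mapsto> f (g x) - f (g 0))\<close>, is a contractive
  projection onto the invariant functions: bounded orbits make \<open>g \<mapsto> f (g x)\<close> bounded, and right
  invariance of the mean gives \<open>P f (h x) = P f x\<close>. On \<open>F(M)\<close> one has \<open>R_G \<mu> = \<mu> \<circ> P\<close>. By the
  Hahn--Banach theorem the distance from \<open>\<mu>\<close> to the span of the \<open>\<delta> (g x) - \<delta> x\<close> is attained by a
  Lipschitz function of constant at most 1 that kills this span, hence is invariant, so the distance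
  is at most \<open>\<parallel>R_G \<mu>\<parallel>\<close>. This yields the kernel, and lifting small images to small vectors yields
  closedness of the range and surjectivity of the push-forward \<open>R_G[F(M)] \<rightarrow> F(M/G)\<close>, which is isometric
  because invariant functions are the Lipschitz functions on the quotient. In (2), a second application
  of Hahn--Banach shows that \<open>R_G \<mu>\<close> is a limit of elements of \<open>I_G\<close>.\<close>

text \<open>The two kinds of mean live on different function spaces. They meet on the bounded
  functions satisfying \<open>unif_cont_l\<close>: in an SIN group these are uniformly continuous on
  both sides, and in the locally compact case they are continuous and hence lie in
  \<open>Linf\<close>. The averaging argument therefore runs over an abstract space \<open>E\<close>
  of functions on the group. Closure of \<open>E\<close> under uniform limits lets
  \<open>g \<mapsto> Tact S d z \<phi> g \<mu> f\<close> be averaged for every \<open>\<mu>\<close>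
  of the free space, not only for finite combinations of evaluations. Since a mean is not an
  integral of vectors, the average of the \<open>T_g \<mu>\<close> is a priori only a functional on
  Lipschitz functions; that it lies in the free space is what has to be proved in (2). The distance
  estimate makes \<open>RG\<close> isometric on the free space modulo its kernel, and together with
  completeness of the dual this is the openness behind the closed range.\<close>

lemma lin_subspaceD:
  assumes "lin_subspace A" "x \<in> A" "y \<in> A"
  shows lin_subspace_lin: "(\<lambda>t. a * x t + b * y t) \<in> A"
    and lin_subspace_add: "(\<lambda>t. x t + y t) \<in> A"
    and lin_subspace_diff: "(\<lambda>t. x t - y t) \<in> A"
proof -
  show *: "(\<lambda>t. a * x t + b * y t) \<in> A" for a b
    using assms unfolding lin_subspace_def by blast
  show "(\<lambda>t. x t + y t) \<in> A" "(\<lambda>t. x t - y t) \<in> A"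
    using *[of 1 1] *[of 1 "-1"] by simp_all
qed

lemma lin_subspace_scale: "lin_subspace A \<Longrightarrow> x \<in> A \<Longrightarrow> (\<lambda>t. a * x t) \<in> A"
  using lin_subspace_lin[of A x x a 0] by simp

lemma lin_subspace_zero: "lin_subspace A \<Longrightarrow> (\<lambda>_. 0) \<in> A"
  by (simp add: lin_subspace_def)

section \<open>A Hahn--Banach theorem\<close>

text \<open>Homogeneity is asked for positive factors only; the clause on the zero function supplies
  the factor 0.\<close>

definition sublin :: "('b \<Rightarrow> real) set \<Rightarrow> (('b \<Rightarrow> real) \<Rightarrow> real) \<Rightarrow> bool" where
  "sublin E p \<longleftrightarrow> p (\<lambda>_. 0) = 0 \<and> (\<forall>x\<in>E. \<forall>y\<in>E. p (\<lambda>t. x t + y t) \<le> p x + p y) \<and>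
     (\<forall>x\<in>E. \<forall>c>0. p (\<lambda>t. c * x t) = c * p x)"

text \<open>One inequality for all positive factors suffices: applied to \<open>c x\<close> with the
  factor \<open>1/c\<close> it gives the reverse one.\<close>

lemma sublinI:
  assumes E: "lin_subspace E" and zero: "p (\<lambda>_. 0) = 0"
    and add: "\<And>x y. x \<in> E \<Longrightarrow> y \<in> E \<Longrightarrow> p (\<lambda>t. x t + y t) \<le> p x + p y"
    and scale: "\<And>x c. x \<in> E \<Longrightarrow> 0 < c \<Longrightarrow> p (\<lambda>t. c * x t) \<le> c * p x"
  shows "sublin E p"
proof -
  have "c * p x \<le> p (\<lambda>t. c * x t)" if "x \<in> E" "0 < c" for x and c :: real
  proof -
    have "p (\<lambda>t. inverse c * (c * x t)) \<le> inverse c * p (\<lambda>t. c * x t)"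
      using that by (intro scale lin_subspace_scale[OF E]) auto
    moreover have "(\<lambda>t. inverse c * (c * x t)) = x"
      using that by auto
    ultimately show ?thesis
      using that by (simp add: field_simps)
  qed
  with assms show ?thesis
    unfolding sublin_def by (auto intro: antisym)
qed

lemma sublin_add: "sublin E p \<Longrightarrow> x \<in> E \<Longrightarrow> y \<in> E \<Longrightarrow> p (\<lambda>t. x t + y t) \<le> p x + p y"
  by (simp add: sublin_def)

lemma sublin_scale: "sublin E p \<Longrightarrow> x \<in> E \<Longrightarrow> 0 < c \<Longrightarrow> p (\<lambda>t. c * x t) = c * p x"
  by (simp add: sublin_def)

text \<open>From \<open>0 = p (x + (-x)) \<le> p x + p (-x)\<close>. This lower bound keeps infima
  of sublinear functionals finite.\<close>

lemma sublin_neg: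
  assumes "lin_subspace E" "sublin E p" "x \<in> E"
  shows "- p (\<lambda>t. - x t) \<le> p x"
  using sublin_add[OF assms(2,3) lin_subspace_scale[OF assms(1,3), of "-1"]] assms(2)
  by (simp add: sublin_def)

text \<open>Replacing \<open>p\<close> by this function forces equality \<open>p (x + y) = p x + p y\<close> in the minimal case.\<close>

definition shrink :: "('b \<Rightarrow> real) set \<Rightarrow> (('b \<Rightarrow> real) \<Rightarrow> real) \<Rightarrow> ('b \<Rightarrow> real) \<Rightarrow> ('b \<Rightarrow> real) \<Rightarrow> real" where
  "shrink E p y x = (if x \<in> E then INF s\<in>{0..}. p (\<lambda>t. x t + s * y t) - s * p y else 0)"

text \<open>The infimum is at least \<open>- p (-x)\<close>, by subadditivity for
  \<open>s y = (x + s y) + (-x)\<close>. Sublinearity follows by adding the parameters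
  \<open>s\<close> and \<open>r\<close> for a sum and by passing from \<open>s\<close> to
  \<open>c s\<close> for a multiple.\<close>

lemma shrink:
  assumes E: "lin_subspace E" and p: "sublin E p" and y: "y \<in> E"
  shows shrink_le: "x \<in> E \<Longrightarrow> 0 \<le> s \<Longrightarrow> shrink E p y x \<le> p (\<lambda>t. x t + s * y t) - s * p y"
    and shrink_sublin: "sublin E (shrink E p y)"
proof -
  have mem: "(\<lambda>t. x t + s * y t) \<in> E" if "x \<in> E" for x s
    using lin_subspace_lin[OF E that y, of 1 s] by simp
  have sc: "p (\<lambda>t. s * y t) = s * p y" if "0 \<le> s" for s
    using p y that by (cases "s = 0") (auto simp: sublin_def)
  have lb: "- p (\<lambda>t. - x t) \<le> p (\<lambda>t. x t + s * y t) - s * p y" if x: "x \<in> E" and s: "0 \<le> s" for x s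
  proof -
    have "p (\<lambda>t. (x t + s * y t) + - x t) \<le> p (\<lambda>t. x t + s * y t) + p (\<lambda>t. - x t)"
      using sublin_add[OF p mem[OF x, of s] lin_subspace_scale[OF E x, of "-1"]] by simp
    then show ?thesis
      using sc[OF s] by (simp add: algebra_simps)
  qed
  have bdd: "bdd_below ((\<lambda>s. p (\<lambda>t. x t + s * y t) - s * p y) ` {0..})" if "x \<in> E" for x
    using lb[OF that] by (auto intro!: bdd_belowI)
  show le: "shrink E p y x \<le> p (\<lambda>t. x t + s * y t) - s * p y" if "x \<in> E" "0 \<le> s" for x s
    using bdd[OF that(1)] that by (auto simp: shrink_def intro!: cINF_lower)
  have ge: "c \<le> shrink E p y x" if "x \<in> E" "\<And>s. 0 \<le> s \<Longrightarrow> c \<le> p (\<lambda>t. x t + s * y t) - s * p y" for x c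
    using that by (auto simp: shrink_def intro!: cINF_greatest)
  show "sublin E (shrink E p y)"
  proof (rule sublinI[OF E])
    have "(\<lambda>s. p (\<lambda>t. s * y t) - s * p y) ` {0..} = {0}"
      using sc by (auto simp: image_iff)
    then show "shrink E p y (\<lambda>_. 0) = 0"
      using lin_subspace_zero[OF E] by (simp add: shrink_def)
  next
    fix x x' assume x: "x \<in> E" "x' \<in> E"
    \<comment> \<open>With \<open>s\<close> fixed the bound passes to the infimum for
      \<open>x'\<close>; rearranged, it then passes to the infimum for \<open>x\<close>.\<close>
    have "shrink E p y (\<lambda>t. x t + x' t) - (p (\<lambda>t. x t + s * y t) - s * p y) \<le> shrink E p y x'"
      if "0 \<le> s" for s
    proof (rule ge[OF x(2)])
      fix r :: real assume r: "0 \<le> r"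
      have "shrink E p y (\<lambda>t. x t + x' t) \<le> p (\<lambda>t. (x t + x' t) + (s + r) * y t) - (s + r) * p y"
        using r that x by (intro le lin_subspace_add[OF E]) auto
      also have "(\<lambda>t. (x t + x' t) + (s + r) * y t) = (\<lambda>t. (x t + s * y t) + (x' t + r * y t))"
        by (auto simp: algebra_simps)
      also have "p \<dots> \<le> p (\<lambda>t. x t + s * y t) + p (\<lambda>t. x' t + r * y t)"
        by (rule sublin_add[OF p mem[OF x(1)] mem[OF x(2)]])
      finally show "shrink E p y (\<lambda>t. x t + x' t) - (p (\<lambda>t. x t + s * y t) - s * p y)
          \<le> p (\<lambda>t. x' t + r * y t) - r * p y"
        by (simp add: algebra_simps)
    qed
    then have "shrink E p y (\<lambda>t. x t + x' t) - shrink E p y x' \<le> shrink E p y x"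
      by (intro ge[OF x(1)]) (simp add: algebra_simps)
    then show "shrink E p y (\<lambda>t. x t + x' t) \<le> shrink E p y x + shrink E p y x'"
      by simp
  next
    fix x and c :: real assume x: "x \<in> E" and c: "0 < c"
    have "shrink E p y (\<lambda>t. c * x t) / c \<le> shrink E p y x"
    proof (rule ge[OF x])
      fix s :: real assume s: "0 \<le> s"
      have "shrink E p y (\<lambda>t. c * x t) \<le> p (\<lambda>t. c * x t + (c * s) * y t) - (c * s) * p y"
        using s c x by (intro le lin_subspace_scale[OF E]) auto
      also have "(\<lambda>t. c * x t + (c * s) * y t) = (\<lambda>t. c * (x t + s * y t))"
        by (auto simp: algebra_simps)
      also have "p \<dots> = c * p (\<lambda>t. x t + s * y t)"
        by (rule sublin_scale[OF p mem[OF x] c])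
      finally show "shrink E p y (\<lambda>t. c * x t) / c \<le> p (\<lambda>t. x t + s * y t) - s * p y"
        using c by (simp add: field_simps)
    qed
    then show "shrink E p y (\<lambda>t. c * x t) \<le> c * shrink E p y x"
      using c by (simp add: field_simps)
  qed
qed

text \<open>Subadditivity uses the chain condition: near-optimal members for \<open>x\<close> and
  for \<open>y\<close> can be replaced by the smaller of the two. The lower bound
  \<open>- p (-x)\<close>, common to all members, makes the infimum finite.\<close>

lemma sublin_Inf_chain:
  assumes E: "lin_subspace E" and p: "sublin E p"
    and C: "C \<noteq> {}" "\<And>q. q \<in> C \<Longrightarrow> sublin E q" "\<And>q x. q \<in> C \<Longrightarrow> x \<in> E \<Longrightarrow> q x \<le> p x"
    and chain: "\<And>q r. q \<in> C \<Longrightarrow> r \<in> C \<Longrightarrow> q \<le> r \<or> r \<le> q"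
  defines "u \<equiv> \<lambda>x. if x \<in> E then INF q\<in>C. q x else 0"
  shows "sublin E u" and "\<And>q x. q \<in> C \<Longrightarrow> x \<in> E \<Longrightarrow> u x \<le> q x"
proof -
  have "- p (\<lambda>t. - x t) \<le> q x" if "x \<in> E" "q \<in> C" for x q
    using sublin_neg[OF E C(2)[OF that(2)] that(1)] C(3)[OF that(2), of "\<lambda>t. - x t"]
      lin_subspace_scale[OF E that(1), of "-1"] by auto
  then have bdd: "bdd_below ((\<lambda>q. q x) ` C)" if "x \<in> E" for x
    using that by (auto intro!: bdd_belowI)
  show le: "u x \<le> q x" if "q \<in> C" "x \<in> E" for q x
    using bdd that by (auto simp: u_def intro!: cINF_lower)
  have ge: "c \<le> u x" if "x \<in> E" "\<And>q. q \<in> C \<Longrightarrow> c \<le> q x" for x c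
    using that C(1) by (auto simp: u_def intro!: cINF_greatest)
  show "sublin E u"
  proof (rule sublinI[OF E])
    have "(\<lambda>q. q (\<lambda>_. 0)) ` C = {0}"
      using C(1,2) by (auto simp: sublin_def image_iff)
    then show "u (\<lambda>_. 0) = 0"
      using lin_subspace_zero[OF E] by (simp add: u_def)
  next
    fix x y assume x: "x \<in> E" "y \<in> E"
    have "u (\<lambda>t. x t + y t) \<le> q x + r y" if q: "q \<in> C" and r: "r \<in> C" for q r
    proof -
      obtain w where w: "w \<in> C" "w \<le> q" "w \<le> r"
        using chain[OF q r] q r by auto
      have "u (\<lambda>t. x t + y t) \<le> w (\<lambda>t. x t + y t)"
        using w x by (intro le lin_subspace_add[OF E])
      also have "\<dots> \<le> w x + w y"
        using C(2)[OF w(1)] x by (auto simp: sublin_def)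
      also have "\<dots> \<le> q x + r y"
        using w by (intro add_mono) (auto simp: le_fun_def)
      finally show ?thesis .
    qed
    then have "u (\<lambda>t. x t + y t) - r y \<le> u x" if "r \<in> C" for r
      using that x by (intro ge) (auto simp: algebra_simps)
    then have "u (\<lambda>t. x t + y t) - u x \<le> u y"
      using x by (intro ge) (auto simp: algebra_simps)
    then show "u (\<lambda>t. x t + y t) \<le> u x + u y"
      by simp
  next
    fix x and c :: real assume x: "x \<in> E" and c: "0 < c"
    have "u (\<lambda>t. c * x t) / c \<le> u x"
    proof (rule ge[OF x])
      fix q assume q: "q \<in> C"
      have "u (\<lambda>t. c * x t) \<le> q (\<lambda>t. c * x t)"
        using q x by (intro le lin_subspace_scale[OF E])
      also have "\<dots> = c * q x"
        using C(2)[OF q] x c by (auto simp: sublin_def)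
      finally show "u (\<lambda>t. c * x t) / c \<le> q x"
        using c by (simp add: field_simps)
    qed
    then show "u (\<lambda>t. c * x t) \<le> c * u x"
      using c by (simp add: field_simps)
  qed
qed

text \<open>Zorn's lemma for the reversed pointwise order, with infima of chains as bounds. The
  functionals in \<open>Q\<close> are set to 0 off \<open>E\<close>, so that comparison on
  \<open>E\<close> becomes comparison of functions.\<close>

lemma exists_minimal_sublin:
  assumes E: "lin_subspace E" and p: "sublin E p"
  shows "\<exists>q. sublin E q \<and> (\<forall>x\<in>E. q x \<le> p x) \<and>
    (\<forall>r. sublin E r \<longrightarrow> (\<forall>x\<in>E. r x \<le> q x) \<longrightarrow> (\<forall>x\<in>E. r x = q x))"
proof -
  define Q where "Q = {q. sublin E q \<and> (\<forall>x\<in>E. q x \<le> p x) \<and> (\<forall>x. x \<notin> E \<longrightarrow> q x = 0)}"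
  define p0 where "p0 = (\<lambda>x. if x \<in> E then p x else 0)"
  have "sublin E p0"
    using p lin_subspaceD[OF E] lin_subspace_scale[OF E] lin_subspace_zero[OF E] unfolding sublin_def p0_def by auto
  then have p0: "p0 \<in> Q"
    by (auto simp: Q_def p0_def)
  have "\<exists>m\<in>Q. \<forall>a\<in>Q. a \<le> m \<longrightarrow> a = m"
  proof (rule predicate_Zorn)
    show "partial_order_on Q (relation_of (\<lambda>a b. b \<le> a) Q)"
      by (rule partial_order_on_relation_ofI) auto
  next
    fix C assume "C \<in> Chains (relation_of (\<lambda>a b. b \<le> a) Q)"
    then have C: "C \<subseteq> Q" "\<And>q r. q \<in> C \<Longrightarrow> r \<in> C \<Longrightarrow> q \<le> r \<or> r \<le> q"
      by (auto simp: Chains_def relation_of_def)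
    show "\<exists>u\<in>Q. \<forall>a\<in>C. u \<le> a"
    proof (cases "C = {}")
      case True
      with p0 show ?thesis by auto
    next
      case False
      let ?u = "\<lambda>x. if x \<in> E then INF q\<in>C. q x else 0"
      have "sublin E ?u" and le: "\<And>q x. q \<in> C \<Longrightarrow> x \<in> E \<Longrightarrow> ?u x \<le> q x"
        using sublin_Inf_chain[OF E p False] C by (auto simp: Q_def subset_iff)
      moreover obtain q where "q \<in> C" "q \<in> Q"
        using False C by auto
      ultimately have "?u \<in> Q"
        using order_trans[OF le] unfolding Q_def by fastforce
      moreover have "?u \<le> a" if "a \<in> C" for a
        using le[OF that] that C(1) by (auto simp: le_fun_def Q_def)
      ultimately show ?thesis by blast
    qed
  qed
  then obtain m where m: "m \<in> Q" and min: "\<And>a. a \<in> Q \<Longrightarrow> a \<le> m \<Longrightarrow> a = m"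
    by blast
  have "r x = m x" if r: "sublin E r" "\<forall>x\<in>E. r x \<le> m x" and x: "x \<in> E" for r x
  proof -
    let ?r = "\<lambda>x. if x \<in> E then r x else 0"
    have "sublin E ?r"
      using r(1) lin_subspaceD[OF E] lin_subspace_scale[OF E] lin_subspace_zero[OF E] unfolding sublin_def by auto
    moreover have "r x \<le> p x" if "x \<in> E" for x
      using r(2) m that by (fastforce simp: Q_def)
    ultimately have "?r = m"
      using r(2) m by (intro min) (auto simp: Q_def le_fun_def)
    then show "r x = m x"
      using x by (auto dest: fun_cong[of _ _ x])
  qed
  with m show ?thesis
    by (auto simp: Q_def)
qed

text \<open>A minimal sublinear \<open>q\<close> is linear: \<open>shrink E q y\<close> lies below
  \<open>q\<close>, hence equals it, and the parameter 1 gives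
  \<open>q x + q y \<le> q (x + y)\<close>. Minimising below \<open>shrink E p x0\<close> instead of
  \<open>p\<close> fixes the value at \<open>x0\<close>, since the parameter 1 at \<open>-x0\<close>
  yields \<open>q (-x0) \<le> - p x0\<close>.\<close>

theorem hahn_banach:
  assumes E: "lin_subspace E" and p: "sublin E p" and x0: "x0 \<in> E"
  shows "\<exists>\<Lambda>. (\<forall>x\<in>E. \<forall>y\<in>E. \<forall>a b. \<Lambda> (\<lambda>t. a * x t + b * y t) = a * \<Lambda> x + b * \<Lambda> y) \<and>
    (\<forall>x\<in>E. \<Lambda> x \<le> p x) \<and> \<Lambda> x0 = p x0"
proof -
  have neg: "(\<lambda>t. - x t) \<in> E" if "x \<in> E" for x
    using lin_subspace_scale[OF E that, of "-1"] by simp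
  obtain q where q: "sublin E q" "\<And>x. x \<in> E \<Longrightarrow> q x \<le> shrink E p x0 x"
    and min: "\<And>r x. sublin E r \<Longrightarrow> \<forall>x\<in>E. r x \<le> q x \<Longrightarrow> x \<in> E \<Longrightarrow> r x = q x"
    using exists_minimal_sublin[OF E shrink_sublin[OF E p x0]] by blast
  have le: "q x \<le> p x" if "x \<in> E" for x
    using q(2)[OF that] shrink_le[OF E p x0 that, of 0] by simp
  have add: "q (\<lambda>t. x t + y t) = q x + q y" if x: "x \<in> E" and y: "y \<in> E" for x y
  proof (rule antisym)
    show "q (\<lambda>t. x t + y t) \<le> q x + q y"
      using q(1) x y by (simp add: sublin_def)
    have "shrink E q y x = q x"
      using shrink_le[OF E q(1) y, of _ 0] by (intro min shrink_sublin[OF E q(1) y] x) auto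
    then show "q x + q y \<le> q (\<lambda>t. x t + y t)"
      using shrink_le[OF E q(1) y x, of 1] by simp
  qed
  have minus: "q (\<lambda>t. - x t) = - q x" if "x \<in> E" for x
    using add[OF that neg[OF that]] q(1) by (simp add: sublin_def)
  have scale: "q (\<lambda>t. a * x t) = a * q x" if x: "x \<in> E" for x a
  proof -
    consider "a = 0" | "a > 0" | "a < 0" by linarith
    then show ?thesis
    proof cases
      case 3
      then have "q (\<lambda>t. - a * x t) = - a * q x"
        using q(1) x unfolding sublin_def by (metis neg_0_less_iff_less)
      then show ?thesis
        using minus[OF lin_subspace_scale[OF E x, of a]] by simp
    qed (use q(1) x in \<open>auto simp: sublin_def\<close>)
  qed
  show ?thesis
  proof (intro exI[of _ q] conjI ballI allI)
    show "q (\<lambda>t. a * x t + b * y t) = a * q x + b * q y" if "x \<in> E" "y \<in> E" for x y a b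
      using that by (simp add: add scale lin_subspaceD[OF E] lin_subspace_scale[OF E])
    show "q x \<le> p x" if "x \<in> E" for x
      by (rule le[OF that])
    have "q (\<lambda>t. - x0 t) \<le> p (\<lambda>t. - x0 t + 1 * x0 t) - 1 * p x0"
      using q(2)[OF neg[OF x0]] shrink_le[OF E p x0 neg[OF x0], of 1] by linarith
    then show "q x0 = p x0"
      using minus[OF x0] le[OF x0] p by (simp add: sublin_def)
  qed
qed

section \<open>Lipschitz functions and the duality pairing\<close>

lemma lincomb_lin:
  assumes "\<phi> \<in> lincomb A" "\<psi> \<in> lincomb A"
  shows "(\<lambda>t. a * \<phi> t + b * \<psi> t) \<in> lincomb A"
proof -
  obtain n :: nat and c u where \<phi>: "\<phi> = (\<lambda>t. \<Sum>i<n. c i * u i t)" "\<forall>i<n. u i \<in> A"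
    using assms(1) unfolding lincomb_def by blast
  obtain m :: nat and c' u' where \<psi>: "\<psi> = (\<lambda>t. \<Sum>i<m. c' i * u' i t)" "\<forall>i<m. u' i \<in> A"
    using assms(2) unfolding lincomb_def by blast
  define e where "e i = (if i < n then a * c i else b * c' (i - n))" for i
  define v where "v i = (if i < n then u i else u' (i - n))" for i
  have "a * \<phi> t + b * \<psi> t = (\<Sum>i<n + m. e i * v i t)" for t
  proof -
    have "(\<Sum>i<n + m. e i * v i t) = (\<Sum>i<n. e i * v i t) + (\<Sum>i<m. e (n + i) * v (n + i) t)"
      by (induction m) (auto simp: add.assoc)
    then show ?thesis
      by (simp add: e_def v_def \<phi> \<psi> sum_distrib_left mult.assoc)
  qed
  moreover have "\<forall>i<n + m. v i \<in> A"
    using \<phi> \<psi> by (auto simp: v_def)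
  ultimately show ?thesis
    unfolding lincomb_def by blast
qed

lemma lin_subspace_lincomb: "lin_subspace (lincomb A)"
proof -
  have "(\<lambda>_. 0) \<in> lincomb A"
    unfolding lincomb_def by (rule CollectI) (rule exI[of _ 0], auto)
  then show ?thesis
    by (simp add: lin_subspace_def lincomb_lin)
qed

lemma lincomb_superset: "A \<subseteq> lincomb A"
proof
  fix \<phi> assume "\<phi> \<in> A"
  then show "\<phi> \<in> lincomb A"
    unfolding lincomb_def
    by (intro CollectI exI[of _ 1] exI[of _ "\<lambda>_. 1"] exI[of _ "\<lambda>_. \<phi>"]) auto
qed

lemma lincomb_minimal:
  assumes "lin_subspace B" "A \<subseteq> B"
  shows "lincomb A \<subseteq> B"
proof -
  have "(\<lambda>t. \<Sum>i<n. c i * u i t) \<in> B" if "\<forall>i<n. u i \<in> A" for n :: nat and c u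
    using that
  proof (induction n)
    case 0
    then show ?case using lin_subspace_zero[OF assms(1)] by simp
  next
    case (Suc n)
    then have "(\<lambda>t. \<Sum>i<n. c i * u i t) \<in> B" "u n \<in> B"
      using assms(2) by auto
    from lin_subspace_lin[OF assms(1) this, of 1 "c n"] show ?case
      by simp
  qed
  then show ?thesis
    by (auto simp: lincomb_def)
qed

text \<open>This is interpreted twice, for the metric space and for the set of orbit closures with
  \<open>quot_dist\<close>. The axioms are what makes the difference quotients meaningful; for the
  quotient they amount to zero distance identifying orbit closures.\<close>

locale lip_space =
  fixes S :: "'a set" and d :: "'a \<Rightarrow> 'a \<Rightarrow> real" and z :: 'a
  assumes base: "z \<in> S"
    and d_refl: "x \<in> S \<Longrightarrow> d x x = 0"
    and d_pos: "x \<in> S \<Longrightarrow> y \<in> S \<Longrightarrow> x \<noteq> y \<Longrightarrow> 0 < d x y"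
begin

abbreviation "L0 \<equiv> Lip0 S d z"
abbreviation "LD \<equiv> LipDual S d z"
abbreviation "FS \<equiv> FreeSp S d z"
abbreviation "lc \<equiv> lipc S d"
abbreviation "dn \<equiv> dnorm S d z"
abbreviation "\<delta> \<equiv> delta S d z"

lemma d_nonneg: "x \<in> S \<Longrightarrow> y \<in> S \<Longrightarrow> 0 \<le> d x y"
  using d_refl d_pos by (cases "x = y") (auto intro: less_imp_le)

lemma Lip0I:
  "f z = 0 \<Longrightarrow> (\<And>x. x \<notin> S \<Longrightarrow> f x = 0) \<Longrightarrow> (\<And>x y. x \<in> S \<Longrightarrow> y \<in> S \<Longrightarrow> \<bar>f x - f y\<bar> \<le> L * d x y) \<Longrightarrow> f \<in> L0"
  unfolding Lip0_def by blast

lemma Lip0_bound: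
  assumes f: "f \<in> L0"
  shows lipc_bound: "x \<in> S \<Longrightarrow> y \<in> S \<Longrightarrow> \<bar>f x - f y\<bar> \<le> lc f * d x y"
    and lipc_nonneg: "0 \<le> lc f"
proof -
  let ?A = "insert 0 {\<bar>f x - f y\<bar> / d x y |x y. x \<in> S \<and> y \<in> S \<and> x \<noteq> y}"
  obtain L where L: "\<And>x y. x \<in> S \<Longrightarrow> y \<in> S \<Longrightarrow> \<bar>f x - f y\<bar> \<le> L * d x y"
    using f unfolding Lip0_def by blast
  have bdd: "bdd_above ?A"
  proof (rule bdd_aboveI)
    fix r assume "r \<in> ?A"
    \<comment> \<open>The constant \<open>L\<close> may be negative when \<open>S\<close> is a
      single point; the maximum also covers the inserted 0.\<close>
    then show "r \<le> max 0 L"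
      using L d_pos by (auto simp: pos_divide_le_eq le_max_iff_disj)
  qed
  show "0 \<le> lc f"
    unfolding lipc_def using bdd by (rule cSup_upper[rotated]) simp
  show "\<bar>f x - f y\<bar> \<le> lc f * d x y" if "x \<in> S" "y \<in> S"
  proof (cases "x = y")
    case True
    then show ?thesis using that d_refl by simp
  next
    case False
    then have "\<bar>f x - f y\<bar> / d x y \<le> lc f"
      unfolding lipc_def using bdd that by (intro cSup_upper) auto
    then show ?thesis
      using d_pos[OF that False] by (simp add: pos_divide_le_eq)
  qed
qed

lemma lipc_le:
  assumes "0 \<le> L" "\<And>x y. x \<in> S \<Longrightarrow> y \<in> S \<Longrightarrow> \<bar>f x - f y\<bar> \<le> L * d x y"
  shows "lc f \<le> L"
  unfolding lipc_def using assms d_pos by (intro cSup_least) (auto simp: pos_divide_le_eq)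

lemma Lip0_abs_le:
  assumes "f \<in> L0" "x \<in> S"
  shows "\<bar>f x\<bar> \<le> lc f * d x z"
  using lipc_bound[OF assms base] assms(1) by (simp add: Lip0_def)

lemma Lip0_lin:
  assumes f: "f \<in> L0" and h: "h \<in> L0"
  shows "(\<lambda>x. a * f x + b * h x) \<in> L0"
proof (rule Lip0I)
  fix x y assume xy: "x \<in> S" "y \<in> S"
  have "a * f x + b * h x - (a * f y + b * h y) = a * (f x - f y) + b * (h x - h y)"
    by (simp add: algebra_simps)
  then have "\<bar>a * f x + b * h x - (a * f y + b * h y)\<bar> \<le> \<bar>a * (f x - f y)\<bar> + \<bar>b * (h x - h y)\<bar>"
    by (simp add: abs_triangle_ineq)
  also have "\<dots> \<le> \<bar>a\<bar> * (lc f * d x y) + \<bar>b\<bar> * (lc h * d x y)"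
    using lipc_bound[OF f xy] lipc_bound[OF h xy] by (auto simp: abs_mult intro!: add_mono mult_left_mono)
  finally show "\<bar>a * f x + b * h x - (a * f y + b * h y)\<bar> \<le> (\<bar>a\<bar> * lc f + \<bar>b\<bar> * lc h) * d x y"
    by (simp add: algebra_simps)
qed (use f h in \<open>auto simp: Lip0_def\<close>)

lemma lin_subspace_Lip0: "lin_subspace L0"
  unfolding lin_subspace_def using Lip0_lin by (auto intro: Lip0I[of _ 0])

lemma LipDualI:
  assumes "\<And>f. f \<notin> L0 \<Longrightarrow> \<phi> f = 0"
    and "\<And>f h a b. f \<in> L0 \<Longrightarrow> h \<in> L0 \<Longrightarrow> \<phi> (\<lambda>x. a * f x + b * h x) = a * \<phi> f + b * \<phi> h"
    and "\<And>f. f \<in> L0 \<Longrightarrow> \<bar>\<phi> f\<bar> \<le> C * lc f"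
  shows "\<phi> \<in> LD"
  using assms unfolding LipDual_def by blast

lemma LipDual_lin: "\<phi> \<in> LD \<Longrightarrow> f \<in> L0 \<Longrightarrow> h \<in> L0 \<Longrightarrow> \<phi> (\<lambda>x. a * f x + b * h x) = a * \<phi> f + b * \<phi> h"
  unfolding LipDual_def by blast

lemma LipDual_outside: "\<phi> \<in> LD \<Longrightarrow> f \<notin> L0 \<Longrightarrow> \<phi> f = 0"
  unfolding LipDual_def by blast

lemma LipDual_eqI: "\<phi> \<in> LD \<Longrightarrow> \<psi> \<in> LD \<Longrightarrow> (\<And>f. f \<in> L0 \<Longrightarrow> \<phi> f = \<psi> f) \<Longrightarrow> \<phi> = \<psi>"
  by (metis LipDual_outside ext)

lemma dnorm_le:
  assumes "0 \<le> C" "\<And>f. f \<in> L0 \<Longrightarrow> \<bar>\<phi> f\<bar> \<le> C * lc f"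
  shows "dn \<phi> \<le> C"
proof -
  have "\<bar>\<phi> f\<bar> \<le> C" if "f \<in> L0" "lc f \<le> 1" for f
    using assms(2)[OF that(1)] mult_left_mono[OF that(2) assms(1)] by simp
  then show ?thesis
    unfolding dnorm_def using assms(1) by (intro cSup_least) auto
qed

text \<open>Membership in \<open>LD\<close> bounds the values on the unit ball, so the supremum
  exists; a general function is scaled into the ball by its Lipschitz constant.\<close>

lemma LipDual_norm:
  assumes \<phi>: "\<phi> \<in> LD"
  shows dnorm_bound: "f \<in> L0 \<Longrightarrow> \<bar>\<phi> f\<bar> \<le> dn \<phi> * lc f"
    and dnorm_nonneg: "0 \<le> dn \<phi>"
proof -
  let ?A = "insert 0 {\<bar>\<phi> f\<bar> |f. f \<in> L0 \<and> lc f \<le> 1}"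
  obtain C where C: "\<And>f. f \<in> L0 \<Longrightarrow> \<bar>\<phi> f\<bar> \<le> C * lc f"
    using \<phi> unfolding LipDual_def by blast
  have bdd: "bdd_above ?A"
  proof (rule bdd_aboveI)
    fix r assume "r \<in> ?A"
    then consider "r = 0" | f where "r = \<bar>\<phi> f\<bar>" "f \<in> L0" "lc f \<le> 1"
      by auto
    then show "r \<le> max 0 C"
    proof cases
      case 2
      have "C * lc f \<le> max 0 C * lc f"
        by (rule mult_right_mono) (use lipc_nonneg[OF 2(2)] in auto)
      also have "\<dots> \<le> max 0 C * 1"
        by (rule mult_left_mono) (use 2 in auto)
      finally show ?thesis
        using C[OF 2(2)] 2(1) by simp
    qed auto
  qed
  show nn: "0 \<le> dn \<phi>"
    unfolding dnorm_def using bdd by (rule cSup_upper[rotated]) simp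
  show "\<bar>\<phi> f\<bar> \<le> dn \<phi> * lc f" if f: "f \<in> L0"
  proof (cases "lc f = 0")
    \<comment> \<open>Such a function cannot be normalised; the bound with \<open>C\<close> forces
      its value to be 0.\<close>
    case True
    then show ?thesis using C[OF f] by simp
  next
    case False
    then have pos: "0 < lc f"
      using lipc_nonneg[OF f] by simp
    define h where "h = (\<lambda>x. inverse (lc f) * f x)"
    have h: "h \<in> L0"
      unfolding h_def by (rule lin_subspace_scale[OF lin_subspace_Lip0 f])
    have "lc h \<le> 1"
    proof (rule lipc_le)
      fix x y assume "x \<in> S" "y \<in> S"
      have "\<bar>h x - h y\<bar> = \<bar>f x - f y\<bar> / lc f"
        using pos by (simp add: h_def right_diff_distrib[symmetric] abs_mult divide_inverse)
      also have "\<dots> \<le> 1 * d x y"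
        using lipc_bound[OF f \<open>x \<in> S\<close> \<open>y \<in> S\<close>] pos by (simp add: pos_divide_le_eq mult.commute)
      finally show "\<bar>h x - h y\<bar> \<le> 1 * d x y" .
    qed simp
    then have "\<bar>\<phi> h\<bar> \<le> dn \<phi>"
      unfolding dnorm_def using bdd h by (intro cSup_upper) auto
    moreover have "\<phi> h = inverse (lc f) * \<phi> f"
      using LipDual_lin[OF \<phi> f f, of "inverse (lc f)" 0] by (simp add: h_def)
    ultimately show ?thesis
      using pos by (simp add: abs_mult field_simps)
  qed
qed

lemma LipDual_comb:
  assumes \<phi>: "\<phi> \<in> LD" and \<psi>: "\<psi> \<in> LD"
  shows LipDual_comb_mem: "(\<lambda>f. a * \<phi> f + b * \<psi> f) \<in> LD"
    and dnorm_comb: "dn (\<lambda>f. a * \<phi> f + b * \<psi> f) \<le> \<bar>a\<bar> * dn \<phi> + \<bar>b\<bar> * dn \<psi>"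
proof -
  have bd: "\<bar>a * \<phi> f + b * \<psi> f\<bar> \<le> (\<bar>a\<bar> * dn \<phi> + \<bar>b\<bar> * dn \<psi>) * lc f" if f: "f \<in> L0" for f
  proof -
    have "\<bar>a * \<phi> f + b * \<psi> f\<bar> \<le> \<bar>a\<bar> * \<bar>\<phi> f\<bar> + \<bar>b\<bar> * \<bar>\<psi> f\<bar>"
      using abs_triangle_ineq[of "a * \<phi> f" "b * \<psi> f"] by (simp add: abs_mult)
    also have "\<dots> \<le> \<bar>a\<bar> * (dn \<phi> * lc f) + \<bar>b\<bar> * (dn \<psi> * lc f)"
      using dnorm_bound[OF \<phi> f] dnorm_bound[OF \<psi> f] by (intro add_mono mult_left_mono) auto
    finally show ?thesis by (simp add: algebra_simps)
  qed
  show "(\<lambda>f. a * \<phi> f + b * \<psi> f) \<in> LD"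
  proof (rule LipDualI)
    show "a * \<phi> (\<lambda>x. s * f x + t * h x) + b * \<psi> (\<lambda>x. s * f x + t * h x)
        = s * (a * \<phi> f + b * \<psi> f) + t * (a * \<phi> h + b * \<psi> h)" if "f \<in> L0" "h \<in> L0" for f h s t
      using that by (simp add: LipDual_lin[OF \<phi>] LipDual_lin[OF \<psi>] algebra_simps)
  qed (use bd in \<open>auto simp: LipDual_outside[OF \<phi>] LipDual_outside[OF \<psi>]\<close>)
  show "dn (\<lambda>f. a * \<phi> f + b * \<psi> f) \<le> \<bar>a\<bar> * dn \<phi> + \<bar>b\<bar> * dn \<psi>"
    using bd dnorm_nonneg[OF \<phi>] dnorm_nonneg[OF \<psi>] by (intro dnorm_le) auto
qed

lemma lin_subspace_LipDual: "lin_subspace LD"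
  unfolding lin_subspace_def using LipDual_comb_mem by (auto intro: LipDualI[of _ 0])

lemmas LipDual_diff = lin_subspace_diff[OF lin_subspace_LipDual]

lemma dnorm_zero: "dn (\<lambda>_. 0) = 0"
  using dnorm_le[of 0 "\<lambda>_. 0"] dnorm_nonneg[OF lin_subspace_zero[OF lin_subspace_LipDual]] by simp

lemma dnorm_add: "\<phi> \<in> LD \<Longrightarrow> \<psi> \<in> LD \<Longrightarrow> dn (\<lambda>f. \<phi> f + \<psi> f) \<le> dn \<phi> + dn \<psi>"
  using dnorm_comb[of \<phi> \<psi> 1 1] by simp

lemma dnorm_scale: "\<phi> \<in> LD \<Longrightarrow> dn (\<lambda>f. c * \<phi> f) \<le> \<bar>c\<bar> * dn \<phi>"
  using dnorm_comb[of \<phi> \<phi> c 0] by simp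

lemma dnorm_triangle:
  assumes "\<phi> \<in> LD" "\<psi> \<in> LD" "\<kappa> \<in> LD"
  shows "dn (\<lambda>f. \<phi> f - \<kappa> f) \<le> dn (\<lambda>f. \<phi> f - \<psi> f) + dn (\<lambda>f. \<psi> f - \<kappa> f)"
  using dnorm_add[OF LipDual_diff[OF assms(1,2)] LipDual_diff[OF assms(2,3)]] by simp

lemma dnorm_minus_commute:
  assumes "\<phi> \<in> LD" "\<psi> \<in> LD"
  shows "dn (\<lambda>f. \<phi> f - \<psi> f) = dn (\<lambda>f. \<psi> f - \<phi> f)"
  using dnorm_scale[OF LipDual_diff[OF assms], of "-1"] dnorm_scale[OF LipDual_diff[OF assms(2,1)], of "-1"]
  by simp

lemma dnorm_diff_bound:
  assumes "\<phi> \<in> LD" "\<psi> \<in> LD" "f \<in> L0"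
  shows "\<bar>\<phi> f - \<psi> f\<bar> \<le> dn (\<lambda>f. \<phi> f - \<psi> f) * lc f"
  using dnorm_bound[OF LipDual_diff[OF assms(1,2)] assms(3)] .

lemma delta_apply: "f \<in> L0 \<Longrightarrow> \<delta> x f = f x"
  by (simp add: delta_def)

lemma delta_LipDual: "x \<in> S \<Longrightarrow> \<delta> x \<in> LD"
  using Lip0_lin Lip0_abs_le
  by (intro LipDualI[where C = "d x z"]) (auto simp: delta_def mult.commute)

lemma delta_base: "\<delta> z = (\<lambda>_. 0)"
  by (auto simp: delta_def Lip0_def)

lemma dnorm_delta_diff:
  assumes "x \<in> S" "y \<in> S"
  shows "dn (\<lambda>f. \<delta> x f - \<delta> y f) \<le> d x y"
  using assms lipc_bound d_nonneg by (intro dnorm_le) (auto simp: delta_apply mult.commute)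

subsection \<open>Closed spans\<close>

abbreviation "closed_sub \<equiv> closed_subspace_dual S d z"

lemma closed_subD:
  assumes "closed_sub A"
  shows closed_sub_LD: "A \<subseteq> LD" and closed_sub_lin: "lin_subspace A"
    and closed_sub_lim: "\<phi> \<in> LD \<Longrightarrow> (\<And>\<epsilon>. 0 < \<epsilon> \<Longrightarrow> \<exists>\<psi>\<in>A. dn (\<lambda>f. \<phi> f - \<psi> f) < \<epsilon>) \<Longrightarrow> \<phi> \<in> A"
  using assms unfolding closed_subspace_dual_def by auto

lemma cspanD:
  assumes "\<phi> \<in> cspan S d z A"
  shows cspan_LipDual: "\<phi> \<in> LD" and cspan_approx: "0 < \<epsilon> \<Longrightarrow> \<exists>\<psi>\<in>lincomb A. dn (\<lambda>f. \<phi> f - \<psi> f) < \<epsilon>"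
  using assms unfolding cspan_def by auto

lemma lincomb_LipDual: "A \<subseteq> LD \<Longrightarrow> lincomb A \<subseteq> LD"
  by (rule lincomb_minimal[OF lin_subspace_LipDual])

lemma lincomb_cspan:
  assumes "A \<subseteq> LD"
  shows "lincomb A \<subseteq> cspan S d z A"
  using lincomb_LipDual[OF assms] dnorm_zero unfolding cspan_def by force

lemma closed_sub_cspan:
  assumes A: "A \<subseteq> LD"
  shows "closed_sub (cspan S d z A)"
  unfolding closed_subspace_dual_def
proof (intro conjI ballI impI)
  note lcA = subsetD[OF lincomb_LipDual[OF A]]
  show "cspan S d z A \<subseteq> LD"
    by (auto simp: cspan_def)
  show "lin_subspace (cspan S d z A)"
    unfolding lin_subspace_def
  proof (intro conjI ballI allI)
    show "(\<lambda>_. 0) \<in> cspan S d z A"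
      using lincomb_cspan[OF A] lin_subspace_zero[OF lin_subspace_lincomb] by blast
    fix \<phi> \<psi> and a b :: real
    assume \<phi>: "\<phi> \<in> cspan S d z A" and \<psi>: "\<psi> \<in> cspan S d z A"
    note LD = cspan_LipDual[OF \<phi>] cspan_LipDual[OF \<psi>]
    have "\<exists>\<kappa>\<in>lincomb A. dn (\<lambda>f. (a * \<phi> f + b * \<psi> f) - \<kappa> f) < \<epsilon>" if \<epsilon>: "0 < \<epsilon>" for \<epsilon>
    proof -
      \<comment> \<open>The summand 1 keeps the divisor positive when \<open>a = b = 0\<close> and
        makes the final estimate strict.\<close>
      define \<eta> where "\<eta> = \<epsilon> / (\<bar>a\<bar> + \<bar>b\<bar> + 1)"
      have pos: "0 < \<bar>a\<bar> + \<bar>b\<bar> + 1" by linarith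
      with \<epsilon> have \<eta>: "0 < \<eta>" by (simp add: \<eta>_def)
      obtain \<phi>' where \<phi>': "\<phi>' \<in> lincomb A" "dn (\<lambda>f. \<phi> f - \<phi>' f) < \<eta>"
        using cspan_approx[OF \<phi> \<eta>] by blast
      obtain \<psi>' where \<psi>': "\<psi>' \<in> lincomb A" "dn (\<lambda>f. \<psi> f - \<psi>' f) < \<eta>"
        using cspan_approx[OF \<psi> \<eta>] by blast
      have "(\<lambda>f. (a * \<phi> f + b * \<psi> f) - (a * \<phi>' f + b * \<psi>' f)) = (\<lambda>f. a * (\<phi> f - \<phi>' f) + b * (\<psi> f - \<psi>' f))"
        by (simp add: algebra_simps)
      then have "dn (\<lambda>f. (a * \<phi> f + b * \<psi> f) - (a * \<phi>' f + b * \<psi>' f))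
          \<le> \<bar>a\<bar> * dn (\<lambda>f. \<phi> f - \<phi>' f) + \<bar>b\<bar> * dn (\<lambda>f. \<psi> f - \<psi>' f)"
        using dnorm_comb[OF LipDual_diff[OF LD(1) lcA[OF \<phi>'(1)]] LipDual_diff[OF LD(2) lcA[OF \<psi>'(1)]]]
        by simp
      also have "\<dots> \<le> \<bar>a\<bar> * \<eta> + \<bar>b\<bar> * \<eta>"
        using \<phi>' \<psi>' by (intro add_mono mult_left_mono) auto
      also have "\<dots> < (\<bar>a\<bar> + \<bar>b\<bar> + 1) * \<eta>"
        using \<eta> by (simp add: algebra_simps)
      also have "\<dots> = \<epsilon>"
        using pos by (simp add: \<eta>_def)
      finally show ?thesis
        by (intro bexI[OF _ lincomb_lin[OF \<phi>'(1) \<psi>'(1)]])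
    qed
    then show "(\<lambda>t. a * \<phi> t + b * \<psi> t) \<in> cspan S d z A"
      using LipDual_comb_mem[OF LD] by (simp add: cspan_def)
  qed
  fix \<phi> assume \<phi>: "\<phi> \<in> LD" and lim: "\<forall>\<epsilon>>0. \<exists>\<psi>\<in>cspan S d z A. dn (\<lambda>f. \<phi> f - \<psi> f) < \<epsilon>"
  have "\<exists>\<kappa>\<in>lincomb A. dn (\<lambda>f. \<phi> f - \<kappa> f) < \<epsilon>" if \<epsilon>: "0 < \<epsilon>" for \<epsilon>
  proof -
    have \<epsilon>2: "0 < \<epsilon> / 2" using \<epsilon> by simp
    obtain \<psi> where \<psi>: "\<psi> \<in> cspan S d z A" "dn (\<lambda>f. \<phi> f - \<psi> f) < \<epsilon> / 2"
      using lim \<epsilon>2 by blast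
    obtain \<kappa> where \<kappa>: "\<kappa> \<in> lincomb A" "dn (\<lambda>f. \<psi> f - \<kappa> f) < \<epsilon> / 2"
      using cspan_approx[OF \<psi>(1) \<epsilon>2] by blast
    have "dn (\<lambda>f. \<phi> f - \<kappa> f) < \<epsilon>"
      using dnorm_triangle[OF \<phi> cspan_LipDual[OF \<psi>(1)] lcA[OF \<kappa>(1)]] \<psi>(2) \<kappa>(2) by simp
    with \<kappa>(1) show ?thesis by blast
  qed
  with \<phi> show "\<phi> \<in> cspan S d z A"
    by (simp add: cspan_def)
qed

lemma cspan_minimal:
  assumes B: "closed_sub B" and A: "A \<subseteq> B"
  shows "cspan S d z A \<subseteq> B"
proof
  fix \<phi> assume \<phi>: "\<phi> \<in> cspan S d z A"
  have "\<exists>\<psi>\<in>B. dn (\<lambda>f. \<phi> f - \<psi> f) < \<epsilon>" if "0 < \<epsilon>" for \<epsilon>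
    using cspan_approx[OF \<phi> that] lincomb_minimal[OF closed_sub_lin[OF B] A] by blast
  then show "\<phi> \<in> B"
    by (rule closed_sub_lim[OF B cspan_LipDual[OF \<phi>]])
qed

lemma closed_sub_FreeSp: "closed_sub FS"
  unfolding FreeSp_def using delta_LipDual by (intro closed_sub_cspan) auto

lemmas FreeSp_LipDual = subsetD[OF closed_sub_LD[OF closed_sub_FreeSp]]
lemmas lin_subspace_FreeSp = closed_sub_lin[OF closed_sub_FreeSp]

lemma delta_FreeSp: "x \<in> S \<Longrightarrow> \<delta> x \<in> FS"
  unfolding FreeSp_def using delta_LipDual
  by (intro subsetD[OF lincomb_cspan] subsetD[OF lincomb_superset]) auto

text \<open>Induction by density: the elements with property \<open>P\<close> form a closed subspace
  containing the evaluations, and the free space is the smallest one.\<close>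

lemma FreeSp_induct [consumes 1, case_names delta closed]:
  assumes "\<mu> \<in> FS" "\<And>x. x \<in> S \<Longrightarrow> P (\<delta> x)" "closed_sub {\<mu> \<in> FS. P \<mu>}"
  shows "P \<mu>"
proof -
  have "FS \<subseteq> {\<mu> \<in> FS. P \<mu>}"
    unfolding FreeSp_def[of S d z] 
    by (rule cspan_minimal[OF assms(3)[unfolded FreeSp_def]])
      (use assms(2) delta_FreeSp in \<open>auto simp: FreeSp_def\<close>)
  with assms(1) show ?thesis by blast
qed

text \<open>Supplies the \<open>closed\<close> case of the density induction. A limit of elements of
  \<open>FS\<close> stays in \<open>FS\<close>, so the limit premise may speak of
  \<open>\<mu> \<in> FS\<close> only.\<close>

lemma closed_subI_FreeSp:
  assumes "P (\<lambda>_. 0)"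
    and "\<And>\<mu> \<nu> a b. \<mu> \<in> FS \<Longrightarrow> \<nu> \<in> FS \<Longrightarrow> P \<mu> \<Longrightarrow> P \<nu> \<Longrightarrow> P (\<lambda>f. a * \<mu> f + b * \<nu> f)"
    and "\<And>\<mu>. \<mu> \<in> FS \<Longrightarrow> (\<And>\<epsilon>. 0 < \<epsilon> \<Longrightarrow> \<exists>\<nu>\<in>FS. P \<nu> \<and> dn (\<lambda>f. \<mu> f - \<nu> f) < \<epsilon>) \<Longrightarrow> P \<mu>"
  shows "closed_sub {\<mu> \<in> FS. P \<mu>}"
  unfolding closed_subspace_dual_def
proof (intro conjI ballI impI)
  show "{\<mu> \<in> FS. P \<mu>} \<subseteq> LD"
    using FreeSp_LipDual by blast
  show "lin_subspace {\<mu> \<in> FS. P \<mu>}"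
    unfolding lin_subspace_def
    using assms(1,2) lin_subspace_zero[OF lin_subspace_FreeSp] lin_subspace_lin[OF lin_subspace_FreeSp]
    by auto
  fix \<phi> assume \<phi>: "\<phi> \<in> LD" and lim: "\<forall>\<epsilon>>0. \<exists>\<psi>\<in>{\<mu> \<in> FS. P \<mu>}. dn (\<lambda>f. \<phi> f - \<psi> f) < \<epsilon>"
  have "\<phi> \<in> FS"
    using lim by (intro closed_sub_lim[OF closed_sub_FreeSp \<phi>]) auto
  moreover from this have "P \<phi>"
    using lim by (intro assms(3)) auto
  ultimately show "\<phi> \<in> {\<mu> \<in> FS. P \<mu>}" by simp
qed

text \<open>This is the uniqueness half of the duality between the free space and
  \<open>Lip0\<close>: two bounded linear functionals that agree on evaluations agree on their
  closed span. It serves both the functional from Hahn--Banach and the identity between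
  \<open>R\<close> and \<open>P\<close>.\<close>

lemma FreeSp_functional_eq:
  assumes \<mu>: "\<mu> \<in> FS"
    and lin: "\<And>\<mu> \<nu> a b. \<mu> \<in> FS \<Longrightarrow> \<nu> \<in> FS \<Longrightarrow> \<Lambda> (\<lambda>f. a * \<mu> f + b * \<nu> f) = a * \<Lambda> \<mu> + b * \<Lambda> \<nu>"
    and bound: "\<And>\<mu>. \<mu> \<in> FS \<Longrightarrow> \<bar>\<Lambda> \<mu>\<bar> \<le> C * dn \<mu>"
    and f: "f \<in> L0" and delta: "\<And>x. x \<in> S \<Longrightarrow> \<Lambda> (\<delta> x) = f x"
  shows "\<Lambda> \<mu> = \<mu> f"
  using \<mu>
proof (induction rule: FreeSp_induct)
  case (delta x)
  then show ?case using assms(5) f by (simp add: delta_apply)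
next
  case closed
  show ?case
  proof (rule closed_subI_FreeSp)
    have "\<Lambda> (\<lambda>f. 0 * \<delta> z f + 0 * \<delta> z f) = 0 * \<Lambda> (\<delta> z) + 0 * \<Lambda> (\<delta> z)"
      by (intro lin delta_FreeSp base)
    then show "\<Lambda> (\<lambda>_. 0) = 0" by simp
    show "\<Lambda> (\<lambda>f. a * \<mu> f + b * \<nu> f) = a * \<mu> f + b * \<nu> f" if "\<mu> \<in> FS" "\<nu> \<in> FS" "\<Lambda> \<mu> = \<mu> f" "\<Lambda> \<nu> = \<nu> f" for \<mu> \<nu> a b
      using that by (simp add: lin)
    fix \<mu> assume \<mu>: "\<mu> \<in> FS" and lim: "\<And>\<epsilon>. 0 < \<epsilon> \<Longrightarrow> \<exists>\<nu>\<in>FS. \<Lambda> \<nu> = \<nu> f \<and> dn (\<lambda>f. \<mu> f - \<nu> f) < \<epsilon>"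
    have "\<bar>\<Lambda> \<mu> - \<mu> f\<bar> \<le> 0 + \<epsilon>" if \<epsilon>: "0 < \<epsilon>" for \<epsilon>
    proof -
      \<comment> \<open>The error splits into \<open>\<Lambda> \<mu> - \<Lambda> \<nu>\<close> and
        \<open>\<nu> f - \<mu> f\<close>, which contribute \<open>\<bar>C\<bar>\<close> and
        \<open>lc f\<close> times the distance; the summand 1 makes \<open>K\<close>
        positive.\<close>
      define K where "K = \<bar>C\<bar> + lc f + 1"
      have K: "0 < K" using lipc_nonneg[OF f] by (simp add: K_def)
      obtain \<nu> where \<nu>: "\<nu> \<in> FS" "\<Lambda> \<nu> = \<nu> f" "dn (\<lambda>f. \<mu> f - \<nu> f) < \<epsilon> / K"
        using lim[of "\<epsilon> / K"] \<epsilon> K by auto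
      let ?D = "dn (\<lambda>f. \<mu> f - \<nu> f)"
      have D: "0 \<le> ?D"
        by (intro dnorm_nonneg LipDual_diff FreeSp_LipDual \<mu> \<nu>)
      have "\<Lambda> (\<lambda>f. \<mu> f - \<nu> f) = \<Lambda> \<mu> - \<Lambda> \<nu>"
        using lin[OF \<mu> \<nu>(1), of 1 "-1"] by simp
      then have "\<bar>\<Lambda> \<mu> - \<Lambda> \<nu>\<bar> \<le> C * ?D"
        using bound[OF lin_subspace_diff[OF lin_subspace_FreeSp \<mu> \<nu>(1)]] by simp
      also have "C * ?D \<le> \<bar>C\<bar> * ?D"
        using D by (intro mult_right_mono) auto
      finally have "\<bar>\<Lambda> \<mu> - \<mu> f\<bar> \<le> \<bar>C\<bar> * ?D + lc f * ?D"
        using dnorm_diff_bound[OF FreeSp_LipDual[OF \<mu>] FreeSp_LipDual[OF \<nu>(1)] f] \<nu>(2)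
        by (simp add: mult.commute)
      also have "\<dots> \<le> K * ?D"
        using D by (simp add: K_def algebra_simps)
      also have "\<dots> \<le> \<epsilon>"
        using \<nu>(3) K by (simp add: pos_less_divide_eq mult.commute less_imp_le)
      finally show ?thesis by simp
    qed
    then have "\<bar>\<Lambda> \<mu> - \<mu> f\<bar> \<le> 0"
      by (rule field_le_epsilon)
    then show "\<Lambda> \<mu> = \<mu> f" by simp
  qed
qed

subsection \<open>Norming functionals given by Lipschitz functions\<close>

text \<open>The functional on \<open>FS\<close> provided by the Hahn--Banach theorem is evaluation at \<open>f x = \<Lambda> (\<delta> x)\<close>.\<close>

lemma sublin_representation:
  assumes p: "sublin FS p" and le: "\<And>\<nu>. \<nu> \<in> FS \<Longrightarrow> p \<nu> \<le> dn \<nu>" and \<mu>: "\<mu> \<in> FS"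
  shows "\<exists>f\<in>L0. lc f \<le> 1 \<and> (\<forall>\<nu>\<in>FS. \<nu> f \<le> p \<nu>) \<and> \<mu> f = p \<mu>"
proof -
  obtain \<Lambda> where lin: "\<And>\<mu> \<nu> a b. \<mu> \<in> FS \<Longrightarrow> \<nu> \<in> FS \<Longrightarrow> \<Lambda> (\<lambda>f. a * \<mu> f + b * \<nu> f) = a * \<Lambda> \<mu> + b * \<Lambda> \<nu>"
    and \<Lambda>: "\<And>\<nu>. \<nu> \<in> FS \<Longrightarrow> \<Lambda> \<nu> \<le> p \<nu>" "\<Lambda> \<mu> = p \<mu>"
    using hahn_banach[OF lin_subspace_FreeSp p \<mu>] by blast
  have diff: "\<Lambda> (\<lambda>f. \<mu> f - \<nu> f) = \<Lambda> \<mu> - \<Lambda> \<nu>" if "\<mu> \<in> FS" "\<nu> \<in> FS" for \<mu> \<nu>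
    using lin[OF that, of 1 "-1"] by simp
  have bound: "\<bar>\<Lambda> \<nu>\<bar> \<le> 1 * dn \<nu>" if \<nu>: "\<nu> \<in> FS" for \<nu>
  proof -
    have "\<Lambda> (\<lambda>f. - \<nu> f) = - \<Lambda> \<nu>"
      using lin[OF \<nu> \<nu>, of "-1" 0] by simp
    moreover have "(\<lambda>f. - \<nu> f) \<in> FS" "dn (\<lambda>f. - \<nu> f) \<le> dn \<nu>"
      using lin_subspace_scale[OF lin_subspace_FreeSp \<nu>, of "-1"]
        dnorm_scale[OF FreeSp_LipDual[OF \<nu>], of "-1"] by auto
    ultimately show ?thesis
      using \<Lambda>(1)[OF \<nu>] le[OF \<nu>] \<Lambda>(1)[of "\<lambda>f. - \<nu> f"] le[of "\<lambda>f. - \<nu> f"] by linarith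
  qed
  define f where "f x = (if x \<in> S then \<Lambda> (\<delta> x) else 0)" for x
  \<comment> \<open>The constant 1 combines the bound of \<open>\<Lambda>\<close> by the norm with
    the bound of the norm of \<open>\<delta> x - \<delta> y\<close> by \<open>d x y\<close>.\<close>
  have Lip: "\<bar>f x - f y\<bar> \<le> 1 * d x y" if "x \<in> S" "y \<in> S" for x y
    using that bound[OF lin_subspace_diff[OF lin_subspace_FreeSp delta_FreeSp delta_FreeSp], of x y]
      dnorm_delta_diff[of x y] by (simp add: f_def diff delta_FreeSp)
  have "\<Lambda> (\<delta> z) = 0"
    using diff[of "\<delta> z" "\<delta> z"] delta_FreeSp[OF base] by (simp add: delta_base)
  then have f: "f \<in> L0"
    using Lip by (intro Lip0I[of f 1]) (auto simp: f_def)
  have eq: "\<Lambda> \<nu> = \<nu> f" if "\<nu> \<in> FS" for \<nu>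
    by (rule FreeSp_functional_eq[OF that lin bound f]) (auto simp: f_def)
  show ?thesis
    using f Lip \<Lambda> \<mu> eq by (intro bexI[of _ f]) (auto intro!: lipc_le)
qed

section \<open>Quotient seminorms and completeness of the dual\<close>

definition cdist :: "(('a \<Rightarrow> real) \<Rightarrow> real) set \<Rightarrow> (('a \<Rightarrow> real) \<Rightarrow> real) \<Rightarrow> real" where
  "cdist N \<phi> = (INF \<eta>\<in>N. dn (\<lambda>f. \<phi> f - \<eta> f))"

lemma cdist:
  assumes N: "lin_subspace N" "N \<subseteq> LD" and \<phi>: "\<phi> \<in> LD"
  shows cdist_le: "\<eta> \<in> N \<Longrightarrow> cdist N \<phi> \<le> dn (\<lambda>f. \<phi> f - \<eta> f)"
    and cdist_nonneg: "0 \<le> cdist N \<phi>"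
    and cdist_approx: "cdist N \<phi> < r \<Longrightarrow> \<exists>\<eta>\<in>N. dn (\<lambda>f. \<phi> f - \<eta> f) < r"
proof -
  have nn: "0 \<le> dn (\<lambda>f. \<phi> f - \<eta> f)" if "\<eta> \<in> N" for \<eta>
    using that N \<phi> by (intro dnorm_nonneg LipDual_diff) auto
  then have bdd: "bdd_below ((\<lambda>\<eta>. dn (\<lambda>f. \<phi> f - \<eta> f)) ` N)"
    by (intro bdd_belowI[of _ 0]) auto
  have ne: "N \<noteq> {}"
    using lin_subspace_zero[OF N(1)] by auto
  show "cdist N \<phi> \<le> dn (\<lambda>f. \<phi> f - \<eta> f)" if "\<eta> \<in> N"
    unfolding cdist_def by (rule cINF_lower[OF bdd that])
  show "0 \<le> cdist N \<phi>"
    unfolding cdist_def by (rule cINF_greatest[OF ne nn])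
  show "\<exists>\<eta>\<in>N. dn (\<lambda>f. \<phi> f - \<eta> f) < r" if "cdist N \<phi> < r"
    using that cINF_less_iff[OF ne bdd] unfolding cdist_def by blast
qed

text \<open>A quotient seminorm composed with a linear map. The map \<open>R\<close> is a parameter
  because two cases occur: the inclusion, for the kernel, and the averaging operator, for the
  invariant vectors. Near-best approximants with an extra \<epsilon> are used, as the infimum need
  not be attained.\<close>

lemma sublin_cdist:
  assumes N: "lin_subspace N" "N \<subseteq> LD" and E: "lin_subspace E"
    and R: "\<And>\<mu>. \<mu> \<in> E \<Longrightarrow> R \<mu> \<in> LD"
      "\<And>\<mu> \<nu> a b. \<mu> \<in> E \<Longrightarrow> \<nu> \<in> E \<Longrightarrow> R (\<lambda>f. a * \<mu> f + b * \<nu> f) = (\<lambda>f. a * R \<mu> f + b * R \<nu> f)"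
  shows "sublin E (\<lambda>\<mu>. cdist N (R \<mu>))"
proof (rule sublinI[OF E])
  have R0: "R (\<lambda>_. 0) = (\<lambda>_. 0)"
    using R(2)[OF lin_subspace_zero[OF E] lin_subspace_zero[OF E], of 0 0] by simp
  have "cdist N (\<lambda>_. 0) \<le> dn (\<lambda>f. 0 - 0)"
    by (rule cdist_le[OF N lin_subspace_zero[OF lin_subspace_LipDual] lin_subspace_zero[OF N(1)]])
  then show "cdist N (R (\<lambda>_. 0)) = 0"
    using cdist_nonneg[OF N lin_subspace_zero[OF lin_subspace_LipDual]] by (simp add: R0 dnorm_zero)
next
  fix \<mu> \<nu> assume \<mu>: "\<mu> \<in> E" and \<nu>: "\<nu> \<in> E"
  have RD: "R (\<lambda>t. \<mu> t + \<nu> t) = (\<lambda>f. R \<mu> f + R \<nu> f)"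
    using R(2)[OF \<mu> \<nu>, of 1 1] by simp
  have mem: "(\<lambda>f. R \<mu> f + R \<nu> f) \<in> LD"
    by (rule lin_subspace_add[OF lin_subspace_LipDual R(1)[OF \<mu>] R(1)[OF \<nu>]])
  show "cdist N (R (\<lambda>t. \<mu> t + \<nu> t)) \<le> cdist N (R \<mu>) + cdist N (R \<nu>)"
  proof (rule field_le_epsilon)
    fix \<epsilon> :: real assume \<epsilon>: "0 < \<epsilon>"
    obtain \<eta> where \<eta>: "\<eta> \<in> N" "dn (\<lambda>f. R \<mu> f - \<eta> f) < cdist N (R \<mu>) + \<epsilon> / 2"
      using cdist_approx[OF N R(1)[OF \<mu>], of "cdist N (R \<mu>) + \<epsilon> / 2"] \<epsilon> by auto
    obtain \<theta> where \<theta>: "\<theta> \<in> N" "dn (\<lambda>f. R \<nu> f - \<theta> f) < cdist N (R \<nu>) + \<epsilon> / 2"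
      using cdist_approx[OF N R(1)[OF \<nu>], of "cdist N (R \<nu>) + \<epsilon> / 2"] \<epsilon> by auto
    have "cdist N (R (\<lambda>t. \<mu> t + \<nu> t)) \<le> dn (\<lambda>f. (R \<mu> f + R \<nu> f) - (\<eta> f + \<theta> f))"
      unfolding RD by (rule cdist_le[OF N mem lin_subspace_add[OF N(1) \<eta>(1) \<theta>(1)]])
    also have "(\<lambda>f. (R \<mu> f + R \<nu> f) - (\<eta> f + \<theta> f)) = (\<lambda>f. (R \<mu> f - \<eta> f) + (R \<nu> f - \<theta> f))"
      by (simp add: algebra_simps)
    also have "dn \<dots> \<le> dn (\<lambda>f. R \<mu> f - \<eta> f) + dn (\<lambda>f. R \<nu> f - \<theta> f)"
      using N(2) \<eta> \<theta> R(1) \<mu> \<nu> by (intro dnorm_add LipDual_diff) auto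
    finally show "cdist N (R (\<lambda>t. \<mu> t + \<nu> t)) \<le> cdist N (R \<mu>) + cdist N (R \<nu>) + \<epsilon>"
      using \<eta>(2) \<theta>(2) by linarith
  qed
next
  fix \<mu> and c :: real assume \<mu>: "\<mu> \<in> E" and c: "0 < c"
  have RD: "R (\<lambda>t. c * \<mu> t) = (\<lambda>f. c * R \<mu> f)"
    using R(2)[OF \<mu> \<mu>, of c 0] by simp
  have mem: "(\<lambda>f. c * R \<mu> f) \<in> LD"
    by (rule lin_subspace_scale[OF lin_subspace_LipDual R(1)[OF \<mu>]])
  show "cdist N (R (\<lambda>t. c * \<mu> t)) \<le> c * cdist N (R \<mu>)"
  proof (rule field_le_epsilon)
    fix \<epsilon> :: real assume \<epsilon>: "0 < \<epsilon>"
    obtain \<eta> where \<eta>: "\<eta> \<in> N" "dn (\<lambda>f. R \<mu> f - \<eta> f) < cdist N (R \<mu>) + \<epsilon> / c"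
      using cdist_approx[OF N R(1)[OF \<mu>], of "cdist N (R \<mu>) + \<epsilon> / c"] \<epsilon> c by auto
    have "cdist N (R (\<lambda>t. c * \<mu> t)) \<le> dn (\<lambda>f. c * R \<mu> f - c * \<eta> f)"
      unfolding RD by (rule cdist_le[OF N mem lin_subspace_scale[OF N(1) \<eta>(1)]])
    also have "(\<lambda>f. c * R \<mu> f - c * \<eta> f) = (\<lambda>f. c * (R \<mu> f - \<eta> f))"
      by (simp add: algebra_simps)
    also have "dn \<dots> \<le> \<bar>c\<bar> * dn (\<lambda>f. R \<mu> f - \<eta> f)"
      using N(2) \<eta> R(1) \<mu> by (intro dnorm_scale LipDual_diff) auto
    also have "\<dots> \<le> c * (cdist N (R \<mu>) + \<epsilon> / c)"
      using \<eta>(2) c by simp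
    also have "\<dots> = c * cdist N (R \<mu>) + \<epsilon>"
      using c by (simp add: distrib_left)
    finally show "cdist N (R (\<lambda>t. c * \<mu> t)) \<le> c * cdist N (R \<mu>) + \<epsilon>"
      .
  qed
qed

lemma cdist_le_dnorm:
  assumes N: "lin_subspace N" "N \<subseteq> LD" and \<phi>: "\<phi> \<in> LD"
  shows "cdist N \<phi> \<le> dn \<phi>"
  using cdist_le[OF N \<phi> lin_subspace_zero[OF N(1)]] by simp

text \<open>Pointwise limits exist because the increments are summable; linearity passes to the
  limit, and so does the uniform tail bound. The factor 2 is the sum of the geometric
  series.\<close>

lemma LipDual_complete:
  assumes mem: "\<And>n. \<kappa> n \<in> LD" and step: "\<And>n. dn (\<lambda>f. \<kappa> (Suc n) f - \<kappa> n f) \<le> C * (1/2) ^ n"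
  obtains \<psi> where "\<psi> \<in> LD" "\<And>n. dn (\<lambda>f. \<psi> f - \<kappa> n f) \<le> 2 * C * (1/2) ^ n"
proof -
  have C: "0 \<le> C"
    using step[of 0] dnorm_nonneg[OF LipDual_diff[OF mem mem], of 1 0] by simp
  \<comment> \<open>Keeping the exact partial sum \<open>2 * (1 - (1/2) ^ k)\<close> is what lets
    the induction on \<open>k\<close> close.\<close>
  have tail: "\<bar>\<kappa> (n + k) f - \<kappa> n f\<bar> \<le> 2 * C * (1/2) ^ n * (1 - (1/2) ^ k) * lc f" if f: "f \<in> L0" for f n k
  proof (induction k)
    case (Suc k)
    have "\<bar>\<kappa> (Suc (n + k)) f - \<kappa> (n + k) f\<bar> \<le> C * (1/2) ^ (n + k) * lc f"
      using dnorm_diff_bound[OF mem mem f, of "Suc (n + k)" "n + k"] mult_right_mono[OF step lipc_nonneg[OF f], of "n + k"]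
      by (rule order_trans)
    with Suc have "\<bar>\<kappa> (n + Suc k) f - \<kappa> n f\<bar> \<le>
        C * (1/2) ^ (n + k) * lc f + 2 * C * (1/2) ^ n * (1 - (1/2) ^ k) * lc f"
      by simp
    also have "\<dots> = 2 * C * (1/2) ^ n * (1 - (1/2) ^ Suc k) * lc f"
      by (simp add: power_add field_simps)
    finally show ?case .
  qed simp
  have tail': "\<bar>\<kappa> (n + k) f - \<kappa> n f\<bar> \<le> 2 * C * (1/2) ^ n * lc f" if f: "f \<in> L0" for f n k
  proof -
    have "2 * C * (1/2) ^ n * (1 - (1/2) ^ k) * lc f \<le> 2 * C * (1/2) ^ n * 1 * lc f"
      using C lipc_nonneg[OF f] by (intro mult_right_mono mult_left_mono) auto
    with tail[OF f, of n k] show ?thesis by simp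
  qed
  have conv: "\<exists>l. (\<lambda>n. \<kappa> n f) \<longlonglongrightarrow> l" if f: "f \<in> L0" for f
  proof -
    have "Cauchy (\<lambda>n. \<kappa> n f)"
    proof (rule CauchyI')
      fix e :: real assume e: "0 < e"
      have "(\<lambda>n. 2 * C * (1/2) ^ n * lc f) \<longlonglongrightarrow> 2 * C * 0 * lc f"
        by (intro tendsto_intros LIMSEQ_power_zero) auto
      then have "\<forall>\<^sub>F n in sequentially. 2 * C * (1/2) ^ n * lc f < e"
        using e by (auto dest: order_tendstoD(2))
      then obtain n where n: "2 * C * (1/2) ^ n * lc f < e / 1" "\<And>m. n \<le> m \<Longrightarrow> 2 * C * (1/2) ^ m * lc f < e"
        by (auto simp: eventually_sequentially)
      show "\<exists>M. \<forall>m\<ge>M. \<forall>n>m. dist (\<kappa> m f) (\<kappa> n f) < e"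
      proof (intro exI allI impI)
        fix m k assume "n \<le> m" "m < k"
        then show "dist (\<kappa> m f) (\<kappa> k f) < e"
          using tail'[OF f, of m "k - m"] n(2)[of m] by (simp add: dist_real_def)
      qed
    qed
    then show ?thesis
      by (simp add: Cauchy_convergent_iff convergent_def)
  qed
  define \<psi> where "\<psi> f = (if f \<in> L0 then lim (\<lambda>n. \<kappa> n f) else 0)" for f
  have lim: "(\<lambda>n. \<kappa> n f) \<longlonglongrightarrow> \<psi> f" if "f \<in> L0" for f
    using conv[OF that] that by (auto simp: \<psi>_def limI)
  have bd: "\<bar>\<psi> f - \<kappa> n f\<bar> \<le> 2 * C * (1/2) ^ n * lc f" if f: "f \<in> L0" for f n
  proof (rule LIMSEQ_le_const2)
    show "(\<lambda>k. \<bar>\<kappa> (k + n) f - \<kappa> n f\<bar>) \<longlonglongrightarrow> \<bar>\<psi> f - \<kappa> n f\<bar>"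
      by (intro tendsto_intros LIMSEQ_ignore_initial_segment lim f)
    show "\<exists>N. \<forall>k\<ge>N. \<bar>\<kappa> (k + n) f - \<kappa> n f\<bar> \<le> 2 * C * (1/2) ^ n * lc f"
      using tail'[OF f, of n] by (auto simp: add.commute[of _ n])
  qed
  show ?thesis
  proof (rule that)
    show "\<psi> \<in> LD"
    proof (rule LipDualI)
      show "\<psi> f = 0" if "f \<notin> L0" for f
        using that by (simp add: \<psi>_def)
      show "\<psi> (\<lambda>x. a * f x + b * h x) = a * \<psi> f + b * \<psi> h" if f: "f \<in> L0" and h: "h \<in> L0" for f h a b
      proof (rule LIMSEQ_unique[OF lim[OF Lip0_lin[OF f h]]])
        have "(\<lambda>n. a * \<kappa> n f + b * \<kappa> n h) \<longlonglongrightarrow> a * \<psi> f + b * \<psi> h"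
          by (intro tendsto_intros lim f h)
        then show "(\<lambda>n. \<kappa> n (\<lambda>x. a * f x + b * h x)) \<longlonglongrightarrow> a * \<psi> f + b * \<psi> h"
          by (simp add: LipDual_lin[OF mem f h])
      qed
      show "\<bar>\<psi> f\<bar> \<le> (2 * C + dn (\<kappa> 0)) * lc f" if "f \<in> L0" for f
        using bd[OF that, of 0] dnorm_bound[OF mem that, of 0] by (simp add: algebra_simps)
    qed
    show "dn (\<lambda>f. \<psi> f - \<kappa> n f) \<le> 2 * C * (1/2) ^ n" for n
      using bd C by (intro dnorm_le) auto
  qed
qed

end

text \<open>The factor \<open>C\<close> may have any sign; the estimate is tested at
  \<open>\<epsilon> / (\<bar>C\<bar> + 1)\<close>.\<close>

lemma eq_zero_if_small:
  fixes a C :: real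
  assumes "\<And>\<epsilon>. 0 < \<epsilon> \<Longrightarrow> \<bar>a\<bar> \<le> \<epsilon> * C"
  shows "a = 0"
proof -
  have "\<bar>a\<bar> \<le> 0 + \<epsilon>" if "0 < \<epsilon>" for \<epsilon>
  proof -
    have "\<bar>a\<bar> \<le> \<epsilon> / (\<bar>C\<bar> + 1) * C"
      using that by (intro assms) (auto intro!: divide_pos_pos)
    also have "\<dots> \<le> \<epsilon> / (\<bar>C\<bar> + 1) * (\<bar>C\<bar> + 1)"
      using that by (intro mult_left_mono) auto
    also have "\<dots> = 0 + \<epsilon>"
      by (simp add: add_nonneg_eq_0_iff)
    finally show ?thesis .
  qed
  then have "\<bar>a\<bar> \<le> 0"
    by (rule field_le_epsilon)
  then show ?thesis by simp
qed

section \<open>Averaging over an isometric group action\<close>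

text \<open>The mean appears only on restrictions to the carrier, as in \<open>RG\<close>, while
  members of \<open>E\<close> may take any values outside it. The axiom \<open>E_lim\<close>
  compares functions on the carrier alone, so membership in \<open>E\<close> depends only on the
  values there.\<close>

locale averaged_action = Metric_space S d + group_action G S \<phi>
  for S :: "'m set" and d and G :: "('g, 'c) monoid_scheme" (structure) and \<phi> +
  fixes z :: 'm and Mn :: "('g \<Rightarrow> real) \<Rightarrow> real" and E :: "('g \<Rightarrow> real) set"
  assumes z: "z \<in> S"
    and isom: "g \<in> carrier G \<Longrightarrow> x \<in> S \<Longrightarrow> y \<in> S \<Longrightarrow> d (\<phi> g x) (\<phi> g y) = d x y"
    and E_lin: "h \<in> E \<Longrightarrow> k \<in> E \<Longrightarrow> (\<lambda>g. a * h g + b * k g) \<in> E"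
    and E_one: "(\<lambda>_. 1) \<in> E"
    and E_lim: "(\<And>\<epsilon>. 0 < \<epsilon> \<Longrightarrow> \<exists>k\<in>E. \<forall>g\<in>carrier G. \<bar>h g - k g\<bar> < \<epsilon>) \<Longrightarrow> h \<in> E"
    and E_orbit: "f \<in> Lip0 S d z \<Longrightarrow> x \<in> S \<Longrightarrow> (\<lambda>g. f (\<phi> g x)) \<in> E"
    and avg_lin: "h \<in> E \<Longrightarrow> k \<in> E \<Longrightarrow> Mn (restrict (\<lambda>g. a * h g + b * k g) (carrier G))
        = a * Mn (restrict h (carrier G)) + b * Mn (restrict k (carrier G))"
    and avg_pos: "h \<in> E \<Longrightarrow> (\<And>g. g \<in> carrier G \<Longrightarrow> 0 \<le> h g) \<Longrightarrow> 0 \<le> Mn (restrict h (carrier G))"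
    and avg_one: "Mn (restrict (\<lambda>_. 1) (carrier G)) = 1"
    and avg_right: "h \<in> E \<Longrightarrow> g \<in> carrier G \<Longrightarrow>
        Mn (restrict (\<lambda>x. h (x \<otimes> g)) (carrier G)) = Mn (restrict h (carrier G))"

sublocale averaged_action \<subseteq> lip_space S d z
  by unfold_locales (use z in \<open>auto simp: less_le\<close>)

context averaged_action
begin

abbreviation "avg h \<equiv> Mn (restrict h (carrier G))"
abbreviation "R \<equiv> RG G Mn S d z \<phi>"
abbreviation "P \<equiv> PG_tilde G Mn S d z \<phi>"
abbreviation "LG \<equiv> Lip0G G S d z \<phi>"
abbreviation "translate g f \<equiv> (\<lambda>x. if x \<in> S then f (\<phi> g x) - f (\<phi> g z) else 0)"

lemma is_group: "group G"
  using group_hom by (rule group_hom.axioms(1))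

lemma act_closed: "g \<in> carrier G \<Longrightarrow> x \<in> S \<Longrightarrow> \<phi> g x \<in> S"
  by (rule element_image) auto

lemma avg_cong: "(\<And>g. g \<in> carrier G \<Longrightarrow> h g = k g) \<Longrightarrow> avg h = avg k"
  by (metis restrict_ext)

lemma avg_const: "avg (\<lambda>_. c) = c"
  using avg_lin[OF E_one E_one, of c 0] avg_one by simp

text \<open>Positivity of the mean applied to \<open>C + h\<close> and \<open>C - h\<close>.\<close>

lemma avg_abs_le:
  assumes h: "h \<in> E" and C: "\<And>g. g \<in> carrier G \<Longrightarrow> \<bar>h g\<bar> \<le> C"
  shows "\<bar>avg h\<bar> \<le> C"
proof -
  have "0 \<le> avg (\<lambda>g. C * 1 + 1 * h g)" "0 \<le> avg (\<lambda>g. C * 1 + (-1) * h g)"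
    using C by (intro avg_pos E_lin E_one h; fastforce)+
  then show ?thesis
    unfolding avg_lin[OF E_one h] avg_one by simp
qed

text \<open>Isometries preserve the Lipschitz estimate, and subtracting the constant
  \<open>f (\<phi> g z)\<close> restores the zero at the base point, which the action may
  move.\<close>

lemma translate_Lip0:
  assumes f: "f \<in> L0" and g: "g \<in> carrier G"
  shows translate_mem: "translate g f \<in> L0" and lipc_translate: "lc (translate g f) \<le> lc f"
proof -
  have bd: "\<bar>translate g f x - translate g f y\<bar> \<le> lc f * d x y" if "x \<in> S" "y \<in> S" for x y
    using that lipc_bound[OF f act_closed act_closed, OF g _ g, of x y] isom[OF g] by simp
  show "translate g f \<in> L0"
    using bd base by (intro Lip0I[of _ "lc f"]) auto
  show "lc (translate g f) \<le> lc f"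
    using bd lipc_nonneg[OF f] by (rule lipc_le[rotated])
qed

lemma Tact_apply: "f \<in> L0 \<Longrightarrow> Tact S d z \<phi> g \<mu> f = \<mu> (translate g f)"
  by (simp add: Tact_def)

lemma Tact_bound:
  assumes \<mu>: "\<mu> \<in> LD" and f: "f \<in> L0" and g: "g \<in> carrier G"
  shows "\<bar>Tact S d z \<phi> g \<mu> f\<bar> \<le> dn \<mu> * lc f"
proof -
  have "\<bar>Tact S d z \<phi> g \<mu> f\<bar> \<le> dn \<mu> * lc (translate g f)"
    unfolding Tact_apply[OF f] by (rule dnorm_bound[OF \<mu> translate_mem[OF f g]])
  also have "\<dots> \<le> dn \<mu> * lc f"
    by (rule mult_left_mono[OF lipc_translate[OF f g] dnorm_nonneg[OF \<mu>]])
  finally show ?thesis .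
qed

lemma Tact_lin_left: "Tact S d z \<phi> g (\<lambda>f. a * \<mu> f + b * \<nu> f) f = a * Tact S d z \<phi> g \<mu> f + b * Tact S d z \<phi> g \<nu> f"
  by (simp add: Tact_def)

lemma Tact_diff_bound:
  assumes \<mu>: "\<mu> \<in> LD" and \<nu>: "\<nu> \<in> LD" and f: "f \<in> L0" and g: "g \<in> carrier G"
  shows "\<bar>Tact S d z \<phi> g \<mu> f - Tact S d z \<phi> g \<nu> f\<bar> \<le> dn (\<lambda>f. \<mu> f - \<nu> f) * lc f"
  using Tact_bound[OF LipDual_diff[OF \<mu> \<nu>] f g] by (simp add: Tact_apply[OF f])

lemma Tact_lin_right:
  assumes \<mu>: "\<mu> \<in> LD" and f: "f \<in> L0" and h: "h \<in> L0" and g: "g \<in> carrier G"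
  shows "Tact S d z \<phi> g \<mu> (\<lambda>x. a * f x + b * h x) = a * Tact S d z \<phi> g \<mu> f + b * Tact S d z \<phi> g \<mu> h"
proof -
  have "translate g (\<lambda>x. a * f x + b * h x) = (\<lambda>x. a * translate g f x + b * translate g h x)"
    by (auto simp: algebra_simps)
  then show ?thesis
    using LipDual_lin[OF \<mu> translate_mem[OF f g] translate_mem[OF h g]]
    by (simp add: Tact_apply Lip0_lin f h)
qed

lemma Tact_delta:
  assumes "f \<in> L0" "g \<in> carrier G" "x \<in> S"
  shows "Tact S d z \<phi> g (\<delta> x) f = f (\<phi> g x) - f (\<phi> g z)"
  using assms translate_mem[OF assms(1,2)] by (simp add: Tact_apply delta_apply)

text \<open>For an evaluation the function is a difference of two orbit functions. Approximation in
  \<open>\<mu>\<close> is uniform over the group, because every \<open>T_g\<close> is contractive,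
  so closure of \<open>E\<close> under uniform limits reaches all of \<open>FS\<close>.\<close>

lemma Tact_mem_E:
  assumes \<mu>: "\<mu> \<in> FS" and f: "f \<in> L0"
  shows "(\<lambda>g. Tact S d z \<phi> g \<mu> f) \<in> E"
  using \<mu>
proof (induction rule: FreeSp_induct)
  case (delta x)
  have "(\<lambda>g. 1 * f (\<phi> g x) + (-1) * f (\<phi> g z)) \<in> E"
    by (intro E_lin E_orbit f delta base)
  \<comment> \<open>One approximant serves every \<epsilon>: it agrees with the function on the
    carrier, though perhaps not elsewhere.\<close>
  then show ?case
    using Tact_delta[OF f _ delta] by (intro E_lim) (auto intro!: bexI[rotated])
next
  case closed
  show ?case
  proof (rule closed_subI_FreeSp)
    have "(\<lambda>g. 0 * 1 + 0 * 1 :: real) \<in> E"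
      by (intro E_lin E_one)
    then show "(\<lambda>g. Tact S d z \<phi> g (\<lambda>_. 0) f) \<in> E"
      by (simp add: Tact_def)
    show "(\<lambda>g. Tact S d z \<phi> g (\<lambda>f. a * \<mu> f + b * \<nu> f) f) \<in> E"
      if "(\<lambda>g. Tact S d z \<phi> g \<mu> f) \<in> E" "(\<lambda>g. Tact S d z \<phi> g \<nu> f) \<in> E" for \<mu> \<nu> a b
      unfolding Tact_lin_left using that by (rule E_lin)
    fix \<mu> assume \<mu>: "\<mu> \<in> FS"
      and lim: "\<And>\<epsilon>. 0 < \<epsilon> \<Longrightarrow> \<exists>\<nu>\<in>FS. (\<lambda>g. Tact S d z \<phi> g \<nu> f) \<in> E \<and> dn (\<lambda>f. \<mu> f - \<nu> f) < \<epsilon>"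
    show "(\<lambda>g. Tact S d z \<phi> g \<mu> f) \<in> E"
    proof (rule E_lim)
      fix \<epsilon> :: real assume \<epsilon>: "0 < \<epsilon>"
      have K: "0 < lc f + 1" using lipc_nonneg[OF f] by simp
      then obtain \<nu> where \<nu>: "\<nu> \<in> FS" "(\<lambda>g. Tact S d z \<phi> g \<nu> f) \<in> E" "dn (\<lambda>f. \<mu> f - \<nu> f) < \<epsilon> / (lc f + 1)"
        using lim[of "\<epsilon> / (lc f + 1)"] \<epsilon> by auto
      have "dn (\<lambda>f. \<mu> f - \<nu> f) * lc f \<le> dn (\<lambda>f. \<mu> f - \<nu> f) * (lc f + 1)"
        using dnorm_nonneg[OF LipDual_diff[OF FreeSp_LipDual[OF \<mu>] FreeSp_LipDual[OF \<nu>(1)]]]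
        by (intro mult_left_mono) auto
      also have "\<dots> < \<epsilon>"
        using \<nu>(3) K by (simp add: pos_less_divide_eq)
      finally have "\<bar>Tact S d z \<phi> g \<mu> f - Tact S d z \<phi> g \<nu> f\<bar> < \<epsilon>" if "g \<in> carrier G" for g
        using Tact_diff_bound[OF FreeSp_LipDual[OF \<mu>] FreeSp_LipDual[OF \<nu>(1)] f that] by simp
      with \<nu>(2) show "\<exists>k\<in>E. \<forall>g\<in>carrier G. \<bar>Tact S d z \<phi> g \<mu> f - k g\<bar> < \<epsilon>"
        by (intro bexI[of _ "\<lambda>g. Tact S d z \<phi> g \<nu> f"]) auto
    qed
  qed
qed

subsection \<open>The averaging operators\<close>

lemma RG_apply: "f \<in> L0 \<Longrightarrow> R \<mu> f = avg (\<lambda>g. Tact S d z \<phi> g \<mu> f)"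
  by (simp add: RG_def)

lemma RG_outside: "f \<notin> L0 \<Longrightarrow> R \<mu> f = 0"
  by (simp add: RG_def)

lemma RG_lin:
  assumes "\<mu> \<in> FS" "\<nu> \<in> FS"
  shows "R (\<lambda>f. a * \<mu> f + b * \<nu> f) = (\<lambda>f. a * R \<mu> f + b * R \<nu> f)"
proof
  fix f
  show "R (\<lambda>f. a * \<mu> f + b * \<nu> f) f = a * R \<mu> f + b * R \<nu> f"
    by (cases "f \<in> L0") (simp_all add: RG_apply RG_outside Tact_lin_left avg_lin Tact_mem_E assms)
qed

lemma RG_bound:
  assumes "\<mu> \<in> FS" "f \<in> L0"
  shows "\<bar>R \<mu> f\<bar> \<le> dn \<mu> * lc f"
  unfolding RG_apply[OF assms(2)]
  using Tact_bound[OF FreeSp_LipDual] assms by (intro avg_abs_le Tact_mem_E) auto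

lemma RG_LipDual:
  assumes \<mu>: "\<mu> \<in> FS"
  shows "R \<mu> \<in> LD"
proof (rule LipDualI)
  show "R \<mu> (\<lambda>x. a * f x + b * h x) = a * R \<mu> f + b * R \<mu> h" if f: "f \<in> L0" and h: "h \<in> L0" for f h a b
  proof -
    have "R \<mu> (\<lambda>x. a * f x + b * h x) = avg (\<lambda>g. a * Tact S d z \<phi> g \<mu> f + b * Tact S d z \<phi> g \<mu> h)"
      unfolding RG_apply[OF Lip0_lin[OF f h]]
      by (intro avg_cong Tact_lin_right FreeSp_LipDual \<mu> f h)
    then show ?thesis
      by (simp add: RG_apply f h avg_lin Tact_mem_E \<mu>)
  qed
qed (use RG_bound[OF \<mu>] RG_outside in auto)

lemma dnorm_RG: "\<mu> \<in> FS \<Longrightarrow> dn (R \<mu>) \<le> dn \<mu>"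
  using RG_bound dnorm_nonneg FreeSp_LipDual by (intro dnorm_le) auto

lemma RG_diff: "\<mu> \<in> FS \<Longrightarrow> \<nu> \<in> FS \<Longrightarrow> R (\<lambda>f. \<mu> f - \<nu> f) = (\<lambda>f. R \<mu> f - R \<nu> f)"
  using RG_lin[of \<mu> \<nu> 1 "-1"] by simp

lemma PG_apply:
  assumes "f \<in> L0" "x \<in> S"
  shows "P f x = avg (\<lambda>g. f (\<phi> g x)) - avg (\<lambda>g. f (\<phi> g z))"
proof -
  have "P f x = avg (\<lambda>g. Tact S d z \<phi> g (\<delta> x) f)"
    using assms by (simp add: PG_tilde_def dual_to_lip_def RG_adj_def kappa_dual_def RG_apply)
  also have "\<dots> = avg (\<lambda>g. 1 * f (\<phi> g x) + (-1) * f (\<phi> g z))"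
    using assms by (intro avg_cong) (simp add: Tact_delta)
  also have "\<dots> = avg (\<lambda>g. f (\<phi> g x)) - avg (\<lambda>g. f (\<phi> g z))"
    using assms base by (subst avg_lin) (auto intro: E_orbit)
  finally show ?thesis .
qed

lemma PG_outside: "x \<notin> S \<Longrightarrow> P f x = 0"
  by (simp add: PG_tilde_def dual_to_lip_def)

lemma PG_eq_RG: "x \<in> S \<Longrightarrow> P f x = R (\<delta> x) f"
  by (simp add: PG_tilde_def dual_to_lip_def RG_adj_def kappa_dual_def)

text \<open>Contractivity of \<open>R\<close> tested on \<open>\<delta> x - \<delta> y\<close>,
  whose norm is at most \<open>d x y\<close>.\<close>

lemma PG_Lip0:
  assumes f: "f \<in> L0"
  shows PG_mem: "P f \<in> L0" and lipc_PG: "lc (P f) \<le> lc f"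
proof -
  have bd: "\<bar>P f x - P f y\<bar> \<le> lc f * d x y" if xy: "x \<in> S" "y \<in> S" for x y
  proof -
    have D: "(\<lambda>f. \<delta> x f - \<delta> y f) \<in> FS"
      using xy by (intro lin_subspace_diff[OF lin_subspace_FreeSp] delta_FreeSp)
    have "\<bar>P f x - P f y\<bar> \<le> dn (\<lambda>f. \<delta> x f - \<delta> y f) * lc f"
      using xy RG_bound[OF D f] by (simp add: PG_eq_RG RG_diff delta_FreeSp)
    also have "\<dots> \<le> d x y * lc f"
      by (rule mult_right_mono[OF dnorm_delta_diff[OF xy] lipc_nonneg[OF f]])
    finally show ?thesis by (simp add: mult.commute)
  qed
  show "P f \<in> L0"
    using bd PG_apply[OF f base] PG_outside by (intro Lip0I[of _ "lc f"]) auto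
  show "lc (P f) \<le> lc f"
    using bd lipc_nonneg[OF f] by (rule lipc_le[rotated])
qed

lemma PG_invariant:
  assumes f: "f \<in> L0"
  shows "P f \<in> LG"
proof -
  have "P f (\<phi> h x) = P f x" if h: "h \<in> carrier G" and x: "x \<in> S" for h x
  proof -
    have "avg (\<lambda>g. f (\<phi> g (\<phi> h x))) = avg (\<lambda>g. f (\<phi> (g \<otimes> h) x))"
      by (intro avg_cong) (simp add: composition_rule[OF x _ h])
    also have "\<dots> = avg (\<lambda>g. f (\<phi> g x))"
      by (rule avg_right[OF E_orbit[OF f x] h])
    finally show ?thesis
      using f x act_closed[OF h x] by (simp add: PG_apply)
  qed
  with PG_mem[OF f] show ?thesis
    by (simp add: Lip0G_def)
qed

lemma Lip0G_Lip0: "f \<in> LG \<Longrightarrow> f \<in> L0"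
  by (simp add: Lip0G_def)

text \<open>The function averaged over the orbit of \<open>x\<close> is constant, and the subtracted
  average is the value 0 at the base point.\<close>

lemma PG_fixes:
  assumes f: "f \<in> LG"
  shows "P f = f"
proof
  fix x
  show "P f x = f x"
  proof (cases "x \<in> S")
    case True
    have const: "avg (\<lambda>g. f (\<phi> g y)) = f y" if "y \<in> S" for y
    proof -
      have "avg (\<lambda>g. f (\<phi> g y)) = avg (\<lambda>_. f y)"
        using f that by (intro avg_cong) (simp add: Lip0G_def)
      then show ?thesis by (simp add: avg_const)
    qed
    from True show ?thesis
      using f base by (simp add: PG_apply Lip0G_Lip0 const) (simp add: Lip0G_def Lip0_def)
  next
    case False
    then show ?thesis
      using f by (simp add: PG_outside Lip0G_def Lip0_def)
  qed
qed

lemma PG_image: "P ` L0 = LG"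
  using PG_invariant PG_fixes Lip0G_Lip0 by (force simp: image_iff)

lemma PG_projection: "is_projection L0 P"
  unfolding is_projection_def
proof (intro conjI ballI allI)
  fix f h and a b :: real assume f: "f \<in> L0" and h: "h \<in> L0"
  show "P (\<lambda>t. a * f t + b * h t) = (\<lambda>s. a * P f s + b * P h s)"
  proof
    fix x
    show "P (\<lambda>t. a * f t + b * h t) x = a * P f x + b * P h x"
      using LipDual_lin[OF RG_LipDual f h] delta_FreeSp
      by (cases "x \<in> S") (simp_all add: PG_eq_RG PG_outside)
  qed
qed (auto intro: PG_mem PG_fixes PG_invariant)

text \<open>For fixed \<open>f\<close>, the left side is a bounded linear functional of
  \<open>\<mu>\<close> whose values on evaluations are those of the Lipschitz function
  \<open>P f\<close>.\<close>

lemma RG_eq_PG: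
  assumes "\<mu> \<in> FS" "f \<in> L0"
  shows "R \<mu> f = \<mu> (P f)"
proof (rule FreeSp_functional_eq[OF assms(1), where C = "lc f"])
  show "\<bar>R \<mu> f\<bar> \<le> lc f * dn \<mu>" if "\<mu> \<in> FS" for \<mu>
    using RG_bound[OF that assms(2)] by (simp add: mult.commute)
qed (use assms PG_mem in \<open>auto simp: RG_lin PG_eq_RG\<close>)

lemma RG_invariant: "\<mu> \<in> FS \<Longrightarrow> f \<in> LG \<Longrightarrow> R \<mu> f = \<mu> f"
  by (simp add: RG_eq_PG Lip0G_Lip0 PG_fixes)

text \<open>By idempotence of \<open>P\<close>, a functional in the range of \<open>R\<close> is
  determined by its values on invariant functions. This is what lets it be transferred to the
  quotient.\<close>

lemma RG_PG: "\<mu> \<in> FS \<Longrightarrow> f \<in> L0 \<Longrightarrow> R \<mu> (P f) = R \<mu> f"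
  by (simp add: RG_eq_PG PG_mem PG_fixes[OF PG_invariant])

subsection \<open>Kernel and range of the averaging operator\<close>

definition orbit_differences :: "(('m \<Rightarrow> real) \<Rightarrow> real) set" where
  "orbit_differences = {(\<lambda>f. \<delta> (\<phi> g x) f - \<delta> x f) |g x. g \<in> carrier G \<and> x \<in> S}"

lemma orbit_differencesD:
  assumes "\<mu> \<in> orbit_differences"
  shows orbit_differences_FreeSp: "\<mu> \<in> FS" and RG_orbit_differences: "R \<mu> = (\<lambda>_. 0)"
proof -
  obtain g x where \<mu>: "\<mu> = (\<lambda>f. \<delta> (\<phi> g x) f - \<delta> x f)" and g: "g \<in> carrier G" and x: "x \<in> S"
    using assms unfolding orbit_differences_def by auto
  note gx = act_closed[OF g x]
  show FS: "\<mu> \<in> FS"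
    unfolding \<mu> by (intro lin_subspace_diff[OF lin_subspace_FreeSp] delta_FreeSp x gx)
  show "R \<mu> = (\<lambda>_. 0)"
  proof
    fix f
    show "R \<mu> f = 0"
    proof (cases "f \<in> L0")
      case True
      then have "R \<mu> f = P f (\<phi> g x) - P f x"
        using RG_eq_PG[OF FS True] by (simp add: \<mu> delta_apply PG_mem)
      then show ?thesis
        using PG_invariant[OF True] g x by (simp add: Lip0G_def)
    qed (simp add: RG_outside)
  qed
qed

lemma lincomb_orbit_differences: "lincomb orbit_differences \<subseteq> {\<mu> \<in> FS. R \<mu> = (\<lambda>_. 0)}"
proof (rule lincomb_minimal)
  have "R (\<lambda>_. 0) = (\<lambda>_. 0)"
    using RG_lin[OF delta_FreeSp delta_FreeSp, of z z 0 0] base by simp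
  then show "lin_subspace {\<mu> \<in> FS. R \<mu> = (\<lambda>_. 0)}"
    unfolding lin_subspace_def
    using lin_subspace_zero[OF lin_subspace_FreeSp] lin_subspace_lin[OF lin_subspace_FreeSp]
    by (auto simp: RG_lin)
qed (use orbit_differencesD in auto)

text \<open>Taking \<open>c = 1\<close> and \<open>c = -1\<close> turns the inequality into
  vanishing on orbit differences. The one-sided form is what domination by a seminorm vanishing
  there delivers.\<close>

lemma invariant_if_nonpos:
  assumes f: "f \<in> L0"
    and le: "\<And>\<mu> c. \<mu> \<in> orbit_differences \<Longrightarrow> c * \<mu> f \<le> 0"
  shows "f \<in> LG"
proof -
  have "f (\<phi> g x) = f x" if "g \<in> carrier G" "x \<in> S" for g x
  proof -
    have "(\<lambda>f. \<delta> (\<phi> g x) f - \<delta> x f) \<in> orbit_differences"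
      using that by (auto simp: orbit_differences_def)
    from le[OF this, of 1] le[OF this, of "-1"] show ?thesis
      using f by (simp add: delta_apply)
  qed
  with f show ?thesis by (simp add: Lip0G_def)
qed

text \<open>Norming \<open>\<mu>\<close> modulo the span of the orbit differences by a Lipschitz function makes that
  function invariant, so that \<open>RG\<close> does not change its value.\<close>

lemma cdist_orbit_differences:
  assumes \<mu>: "\<mu> \<in> FS"
  shows "cdist (lincomb orbit_differences) \<mu> \<le> dn (R \<mu>)"
proof -
  let ?N = "lincomb orbit_differences"
  have N: "lin_subspace ?N" "?N \<subseteq> LD"
    using lin_subspace_lincomb lincomb_orbit_differences FreeSp_LipDual by auto
  have "sublin FS (\<lambda>\<nu>. cdist ?N \<nu>)"
    using sublin_cdist[OF N lin_subspace_FreeSp, of "\<lambda>\<nu>. \<nu>"] FreeSp_LipDual by simp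
  moreover have "cdist ?N \<nu> \<le> dn \<nu>" if "\<nu> \<in> FS" for \<nu>
    by (rule cdist_le_dnorm[OF N FreeSp_LipDual[OF that]])
  ultimately obtain f where f: "f \<in> L0" "lc f \<le> 1" "\<And>\<nu>. \<nu> \<in> FS \<Longrightarrow> \<nu> f \<le> cdist ?N \<nu>" "\<mu> f = cdist ?N \<mu>"
    using sublin_representation[OF _ _ \<mu>] by blast
  \<comment> \<open>All multiples of \<open>\<nu>\<close> lie in the span, where the distance
    dominating \<open>f\<close> is zero.\<close>
  have "c * \<nu> f \<le> 0" if "\<nu> \<in> orbit_differences" for \<nu> c
  proof -
    have mem: "(\<lambda>f. c * \<nu> f) \<in> ?N"
      using lincomb_superset that by (intro lin_subspace_scale[OF N(1), of \<nu>]) auto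
    then have "(\<lambda>f. c * \<nu> f) \<in> FS"
      using lincomb_orbit_differences by blast
    then show ?thesis
      using f(3)[of "\<lambda>f. c * \<nu> f"] cdist_le[OF N FreeSp_LipDual mem] dnorm_zero by fastforce
  qed
  then have "f \<in> LG"
    by (rule invariant_if_nonpos[OF f(1)])
  then have "cdist ?N \<mu> = R \<mu> f"
    using f(4) by (simp add: RG_invariant[OF \<mu>])
  also have "\<dots> \<le> dn (R \<mu>) * lc f"
    using dnorm_bound[OF RG_LipDual[OF \<mu>] f(1)] by simp
  also have "\<dots> \<le> dn (R \<mu>)"
    using mult_left_mono[OF f(2) dnorm_nonneg[OF RG_LipDual[OF \<mu>]]] by simp
  finally show ?thesis .
qed

lemma closed_sub_kernel: "closed_sub {\<mu> \<in> FS. R \<mu> = (\<lambda>_. 0)}"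
proof (rule closed_subI_FreeSp)
  show "R (\<lambda>_. 0) = (\<lambda>_. 0)"
    using lin_subspace_zero[OF lin_subspace_lincomb] lincomb_orbit_differences by blast
  fix \<mu> assume \<mu>: "\<mu> \<in> FS" and lim: "\<And>\<epsilon>. 0 < \<epsilon> \<Longrightarrow> \<exists>\<nu>\<in>FS. R \<nu> = (\<lambda>_. 0) \<and> dn (\<lambda>f. \<mu> f - \<nu> f) < \<epsilon>"
  have "R \<mu> f = 0" if f: "f \<in> L0" for f
  proof (rule eq_zero_if_small)
    fix \<epsilon> :: real assume "0 < \<epsilon>"
    with lim obtain \<nu> where \<nu>: "\<nu> \<in> FS" "R \<nu> = (\<lambda>_. 0)" "dn (\<lambda>f. \<mu> f - \<nu> f) < \<epsilon>"
      by blast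
    have "\<bar>R \<mu> f\<bar> \<le> dn (\<lambda>f. \<mu> f - \<nu> f) * lc f"
      using RG_bound[OF lin_subspace_diff[OF lin_subspace_FreeSp \<mu> \<nu>(1)] f]
      by (simp add: RG_diff \<mu> \<nu>(1,2))
    also have "\<dots> \<le> \<epsilon> * lc f"
      using \<nu>(3) lipc_nonneg[OF f] by (intro mult_right_mono) auto
    finally show "\<bar>R \<mu> f\<bar> \<le> \<epsilon> * lc f" .
  qed
  then show "R \<mu> = (\<lambda>_. 0)"
    using RG_outside by blast
qed (simp add: RG_lin)

text \<open>If \<open>R \<mu>\<close> vanishes, the distance estimate leaves distance 0 to the span,
  which is membership in its closure; the converse is continuity of \<open>R\<close>.\<close>

lemma RG_kernel: "{\<mu> \<in> FS. R \<mu> = (\<lambda>_. 0)} = cspan S d z orbit_differences"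
proof
  have N: "lin_subspace (lincomb orbit_differences)" "lincomb orbit_differences \<subseteq> LD"
    using lin_subspace_lincomb lincomb_orbit_differences FreeSp_LipDual by auto
  show "cspan S d z orbit_differences \<subseteq> {\<mu> \<in> FS. R \<mu> = (\<lambda>_. 0)}"
    using orbit_differencesD by (intro cspan_minimal closed_sub_kernel) auto
  show "{\<mu> \<in> FS. R \<mu> = (\<lambda>_. 0)} \<subseteq> cspan S d z orbit_differences"
  proof (rule subsetI)
    fix \<mu> assume "\<mu> \<in> {\<mu> \<in> FS. R \<mu> = (\<lambda>_. 0)}"
    then have \<mu>: "\<mu> \<in> FS" and "cdist (lincomb orbit_differences) \<mu> \<le> 0"
      using cdist_orbit_differences[of \<mu>] dnorm_zero by auto
    then have "\<exists>\<psi>\<in>lincomb orbit_differences. dn (\<lambda>f. \<mu> f - \<psi> f) < \<epsilon>" if "0 < \<epsilon>" for \<epsilon>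
      using that by (intro cdist_approx[OF N FreeSp_LipDual[OF \<mu>]]) auto
    with FreeSp_LipDual[OF \<mu>] show "\<mu> \<in> cspan S d z orbit_differences"
      by (simp add: cspan_def)
  qed
qed

text \<open>Openness of \<open>R\<close> onto its range with constant 1: a near-best approximant of
  \<open>\<mu>\<close> in the span of orbit differences is subtracted, and \<open>R\<close> does not
  see it. The strict inequality leaves room for an infimum that is not attained.\<close>

lemma RG_lift_small:
  assumes \<mu>: "\<mu> \<in> FS" and small: "dn (R \<mu>) < r"
  obtains \<nu> where "\<nu> \<in> FS" "R \<nu> = R \<mu>" "dn \<nu> < r"
proof -
  have N: "lin_subspace (lincomb orbit_differences)" "lincomb orbit_differences \<subseteq> LD"
    using lin_subspace_lincomb lincomb_orbit_differences FreeSp_LipDual by auto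
  obtain \<eta> where \<eta>: "\<eta> \<in> lincomb orbit_differences" "dn (\<lambda>f. \<mu> f - \<eta> f) < r"
    using cdist_approx[OF N FreeSp_LipDual[OF \<mu>], of r] cdist_orbit_differences[OF \<mu>] small by auto
  then have "\<eta> \<in> FS" "R \<eta> = (\<lambda>_. 0)"
    using lincomb_orbit_differences by auto
  then show ?thesis
    using \<eta>(2) \<mu> by (intro that[of "\<lambda>f. \<mu> f - \<eta> f"] lin_subspace_diff[OF lin_subspace_FreeSp])
      (auto simp: RG_diff)
qed

text \<open>Images converging geometrically are lifted to a geometrically converging sequence in \<open>FS\<close>.\<close>

lemma RG_range_limit:
  assumes \<psi>: "\<psi> \<in> LD" and lim: "\<And>\<epsilon>. 0 < \<epsilon> \<Longrightarrow> \<exists>\<mu>\<in>FS. dn (\<lambda>f. \<psi> f - R \<mu> f) < \<epsilon>"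
  shows "\<psi> \<in> R ` FS"
proof -
  \<comment> \<open>The factor 2 bounds \<open>(1/2) ^ Suc n + (1/2) ^ n\<close>, the distance
    between successive images through \<open>\<psi>\<close>.\<close>
  have "\<exists>\<kappa>. \<forall>n. (\<kappa> n \<in> FS \<and> dn (\<lambda>f. \<psi> f - R (\<kappa> n) f) < (1/2) ^ n) \<and>
      dn (\<lambda>f. \<kappa> (Suc n) f - \<kappa> n f) < 2 * (1/2) ^ n"
  proof (rule dependent_nat_choice)
    show "\<exists>\<mu>. \<mu> \<in> FS \<and> dn (\<lambda>f. \<psi> f - R \<mu> f) < (1/2) ^ 0"
      using lim[of 1] by auto
    fix \<mu> n assume "\<mu> \<in> FS \<and> dn (\<lambda>f. \<psi> f - R \<mu> f) < (1/2) ^ n"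
    then have \<mu>: "\<mu> \<in> FS" and close: "dn (\<lambda>f. \<psi> f - R \<mu> f) < (1/2) ^ n"
      by auto
    obtain \<mu>' where \<mu>': "\<mu>' \<in> FS" "dn (\<lambda>f. \<psi> f - R \<mu>' f) < (1/2) ^ Suc n"
      using lim[of "(1/2) ^ Suc n"] by auto
    have D: "(\<lambda>f. \<mu>' f - \<mu> f) \<in> FS"
      by (rule lin_subspace_diff[OF lin_subspace_FreeSp \<mu>'(1) \<mu>])
    have "dn (R (\<lambda>f. \<mu>' f - \<mu> f)) \<le> dn (\<lambda>f. R \<mu>' f - \<psi> f) + dn (\<lambda>f. \<psi> f - R \<mu> f)"
      unfolding RG_diff[OF \<mu>'(1) \<mu>] by (intro dnorm_triangle RG_LipDual \<psi> \<mu> \<mu>')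
    also have "dn (\<lambda>f. R \<mu>' f - \<psi> f) = dn (\<lambda>f. \<psi> f - R \<mu>' f)"
      by (intro dnorm_minus_commute RG_LipDual \<psi> \<mu>')
    also have "dn (\<lambda>f. \<psi> f - R \<mu>' f) + dn (\<lambda>f. \<psi> f - R \<mu> f) < (1/2) ^ Suc n + (1/2) ^ n"
      using close \<mu>'(2) by linarith
    also have "\<dots> \<le> 2 * (1/2) ^ n"
      by simp
    finally have "dn (R (\<lambda>f. \<mu>' f - \<mu> f)) < 2 * (1/2) ^ n" .
    then obtain \<nu> where \<nu>: "\<nu> \<in> FS" "R \<nu> = R (\<lambda>f. \<mu>' f - \<mu> f)" "dn \<nu> < 2 * (1/2) ^ n"
      by (rule RG_lift_small[OF D])
    \<comment> \<open>The preimage \<open>\<mu>'\<close> may be far from \<open>\<mu>\<close>.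
      Adding the small lift \<open>\<nu>\<close> of the difference of images gives another preimage
      of \<open>R \<mu>'\<close> that is close to \<open>\<mu>\<close>.\<close>
    let ?\<kappa> = "\<lambda>f. \<mu> f + \<nu> f"
    have "?\<kappa> \<in> FS"
      by (rule lin_subspace_add[OF lin_subspace_FreeSp \<mu> \<nu>(1)])
    moreover have "R ?\<kappa> = R \<mu>'"
      using RG_lin[OF \<mu> \<nu>(1), of 1 1] by (simp add: \<nu>(2) RG_diff \<mu> \<mu>'(1))
    moreover have "dn (\<lambda>f. ?\<kappa> f - \<mu> f) < 2 * (1/2) ^ n"
      using \<nu>(3) by simp
    ultimately show "\<exists>\<kappa>. (\<kappa> \<in> FS \<and> dn (\<lambda>f. \<psi> f - R \<kappa> f) < (1/2) ^ Suc n) \<and>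
        dn (\<lambda>f. \<kappa> f - \<mu> f) < 2 * (1/2) ^ n"
      using \<mu>'(2) by (intro exI[of _ ?\<kappa>]) auto
  qed
  then obtain \<kappa> where \<kappa>: "\<And>n. \<kappa> n \<in> FS" "\<And>n. dn (\<lambda>f. \<psi> f - R (\<kappa> n) f) < (1/2) ^ n"
    "\<And>n. dn (\<lambda>f. \<kappa> (Suc n) f - \<kappa> n f) < 2 * (1/2) ^ n"
    by blast
  obtain \<mu> where \<mu>: "\<mu> \<in> LD" "\<And>n. dn (\<lambda>f. \<mu> f - \<kappa> n f) \<le> 2 * 2 * (1/2) ^ n"
    using LipDual_complete[of \<kappa> 2] \<kappa>(1,3) FreeSp_LipDual less_imp_le by blast
  have small: "\<exists>n. C * (1/2) ^ n < \<epsilon>" if "0 < \<epsilon>" "0 < C" for C \<epsilon> :: real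
    using real_arch_pow_inv[of "\<epsilon> / C" "1/2"] that by (auto simp: pos_less_divide_eq mult.commute)
  have FS: "\<mu> \<in> FS"
  proof (rule closed_sub_lim[OF closed_sub_FreeSp \<mu>(1)])
    fix \<epsilon> :: real assume "0 < \<epsilon>"
    with small[of \<epsilon> 4] obtain n where "4 * (1/2) ^ n < \<epsilon>"
      by auto
    with \<mu>(2)[of n] have "dn (\<lambda>f. \<mu> f - \<kappa> n f) < \<epsilon>"
      by simp
    with \<kappa>(1) show "\<exists>\<nu>\<in>FS. dn (\<lambda>f. \<mu> f - \<nu> f) < \<epsilon>" by blast
  qed
  have "R \<mu> f - \<psi> f = 0" if f: "f \<in> L0" for f
  proof (rule eq_zero_if_small)
    fix \<epsilon> :: real assume "0 < \<epsilon>"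
    \<comment> \<open>Four units bound the distance from \<open>\<kappa> n\<close> to its limit, one
      unit the distance from \<open>R (\<kappa> n)\<close> to \<open>\<psi>\<close>.\<close>
    with small[of \<epsilon> 5] obtain n where n: "5 * (1/2) ^ n < \<epsilon>"
      by auto
    have "\<bar>R \<mu> f - R (\<kappa> n) f\<bar> \<le> dn (\<lambda>f. \<mu> f - \<kappa> n f) * lc f"
      using RG_bound[OF lin_subspace_diff[OF lin_subspace_FreeSp FS \<kappa>(1)] f] by (simp add: RG_diff FS \<kappa>(1))
    moreover have "\<bar>\<psi> f - R (\<kappa> n) f\<bar> \<le> dn (\<lambda>f. \<psi> f - R (\<kappa> n) f) * lc f"
      by (intro dnorm_diff_bound RG_LipDual \<psi> \<kappa> f)
    ultimately have "\<bar>R \<mu> f - \<psi> f\<bar> \<le> (dn (\<lambda>f. \<mu> f - \<kappa> n f) + dn (\<lambda>f. \<psi> f - R (\<kappa> n) f)) * lc f"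
      by (simp add: distrib_right)
    also have "\<dots> \<le> \<epsilon> * lc f"
      using \<mu>(2)[of n] \<kappa>(2)[of n] n lipc_nonneg[OF f] by (intro mult_right_mono) auto
    finally show "\<bar>R \<mu> f - \<psi> f\<bar> \<le> \<epsilon> * lc f" .
  qed
  then have "\<psi> = R \<mu>"
    by (intro LipDual_eqI \<psi> RG_LipDual FS) simp
  with FS show ?thesis by blast
qed

lemma RG_range_closed: "closed_sub (R ` FS)"
  unfolding closed_subspace_dual_def
proof (intro conjI ballI impI)
  show "R ` FS \<subseteq> LD"
    using RG_LipDual by blast
  have "(\<lambda>_. 0) \<in> R ` FS"
    using lin_subspace_zero[OF lin_subspace_lincomb] lincomb_orbit_differences by force
  moreover have "(\<lambda>t. a * x t + b * y t) \<in> R ` FS" if "x \<in> R ` FS" "y \<in> R ` FS" for x y a b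
    using that RG_lin[symmetric] lin_subspace_lin[OF lin_subspace_FreeSp] by auto
  ultimately show "lin_subspace (R ` FS)"
    by (simp add: lin_subspace_def)
qed (intro RG_range_limit; blast)

subsection \<open>The invariant vectors\<close>

abbreviation "IX \<equiv> IG G S d z \<phi>"

text \<open>Each condition \<open>T_g \<mu> = \<mu>\<close> survives limits, since
  \<open>T_g\<close> and the identity are both contractive; hence the factor 2 in the
  estimate.\<close>

lemma closed_sub_IG: "closed_sub IX"
  unfolding IG_def
proof (rule closed_subI_FreeSp)
  show "\<forall>g\<in>carrier G. Tact S d z \<phi> g (\<lambda>_. 0) = (\<lambda>_. 0)"
    by (auto simp: Tact_def)
  show "\<forall>g\<in>carrier G. Tact S d z \<phi> g (\<lambda>f. a * \<mu> f + b * \<nu> f) = (\<lambda>f. a * \<mu> f + b * \<nu> f)"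
    if "\<forall>g\<in>carrier G. Tact S d z \<phi> g \<mu> = \<mu>" "\<forall>g\<in>carrier G. Tact S d z \<phi> g \<nu> = \<nu>" for \<mu> \<nu> a b
    using that by (auto simp: Tact_lin_left)
  fix \<mu> assume \<mu>: "\<mu> \<in> FS"
    and lim: "\<And>\<epsilon>. 0 < \<epsilon> \<Longrightarrow> \<exists>\<nu>\<in>FS. (\<forall>g\<in>carrier G. Tact S d z \<phi> g \<nu> = \<nu>) \<and> dn (\<lambda>f. \<mu> f - \<nu> f) < \<epsilon>"
  show "\<forall>g\<in>carrier G. Tact S d z \<phi> g \<mu> = \<mu>"
  proof (intro ballI ext)
    fix g f assume g: "g \<in> carrier G"
    show "Tact S d z \<phi> g \<mu> f = \<mu> f"
    proof (cases "f \<in> L0")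
      case f: True
      have "Tact S d z \<phi> g \<mu> f - \<mu> f = 0"
      proof (rule eq_zero_if_small)
        fix \<epsilon> :: real assume "0 < \<epsilon>"
        with lim obtain \<nu> where \<nu>: "\<nu> \<in> FS" "Tact S d z \<phi> g \<nu> = \<nu>" "dn (\<lambda>f. \<mu> f - \<nu> f) < \<epsilon>"
          using g by blast
        note LD = FreeSp_LipDual[OF \<mu>] FreeSp_LipDual[OF \<nu>(1)]
        have "\<bar>Tact S d z \<phi> g \<mu> f - \<mu> f\<bar> \<le> dn (\<lambda>f. \<mu> f - \<nu> f) * lc f + dn (\<lambda>f. \<mu> f - \<nu> f) * lc f"
          using Tact_diff_bound[OF LD f g] dnorm_diff_bound[OF LD f] unfolding \<nu>(2) by linarith
        also have "\<dots> \<le> \<epsilon> * lc f + \<epsilon> * lc f"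
          using \<nu>(3) lipc_nonneg[OF f] by (intro add_mono mult_right_mono) auto
        finally show "\<bar>Tact S d z \<phi> g \<mu> f - \<mu> f\<bar> \<le> \<epsilon> * (2 * lc f)" by simp
      qed
      then show ?thesis by simp
    next
      case False
      then show ?thesis
        using LipDual_outside[OF FreeSp_LipDual[OF \<mu>]] by (simp add: Tact_def)
    qed
  qed
qed

lemma IG_FreeSp: "\<mu> \<in> IX \<Longrightarrow> \<mu> \<in> FS"
  by (simp add: IG_def)

lemma RG_fixes_IG:
  assumes \<mu>: "\<mu> \<in> IX"
  shows "R \<mu> = \<mu>"
proof (rule LipDual_eqI)
  show "R \<mu> \<in> LD" "\<mu> \<in> LD"
    using \<mu> by (auto intro: RG_LipDual FreeSp_LipDual IG_FreeSp)
  fix f assume f: "f \<in> L0"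
  have "R \<mu> f = avg (\<lambda>_. \<mu> f)"
    unfolding RG_apply[OF f] using \<mu> by (intro avg_cong) (simp add: IG_def)
  then show "R \<mu> f = \<mu> f" by (simp add: avg_const)
qed

text \<open>Let \<open>f\<close> norm \<open>R \<mu>\<close> modulo \<open>IX\<close>, through the
  seminorm \<open>cdist IX (R \<nu>)\<close>. It vanishes on every \<open>\<nu>\<close> with
  \<open>R \<nu> \<in> IX\<close>. Orbit differences are of this kind, so \<open>f\<close> is
  invariant; elements of \<open>IX\<close> are too, being fixed by \<open>R\<close>, so
  \<open>f\<close> annihilates \<open>IX\<close>. The hypothesis leaves \<open>f = 0\<close>, and
  \<open>R \<mu>\<close> has distance 0 from the closed space \<open>IX\<close>.\<close>

lemma RG_into_IG:
  assumes sep: "LG \<inter> annihilator S d z IX = {\<lambda>_. 0}" and \<mu>: "\<mu> \<in> FS"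
  shows "R \<mu> \<in> IX"
proof -
  note I = closed_sub_lin[OF closed_sub_IG] closed_sub_LD[OF closed_sub_IG]
  have "sublin FS (\<lambda>\<nu>. cdist IX (R \<nu>))"
    by (rule sublin_cdist[OF I lin_subspace_FreeSp RG_LipDual RG_lin])
  moreover have "cdist IX (R \<nu>) \<le> dn \<nu>" if "\<nu> \<in> FS" for \<nu>
    using cdist_le_dnorm[OF I RG_LipDual[OF that]] dnorm_RG[OF that] by simp
  ultimately obtain f where f: "f \<in> L0" "lc f \<le> 1" "\<And>\<nu>. \<nu> \<in> FS \<Longrightarrow> \<nu> f \<le> cdist IX (R \<nu>)"
    "\<mu> f = cdist IX (R \<mu>)"
    using sublin_representation[OF _ _ \<mu>] by blast
  have nonpos: "c * \<nu> f \<le> 0" if \<nu>: "\<nu> \<in> FS" and RI: "R \<nu> \<in> IX" for \<nu> c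
  proof -
    have "R (\<lambda>f. c * \<nu> f) = (\<lambda>f. c * R \<nu> f)"
      using RG_lin[OF \<nu> \<nu>, of c 0] by simp
    moreover have "(\<lambda>f. c * R \<nu> f) \<in> IX"
      by (rule lin_subspace_scale[OF I(1) RI])
    moreover have "cdist IX \<eta> \<le> 0" if "\<eta> \<in> IX" for \<eta>
      using cdist_le[OF I _ that, of \<eta>] that I(2) dnorm_zero by auto
    ultimately show ?thesis
      using f(3)[OF lin_subspace_scale[OF lin_subspace_FreeSp \<nu>, of c]] by fastforce
  qed
  have "f \<in> LG"
    using orbit_differencesD lin_subspace_zero[OF I(1)]
    by (intro invariant_if_nonpos[OF f(1)] nonpos) auto
  moreover have "\<eta> f = 0" if "\<eta> \<in> IX" for \<eta>
    using nonpos[OF IG_FreeSp[OF that], of 1] nonpos[OF IG_FreeSp[OF that], of "-1"] that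
    by (simp add: RG_fixes_IG)
  ultimately have "f = (\<lambda>_. 0)"
    using sep f(1) by (auto simp: annihilator_def)
  then have "cdist IX (R \<mu>) = 0"
    using f(4) LipDual_lin[OF FreeSp_LipDual[OF \<mu>] f(1) f(1), of 0 0] by simp
  then show ?thesis
    using cdist_approx[OF I RG_LipDual[OF \<mu>]]
    by (intro closed_sub_lim[OF closed_sub_IG RG_LipDual[OF \<mu>]]) auto
qed

lemma IG_complemented:
  assumes sep: "LG \<inter> annihilator S d z IX = {\<lambda>_. 0}"
  shows "is_projection FS R" and "R ` FS = IX"
proof -
  show "is_projection FS R"
    unfolding is_projection_def
    using RG_into_IG[OF sep] RG_fixes_IG IG_FreeSp by (auto simp: RG_lin)
  show "R ` FS = IX"
    using RG_into_IG[OF sep] RG_fixes_IG IG_FreeSp by (force simp: image_iff)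
qed

end

context averaged_action
begin

subsection \<open>The quotient by orbit closures\<close>

abbreviation "Q \<equiv> quot_space G S d \<phi>"
abbreviation "qd \<equiv> quot_dist d"
abbreviation "\<pi> x \<equiv> orbit_cl G S d \<phi> x"

lemma orbit_cl_iff:
  assumes x: "x \<in> S"
  shows "y \<in> \<pi> x \<longleftrightarrow> y \<in> S \<and> (\<forall>\<epsilon>>0. \<exists>g\<in>carrier G. d (\<phi> g x) y < \<epsilon>)"
proof -
  have "(\<exists>w\<in>orbit G \<phi> x. w \<in> mball y \<epsilon>) \<longleftrightarrow> (\<exists>g\<in>carrier G. d (\<phi> g x) y < \<epsilon>)" if "y \<in> S" for \<epsilon>
    using that x act_closed commute[of y] unfolding orbit_def by auto
  then show ?thesis
    unfolding orbit_cl_def metric_closure_of by blast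
qed

lemma orbit_cl_act: "x \<in> S \<Longrightarrow> g \<in> carrier G \<Longrightarrow> \<phi> g x \<in> \<pi> x"
  using act_closed by (auto simp: orbit_cl_iff intro!: bexI[of _ g])

lemma orbit_cl_refl: "x \<in> S \<Longrightarrow> x \<in> \<pi> x"
  using orbit_cl_act[of x "\<one>"] id_eq_one group.is_monoid[OF is_group]
  by (metis monoid.one_closed restrict_apply')

lemma quot_dist_bdd: "x \<in> S \<Longrightarrow> y \<in> S \<Longrightarrow> bdd_below {d a b |a b. a \<in> \<pi> x \<and> b \<in> \<pi> y}"
  by (intro bdd_belowI[of _ 0]) auto

lemma quot_dist_le: "x \<in> S \<Longrightarrow> y \<in> S \<Longrightarrow> qd (\<pi> x) (\<pi> y) \<le> d x y"
  unfolding quot_dist_def using orbit_cl_refl by (intro cInf_lower quot_dist_bdd) blast+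

lemma quot_dist_nonneg: "x \<in> S \<Longrightarrow> y \<in> S \<Longrightarrow> 0 \<le> qd (\<pi> x) (\<pi> y)"
  unfolding quot_dist_def using orbit_cl_refl by (intro cInf_greatest) auto

text \<open>Applying the isometry of \<open>inv g\<close> leaves a single moving point, so distances
  between two orbits are distances from a point to an orbit.\<close>

lemma d_act_move:
  assumes "g \<in> carrier G" "h \<in> carrier G" "x \<in> S" "y \<in> S"
  shows "d (\<phi> g x) (\<phi> h y) = d x (\<phi> (inv g \<otimes> h) y)"
proof -
  interpret group G by (rule is_group)
  have "\<phi> (inv g \<otimes> h) y = \<phi> (inv g) (\<phi> h y)" "\<phi> (inv g) (\<phi> g x) = x"
    using assms by (simp_all add: composition_rule orbit_sym_aux)
  then show ?thesis
    using isom[of "inv g" "\<phi> g x" "\<phi> h y"] assms act_closed by simp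
qed

lemma quot_dist_approx:
  assumes x: "x \<in> S" and y: "y \<in> S" and less: "qd (\<pi> x) (\<pi> y) < r"
  shows "\<exists>g\<in>carrier G. d x (\<phi> g y) < r"
proof -
  have "{d a b |a b. a \<in> \<pi> x \<and> b \<in> \<pi> y} \<noteq> {}"
    using orbit_cl_refl x y by blast
  then obtain a b where ab: "a \<in> \<pi> x" "b \<in> \<pi> y" "d a b < r"
    using less cInf_less_iff[OF _ quot_dist_bdd[OF x y], of r] unfolding quot_dist_def by blast
  \<comment> \<open>Half of the slack pays for each replacement of a point of the closure by a point
    of the orbit.\<close>
  define e where "e = (r - d a b) / 2"
  have e: "0 < e" using ab by (simp add: e_def)
  obtain g where g: "g \<in> carrier G" "d (\<phi> g x) a < e"
    using ab(1) e x by (auto simp: orbit_cl_iff)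
  obtain h where h: "h \<in> carrier G" "d (\<phi> h y) b < e"
    using ab(2) e y by (auto simp: orbit_cl_iff)
  have S: "a \<in> S" "b \<in> S" "\<phi> g x \<in> S" "\<phi> h y \<in> S"
    using ab g h x y act_closed by (auto simp: orbit_cl_iff)
  have "d (\<phi> g x) (\<phi> h y) \<le> d (\<phi> g x) a + d a b + d b (\<phi> h y)"
    using triangle[OF S(3,1,4)] triangle[OF S(1,2,4)] by linarith
  also have "\<dots> < r"
    using g(2) h(2) commute[of b "\<phi> h y"] by (simp add: e_def field_simps)
  finally have "d x (\<phi> (inv g \<otimes> h) y) < r"
    by (simp add: d_act_move g h x y)
  moreover have "inv g \<otimes> h \<in> carrier G"
    using g h is_group by (simp add: group.subgroup_self subgroup.m_closed subgroup.m_inv_closed)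
  ultimately show ?thesis by blast
qed

text \<open>A point of the closure of \<open>G x\<close> is near some \<open>g x\<close>, and
  \<open>x\<close> is near some \<open>h y\<close>, so it is near \<open>(g h) y\<close>. Used in
  both directions, this separates distinct orbit closures.\<close>

lemma orbit_cl_subset_if_quot_dist_zero:
  assumes x: "x \<in> S" and y: "y \<in> S" and zero: "qd (\<pi> x) (\<pi> y) \<le> 0"
  shows "\<pi> x \<subseteq> \<pi> y"
proof
  fix w assume w: "w \<in> \<pi> x"
  then have wS: "w \<in> S" using x by (simp add: orbit_cl_iff)
  have "\<exists>g\<in>carrier G. d (\<phi> g y) w < \<epsilon>" if \<epsilon>: "0 < \<epsilon>" for \<epsilon>
  proof -
    obtain g where g: "g \<in> carrier G" "d (\<phi> g x) w < \<epsilon> / 2"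
      using w \<epsilon> x by (auto simp: orbit_cl_iff dest: spec[of _ "\<epsilon> / 2"])
    obtain h where h: "h \<in> carrier G" "d x (\<phi> h y) < \<epsilon> / 2"
      using quot_dist_approx[OF x y, of "\<epsilon> / 2"] zero \<epsilon> by auto
    have "\<phi> (g \<otimes> h) y = \<phi> g (\<phi> h y)"
      by (rule composition_rule[OF y g(1) h(1)])
    then have "d (\<phi> g x) (\<phi> (g \<otimes> h) y) < \<epsilon> / 2"
      using h isom[OF g(1) x act_closed[OF h(1) y]] by simp
    moreover have S: "\<phi> g x \<in> S" "\<phi> (g \<otimes> h) y \<in> S" "g \<otimes> h \<in> carrier G"
      using g h x y act_closed is_group by (auto simp: group.subgroup_self subgroup.m_closed)
    ultimately have "d (\<phi> (g \<otimes> h) y) w < \<epsilon>"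
      using triangle[OF S(2,1) wS] commute[of "\<phi> (g \<otimes> h) y" "\<phi> g x"] g(2) by simp
    with S show ?thesis by blast
  qed
  with wS y show "w \<in> \<pi> y" by (simp add: orbit_cl_iff)
qed

lemma quot_dist_commute: "qd A B = qd B A"
proof -
  have "{d x y |x y. x \<in> A \<and> y \<in> B} = {d x y |x y. x \<in> B \<and> y \<in> A}"
    using commute by blast
  then show ?thesis by (simp add: quot_dist_def)
qed

sublocale quot: lip_space Q qd "\<pi> z"
proof
  show "\<pi> z \<in> Q"
    using base by (simp add: quot_space_def)
  show "qd A A = 0" if "A \<in> Q" for A
    using that quot_dist_le quot_dist_nonneg by (force simp: quot_space_def intro: antisym)
  show "0 < qd A B" if A: "A \<in> Q" and B: "B \<in> Q" and ne: "A \<noteq> B" for A B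
  proof -
    obtain x y where xy: "x \<in> S" "y \<in> S" "A = \<pi> x" "B = \<pi> y"
      using A B by (auto simp: quot_space_def)
    have "\<not> qd A B \<le> 0"
      using orbit_cl_subset_if_quot_dist_zero[of x y] orbit_cl_subset_if_quot_dist_zero[of y x]
        xy ne quot_dist_commute[of A B] by auto
    then show ?thesis by simp
  qed
qed

section \<open>Invariant functions as functions on the quotient\<close>

abbreviation "lift F \<equiv> (\<lambda>x. if x \<in> S then F (\<pi> x) else 0)"

text \<open>The chosen point lies in the orbit closure, possibly off the orbit, so independence of
  the choice needs constancy of invariant functions on closures.\<close>

definition descend :: "('m \<Rightarrow> real) \<Rightarrow> 'm set \<Rightarrow> real" where
  "descend f A = (if A \<in> Q then f (SOME x. x \<in> A) else 0)"

lemma quotI: "x \<in> S \<Longrightarrow> \<pi> x \<in> Q"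
  by (simp add: quot_space_def)

text \<open>The point \<open>\<phi> g x\<close> lies in both closures, so their distance is
  0.\<close>

lemma orbit_cl_eq_act:
  assumes "x \<in> S" "g \<in> carrier G"
  shows "\<pi> (\<phi> g x) = \<pi> x"
proof -
  have "qd (\<pi> x) (\<pi> (\<phi> g x)) \<le> d (\<phi> g x) (\<phi> g x)"
    unfolding quot_dist_def using assms orbit_cl_act orbit_cl_refl act_closed
    by (intro cInf_lower quot_dist_bdd) blast+
  then have "qd (\<pi> x) (\<pi> (\<phi> g x)) \<le> 0"
    using assms act_closed by simp
  then show ?thesis
    using orbit_cl_subset_if_quot_dist_zero assms act_closed quot_dist_commute by (metis subset_antisym)
qed

lemma lift_Lip0:
  assumes F: "F \<in> quot.L0"
  shows lift_mem: "lift F \<in> LG" and lipc_lift_le: "lc (lift F) \<le> quot.lc F"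
proof -
  have bd: "\<bar>lift F x - lift F y\<bar> \<le> quot.lc F * d x y" if xy: "x \<in> S" "y \<in> S" for x y
  proof -
    have "\<bar>lift F x - lift F y\<bar> \<le> quot.lc F * qd (\<pi> x) (\<pi> y)"
      using quot.lipc_bound[OF F quotI quotI] xy by simp
    also have "\<dots> \<le> quot.lc F * d x y"
      by (rule mult_left_mono[OF quot_dist_le[OF xy] quot.lipc_nonneg[OF F]])
    finally show ?thesis .
  qed
  have "lift F z = 0"
    using F by (simp add: Lip0_def)
  then have "lift F \<in> L0"
    using bd by (intro Lip0I[of _ "quot.lc F"]) auto
  then show "lift F \<in> LG"
    using act_closed by (simp add: Lip0G_def orbit_cl_eq_act)
  show "lc (lift F) \<le> quot.lc F"
    using bd quot.lipc_nonneg[OF F] by (rule lipc_le[rotated])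
qed

lemma invariant_const_orbit_cl:
  assumes f: "f \<in> LG" and x: "x \<in> S" and y: "y \<in> \<pi> x"
  shows "f y = f x"
proof -
  have yS: "y \<in> S" using x y by (simp add: orbit_cl_iff)
  have "f y - f x = 0"
  proof (rule eq_zero_if_small)
    fix \<epsilon> :: real assume "0 < \<epsilon>"
    then obtain g where g: "g \<in> carrier G" "d (\<phi> g x) y < \<epsilon>"
      using x y by (auto simp: orbit_cl_iff)
    have "\<bar>f y - f x\<bar> = \<bar>f (\<phi> g x) - f y\<bar>"
      using f g x by (simp add: Lip0G_def abs_minus_commute)
    also have "\<dots> \<le> lc f * d (\<phi> g x) y"
      by (intro lipc_bound Lip0G_Lip0 f yS act_closed g x)
    also have "\<dots> \<le> lc f * \<epsilon>"
      using g lipc_nonneg[OF Lip0G_Lip0[OF f]] by (intro mult_left_mono) auto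
    finally show "\<bar>f y - f x\<bar> \<le> \<epsilon> * lc f" by (simp add: mult.commute)
  qed
  then show ?thesis by simp
qed

lemma descend_apply:
  assumes f: "f \<in> LG" and x: "x \<in> S"
  shows "descend f (\<pi> x) = f x"
proof -
  have "(SOME y. y \<in> \<pi> x) \<in> \<pi> x"
    using orbit_cl_refl[OF x] by (rule someI)
  then show ?thesis
    using quotI[OF x] invariant_const_orbit_cl[OF f x] by (simp add: descend_def)
qed

text \<open>Invariance gives \<open>f x - f y = f x - f (\<phi> g y)\<close>, and \<open>g\<close>
  can be chosen with \<open>d x (\<phi> g y)\<close> as close to the quotient distance as desired,
  so the Lipschitz constant does not grow.\<close>

lemma descend_Lip0:
  assumes f: "f \<in> LG"
  shows descend_mem: "descend f \<in> quot.L0" and lipc_descend_le: "quot.lc (descend f) \<le> lc f"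
proof -
  have bd: "\<bar>descend f A - descend f B\<bar> \<le> lc f * qd A B" if A: "A \<in> Q" and B: "B \<in> Q" for A B
  proof -
    obtain x y where xy: "x \<in> S" "y \<in> S" and AB: "A = \<pi> x" "B = \<pi> y"
      using A B by (auto simp: quot_space_def)
    have "\<bar>f x - f y\<bar> \<le> lc f * qd A B + e" if e: "0 < e" for e
    proof -
      have K: "0 < lc f + 1"
        using lipc_nonneg[OF Lip0G_Lip0[OF f]] by simp
      with e have "qd (\<pi> x) (\<pi> y) < qd A B + e / (lc f + 1)"
        by (simp add: AB)
      then obtain g where g: "g \<in> carrier G" "d x (\<phi> g y) < qd A B + e / (lc f + 1)"
        using quot_dist_approx[OF xy] by blast
      have "\<bar>f x - f y\<bar> = \<bar>f x - f (\<phi> g y)\<bar>"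
        using f g xy by (simp add: Lip0G_def)
      also have "\<dots> \<le> lc f * d x (\<phi> g y)"
        by (intro lipc_bound Lip0G_Lip0 f act_closed g xy)
      also have "\<dots> \<le> lc f * (qd A B + e / (lc f + 1))"
        using g lipc_nonneg[OF Lip0G_Lip0[OF f]] by (intro mult_left_mono) auto
      also have "\<dots> \<le> lc f * qd A B + e"
        using K e by (simp add: distrib_left pos_divide_le_eq)
      finally show ?thesis .
    qed
    then have "\<bar>f x - f y\<bar> \<le> lc f * qd A B"
      by (rule field_le_epsilon)
    then show ?thesis
      by (simp add: AB descend_apply f xy)
  qed
  have "descend f (\<pi> z) = 0"
    using descend_apply[OF f base] f by (simp add: Lip0G_def Lip0_def)
  then show "descend f \<in> quot.L0"
    using bd by (intro quot.Lip0I[of _ "lc f"]) (auto simp: descend_def)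
  show "quot.lc (descend f) \<le> lc f"
    using bd lipc_nonneg[OF Lip0G_Lip0[OF f]] by (rule quot.lipc_le[rotated])
qed

lemma lift_descend:
  assumes f: "f \<in> LG"
  shows "lift (descend f) = f"
  using Lip0G_Lip0[OF f] by (auto simp: descend_apply[OF f] Lip0_def)

lemma descend_lift:
  assumes F: "F \<in> quot.L0"
  shows "descend (lift F) = F"
proof
  fix A
  show "descend (lift F) A = F A"
  proof (cases "A \<in> Q")
    case True
    then obtain x where "x \<in> S" "A = \<pi> x"
      by (auto simp: quot_space_def)
    then show ?thesis
      using descend_apply[OF lift_mem[OF F]] by simp
  next
    case False
    then show ?thesis
      using F by (simp add: descend_def Lip0_def)
  qed
qed

lemma lipc_lift: "F \<in> quot.L0 \<Longrightarrow> lc (lift F) = quot.lc F"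
  using lipc_lift_le[of F] lipc_descend_le[OF lift_mem] by (simp add: descend_lift antisym)

lemma descend_lin:
  "descend (\<lambda>x. a * f x + b * h x) = (\<lambda>A. a * descend f A + b * descend h A)"
  by (auto simp: descend_def)

lemma lift_isometry: "lin_iso_onto quot.L0 quot.lc LG lc lift"
  unfolding lin_iso_onto_def
proof (intro conjI ballI allI)
  show "bij_betw lift quot.L0 LG"
    by (rule bij_betw_byWitness[where f' = descend])
      (auto simp: descend_lift lift_descend intro: lift_mem descend_mem)
qed (auto simp: lipc_lift)

text \<open>The adjoint of \<open>lift\<close>, that is, the push-forward under the quotient map.\<close>

definition push :: "(('m \<Rightarrow> real) \<Rightarrow> real) \<Rightarrow> ('m set \<Rightarrow> real) \<Rightarrow> real" where
  "push \<psi> F = (if F \<in> quot.L0 then \<psi> (lift F) else 0)"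

lemma push_LipDual:
  assumes \<psi>: "\<psi> \<in> LD"
  shows push_mem: "push \<psi> \<in> quot.LD" and dnorm_push_le: "quot.dn (push \<psi>) \<le> dn \<psi>"
proof -
  note lift_L0 = Lip0G_Lip0[OF lift_mem]
  have bd: "\<bar>push \<psi> F\<bar> \<le> dn \<psi> * quot.lc F" if "F \<in> quot.L0" for F
    using dnorm_bound[OF \<psi> lift_L0[OF that]] that by (simp add: push_def lipc_lift)
  show "push \<psi> \<in> quot.LD"
  proof (rule quot.LipDualI)
    fix F H and a b :: real assume F: "F \<in> quot.L0" and H: "H \<in> quot.L0"
    have "lift (\<lambda>A. a * F A + b * H A) = (\<lambda>x. a * lift F x + b * lift H x)"
      by auto
    then show "push \<psi> (\<lambda>A. a * F A + b * H A) = a * push \<psi> F + b * push \<psi> H"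
      using LipDual_lin[OF \<psi> lift_L0[OF F] lift_L0[OF H]] quot.Lip0_lin[OF F H]
      by (simp add: push_def F H)
  qed (use bd in \<open>auto simp: push_def\<close>)
  show "quot.dn (push \<psi>) \<le> dn \<psi>"
    using bd dnorm_nonneg[OF \<psi>] by (rule quot.dnorm_le[rotated])
qed

lemma push_lin: "push (\<lambda>f. a * \<mu> f + b * \<nu> f) = (\<lambda>F. a * push \<mu> F + b * push \<nu> F)"
  by (auto simp: push_def)

text \<open>Recovers \<open>R \<mu>\<close> on all of \<open>L0\<close> from its push-forward,
  because \<open>f\<close> may be replaced by \<open>P f\<close>, which comes from the quotient.
  Injectivity of the push-forward on the range follows.\<close>

lemma push_descend: "\<mu> \<in> FS \<Longrightarrow> f \<in> L0 \<Longrightarrow> push (R \<mu>) (descend (P f)) = R \<mu> f"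
  by (simp add: push_def descend_mem PG_invariant lift_descend RG_PG)

lemma lipc_descend_PG: "f \<in> L0 \<Longrightarrow> quot.lc (descend (P f)) \<le> lc f"
  using lipc_descend_le[OF PG_invariant] lipc_PG by (rule order_trans)

text \<open>Each test function \<open>f\<close> for \<open>R \<mu>\<close> yields the test function
  \<open>descend (P f)\<close> for the push-forward, with the same value and no larger Lipschitz
  constant.\<close>

lemma dnorm_push_RG:
  assumes \<mu>: "\<mu> \<in> FS"
  shows "quot.dn (push (R \<mu>)) = dn (R \<mu>)"
proof (rule antisym[OF dnorm_push_le[OF RG_LipDual[OF \<mu>]]])
  note pm = push_mem[OF RG_LipDual[OF \<mu>]]
  show "dn (R \<mu>) \<le> quot.dn (push (R \<mu>))"
  proof (rule dnorm_le[OF quot.dnorm_nonneg[OF pm]])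
    fix f assume f: "f \<in> L0"
    have "\<bar>R \<mu> f\<bar> \<le> quot.dn (push (R \<mu>)) * quot.lc (descend (P f))"
      using quot.dnorm_bound[OF pm descend_mem[OF PG_invariant[OF f]]] by (simp add: push_descend \<mu> f)
    also have "\<dots> \<le> quot.dn (push (R \<mu>)) * lc f"
      by (rule mult_left_mono[OF lipc_descend_PG[OF f] quot.dnorm_nonneg[OF pm]])
    finally show "\<bar>R \<mu> f\<bar> \<le> quot.dn (push (R \<mu>)) * lc f" .
  qed
qed

lemma push_RG_delta:
  assumes x: "x \<in> S"
  shows "push (R (\<delta> x)) = quot.\<delta> (\<pi> x)"
proof
  fix F
  show "push (R (\<delta> x)) F = quot.\<delta> (\<pi> x) F"
    using x RG_eq_PG[OF delta_FreeSp[OF x] Lip0G_Lip0[OF lift_mem]]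
    by (cases "F \<in> quot.L0")
      (simp_all add: push_def delta_def PG_fixes lift_mem Lip0G_Lip0)
qed

lemma push_RG_FreeSp:
  assumes "\<mu> \<in> FS"
  shows "push (R \<mu>) \<in> quot.FS"
  using assms
proof (induction rule: FreeSp_induct)
  case (delta x)
  then show ?case
    by (simp add: push_RG_delta quot.delta_FreeSp quotI)
next
  case closed
  show ?case
  proof (rule closed_subI_FreeSp)
    have "R (\<lambda>_. 0) = (\<lambda>_. 0)"
      using lin_subspace_zero[OF lin_subspace_lincomb] lincomb_orbit_differences by blast
    moreover have "push (\<lambda>_. 0) = (\<lambda>_. 0)"
      by (auto simp: push_def)
    ultimately show "push (R (\<lambda>_. 0)) \<in> quot.FS"
      using lin_subspace_zero[OF quot.lin_subspace_FreeSp] by simp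
    show "push (R (\<lambda>f. a * \<mu> f + b * \<nu> f)) \<in> quot.FS"
      if "\<mu> \<in> FS" "\<nu> \<in> FS" "push (R \<mu>) \<in> quot.FS" "push (R \<nu>) \<in> quot.FS" for \<mu> \<nu> a b
      using that by (simp add: RG_lin push_lin lin_subspace_lin[OF quot.lin_subspace_FreeSp])
    fix \<mu> assume \<mu>: "\<mu> \<in> FS"
      and lim: "\<And>\<epsilon>. 0 < \<epsilon> \<Longrightarrow> \<exists>\<nu>\<in>FS. push (R \<nu>) \<in> quot.FS \<and> dn (\<lambda>f. \<mu> f - \<nu> f) < \<epsilon>"
    show "push (R \<mu>) \<in> quot.FS"
    proof (rule quot.closed_sub_lim[OF quot.closed_sub_FreeSp push_mem[OF RG_LipDual[OF \<mu>]]])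
      fix \<epsilon> :: real assume "0 < \<epsilon>"
      then obtain \<nu> where \<nu>: "\<nu> \<in> FS" "push (R \<nu>) \<in> quot.FS" "dn (\<lambda>f. \<mu> f - \<nu> f) < \<epsilon>"
        using lim by blast
      note D = lin_subspace_diff[OF lin_subspace_FreeSp \<mu> \<nu>(1)]
      have "push (R (\<lambda>f. \<mu> f - \<nu> f)) = (\<lambda>F. push (R \<mu>) F - push (R \<nu>) F)"
        by (auto simp: RG_diff \<mu> \<nu>(1) push_def)
      then have "quot.dn (\<lambda>F. push (R \<mu>) F - push (R \<nu>) F) \<le> dn (\<lambda>f. \<mu> f - \<nu> f)"
        using dnorm_push_RG[OF D] dnorm_RG[OF D] by simp
      with \<nu> show "\<exists>\<psi>\<in>quot.FS. quot.dn (\<lambda>F. push (R \<mu>) F - \<psi> F) < \<epsilon>"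
        by (intro bexI[of _ "push (R \<nu>)"]) auto
    qed
  qed
qed

text \<open>Evaluations at orbit closures are images of evaluations. The limit case rests on the
  closed range of \<open>R\<close>, after the limit functional has been pulled back to
  \<open>L0\<close>.\<close>

lemma push_RG_surj:
  assumes "\<nu> \<in> quot.FS"
  shows "\<exists>\<mu>\<in>FS. push (R \<mu>) = \<nu>"
  using assms
proof (induction rule: quot.FreeSp_induct)
  case (delta A)
  then obtain x where "x \<in> S" "A = \<pi> x"
    by (auto simp: quot_space_def)
  then show ?case
    by (intro bexI[of _ "\<delta> x"] delta_FreeSp) (simp_all add: push_RG_delta)
next
  case closed
  show ?case
  proof (rule quot.closed_subI_FreeSp)
    have "R (\<lambda>_. 0) = (\<lambda>_. 0)"
      using lin_subspace_zero[OF lin_subspace_lincomb] lincomb_orbit_differences by blast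
    then show "\<exists>\<mu>\<in>FS. push (R \<mu>) = (\<lambda>_. 0)"
      using lin_subspace_zero[OF lin_subspace_FreeSp] by (intro bexI[of _ "\<lambda>_. 0"]) (auto simp: push_def)
    fix \<nu> \<nu>' and a b :: real
    assume "\<exists>\<mu>\<in>FS. push (R \<mu>) = \<nu>" "\<exists>\<mu>\<in>FS. push (R \<mu>) = \<nu>'"
    then obtain \<mu> \<mu>' where \<mu>: "\<mu> \<in> FS" "\<mu>' \<in> FS" "push (R \<mu>) = \<nu>" "push (R \<mu>') = \<nu>'"
      by blast
    then have "push (R (\<lambda>f. a * \<mu> f + b * \<mu>' f)) = (\<lambda>F. a * \<nu> F + b * \<nu>' F)"
      by (simp add: RG_lin push_lin)
    then show "\<exists>\<mu>\<in>FS. push (R \<mu>) = (\<lambda>F. a * \<nu> F + b * \<nu>' F)"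
      using lin_subspace_lin[OF lin_subspace_FreeSp \<mu>(1,2)] by blast
  next
    fix \<nu> assume \<nu>: "\<nu> \<in> quot.FS"
      and lim: "\<And>\<epsilon>. 0 < \<epsilon> \<Longrightarrow> \<exists>\<nu>'\<in>quot.FS. (\<exists>\<mu>\<in>FS. push (R \<mu>) = \<nu>') \<and> quot.dn (\<lambda>F. \<nu> F - \<nu>' F) < \<epsilon>"
    note \<nu>LD = quot.FreeSp_LipDual[OF \<nu>]
    note dP = descend_mem[OF PG_invariant]
    \<comment> \<open>The pullback along \<open>descend \<circ> P\<close> is contractive, so
      approximants \<open>push (R \<mu>)\<close> of \<open>\<nu>\<close> become approximants
      \<open>R \<mu>\<close> of \<open>\<psi>\<close>.\<close>
    define \<psi> where "\<psi> f = (if f \<in> L0 then \<nu> (descend (P f)) else 0)" for f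
    have \<psi>: "\<psi> \<in> LD"
    proof (rule LipDualI)
      fix f h and a b :: real assume f: "f \<in> L0" and h: "h \<in> L0"
      have "P (\<lambda>x. a * f x + b * h x) = (\<lambda>x. a * P f x + b * P h x)"
        using PG_projection f h by (simp add: is_projection_def)
      then show "\<psi> (\<lambda>x. a * f x + b * h x) = a * \<psi> f + b * \<psi> h"
        using f h quot.LipDual_lin[OF \<nu>LD dP[OF f] dP[OF h]] Lip0_lin[OF f h]
        by (simp add: \<psi>_def descend_lin)
    next
      fix f assume f: "f \<in> L0"
      have "\<bar>\<psi> f\<bar> \<le> quot.dn \<nu> * quot.lc (descend (P f))"
        using quot.dnorm_bound[OF \<nu>LD dP[OF f]] f by (simp add: \<psi>_def)
      also have "\<dots> \<le> quot.dn \<nu> * lc f"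
        by (rule mult_left_mono[OF lipc_descend_PG[OF f] quot.dnorm_nonneg[OF \<nu>LD]])
      finally show "\<bar>\<psi> f\<bar> \<le> quot.dn \<nu> * lc f" .
    qed (simp add: \<psi>_def)
    have "\<psi> \<in> R ` FS"
    proof (rule RG_range_limit[OF \<psi>])
      fix \<epsilon> :: real assume "0 < \<epsilon>"
      then obtain \<mu> where \<mu>: "\<mu> \<in> FS" "quot.dn (\<lambda>F. \<nu> F - push (R \<mu>) F) < \<epsilon>"
        using lim by blast
      note pm = push_mem[OF RG_LipDual[OF \<mu>(1)]]
      have "dn (\<lambda>f. \<psi> f - R \<mu> f) \<le> quot.dn (\<lambda>F. \<nu> F - push (R \<mu>) F)"
      proof (rule dnorm_le[OF quot.dnorm_nonneg[OF quot.LipDual_diff[OF \<nu>LD pm]]])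
        fix f assume f: "f \<in> L0"
        have "\<bar>\<psi> f - R \<mu> f\<bar> \<le> quot.dn (\<lambda>F. \<nu> F - push (R \<mu>) F) * quot.lc (descend (P f))"
          using quot.dnorm_diff_bound[OF \<nu>LD pm dP[OF f]] f by (simp add: \<psi>_def push_descend \<mu>(1))
        also have "\<dots> \<le> quot.dn (\<lambda>F. \<nu> F - push (R \<mu>) F) * lc f"
          by (rule mult_left_mono[OF lipc_descend_PG[OF f] quot.dnorm_nonneg[OF quot.LipDual_diff[OF \<nu>LD pm]]])
        finally show "\<bar>\<psi> f - R \<mu> f\<bar> \<le> quot.dn (\<lambda>F. \<nu> F - push (R \<mu>) F) * lc f" .
      qed
      with \<mu> show "\<exists>\<mu>\<in>FS. dn (\<lambda>f. \<psi> f - R \<mu> f) < \<epsilon>"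
        by (intro bexI[of _ \<mu>]) auto
    qed
    then obtain \<mu> where \<mu>: "\<mu> \<in> FS" "R \<mu> = \<psi>" by blast
    have "push \<psi> = \<nu>"
    proof (rule quot.LipDual_eqI[OF push_mem[OF \<psi>] \<nu>LD])
      fix F assume F: "F \<in> quot.L0"
      then show "push \<psi> F = \<nu> F"
        using lift_mem[OF F] by (simp add: push_def \<psi>_def Lip0G_Lip0 PG_fixes descend_lift)
    qed
    with \<mu> show "\<exists>\<mu>\<in>FS. push (R \<mu>) = \<nu>" by blast
  qed
qed

lemma push_isometry: "lin_iso_onto (R ` FS) dn quot.FS quot.dn push"
  unfolding lin_iso_onto_def
proof (intro conjI ballI allI)
  have "R \<mu> = R \<nu>" if "\<mu> \<in> FS" "\<nu> \<in> FS" "push (R \<mu>) = push (R \<nu>)" for \<mu> \<nu>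
    using that push_descend by (intro LipDual_eqI RG_LipDual) metis+
  then show "bij_betw push (R ` FS) quot.FS"
    using push_RG_FreeSp push_RG_surj unfolding bij_betw_def inj_on_def by blast
qed (auto simp: push_lin dnorm_push_RG)

end

section \<open>Uniformly continuous functions on topological groups\<close>

text \<open>In contrast to \<open>bounded_on_group\<close>, no value is prescribed off the carrier,
  where an orbit function \<open>g \<mapsto> f (\<phi> g x)\<close> is arbitrary.\<close>

definition BUC_left :: "('g, 'c) monoid_scheme \<Rightarrow> 'g topology \<Rightarrow> ('g \<Rightarrow> real) set" where
  "BUC_left G T = {h. (\<exists>C. \<forall>x\<in>carrier G. \<bar>h x\<bar> \<le> C) \<and> unif_cont_l G T h}"

lemma unif_cont_lD:
  assumes "unif_cont_l G T f" "0 < \<epsilon>"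
  obtains V where "nbhd_one G T V"
    "\<And>x y. x \<in> carrier G \<Longrightarrow> y \<in> carrier G \<Longrightarrow> inv\<^bsub>G\<^esub> x \<otimes>\<^bsub>G\<^esub> y \<in> V \<Longrightarrow> \<bar>f x - f y\<bar> < \<epsilon>"
  using assms unfolding unif_cont_l_def by blast

lemma nbhd_one_Int: "nbhd_one G T V \<Longrightarrow> nbhd_one G T W \<Longrightarrow> nbhd_one G T (V \<inter> W)"
  unfolding nbhd_one_def by (meson IntI inf.coboundedI1 inf_mono openin_Int)

context
  fixes G :: "('g, 'c) monoid_scheme" (structure) and T :: "'g topology"
  assumes tg: "top_group G T"
begin

interpretation group G
  using tg by (simp add: top_group_def)

lemma nbhd_one_carrier: "nbhd_one G T (carrier G)"
  using tg unfolding nbhd_one_def top_group_def by (metis one_closed openin_topspace order_refl)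

lemma BUC_left_one: "(\<lambda>_. 1) \<in> BUC_left G T"
  using nbhd_one_carrier by (auto simp: BUC_left_def unif_cont_l_def intro!: exI[of _ 1])

lemma BUC_left_lin:
  assumes h: "h \<in> BUC_left G T" and k: "k \<in> BUC_left G T"
  shows "(\<lambda>g. a * h g + b * k g) \<in> BUC_left G T"
proof -
  obtain C D where C: "\<forall>x\<in>carrier G. \<bar>h x\<bar> \<le> C" and D: "\<forall>x\<in>carrier G. \<bar>k x\<bar> \<le> D"
    using h k by (auto simp: BUC_left_def)
  have comb: "\<bar>a * s + b * t\<bar> \<le> \<bar>a\<bar> * \<bar>s\<bar> + \<bar>b\<bar> * \<bar>t\<bar>" for s t :: real
    using abs_triangle_ineq[of "a * s" "b * t"] by (simp add: abs_mult)
  have "\<bar>a * h x + b * k x\<bar> \<le> \<bar>a\<bar> * C + \<bar>b\<bar> * D" if "x \<in> carrier G" for x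
    using C D that by (intro order_trans[OF comb] add_mono mult_left_mono) auto
  moreover have "unif_cont_l G T (\<lambda>g. a * h g + b * k g)"
    unfolding unif_cont_l_def
  proof (intro allI impI)
    fix \<epsilon> :: real assume \<epsilon>: "0 < \<epsilon>"
    define e where "e = \<epsilon> / (\<bar>a\<bar> + \<bar>b\<bar> + 1)"
    have pos: "0 < \<bar>a\<bar> + \<bar>b\<bar> + 1" by linarith
    with \<epsilon> have e: "0 < e" by (simp add: e_def)
    obtain V where V: "nbhd_one G T V"
      "\<And>x y. x \<in> carrier G \<Longrightarrow> y \<in> carrier G \<Longrightarrow> inv x \<otimes> y \<in> V \<Longrightarrow> \<bar>h x - h y\<bar> < e"
      using h e unif_cont_lD[of G T h e] unfolding BUC_left_def by blast
    obtain W where W: "nbhd_one G T W"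
      "\<And>x y. x \<in> carrier G \<Longrightarrow> y \<in> carrier G \<Longrightarrow> inv x \<otimes> y \<in> W \<Longrightarrow> \<bar>k x - k y\<bar> < e"
      using k e unif_cont_lD[of G T k e] unfolding BUC_left_def by blast
    have "\<bar>(a * h x + b * k x) - (a * h y + b * k y)\<bar> < \<epsilon>"
      if "x \<in> carrier G" "y \<in> carrier G" "inv x \<otimes> y \<in> V \<inter> W" for x y
    proof -
      have "(a * h x + b * k x) - (a * h y + b * k y) = a * (h x - h y) + b * (k x - k y)"
        by (simp add: algebra_simps)
      then have "\<bar>(a * h x + b * k x) - (a * h y + b * k y)\<bar> \<le> \<bar>a\<bar> * \<bar>h x - h y\<bar> + \<bar>b\<bar> * \<bar>k x - k y\<bar>"
        using comb by simp
      also have "\<dots> \<le> \<bar>a\<bar> * e + \<bar>b\<bar> * e"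
        using V(2)[of x y] W(2)[of x y] that by (intro add_mono mult_left_mono) auto
      also have "\<dots> < (\<bar>a\<bar> + \<bar>b\<bar> + 1) * e"
        using e by (simp add: algebra_simps)
      also have "\<dots> = \<epsilon>"
        using pos by (simp add: e_def)
      finally show ?thesis .
    qed
    then show "\<exists>V. nbhd_one G T V \<and> (\<forall>x\<in>carrier G. \<forall>y\<in>carrier G. inv x \<otimes> y \<in> V \<longrightarrow>
        \<bar>(a * h x + b * k x) - (a * h y + b * k y)\<bar> < \<epsilon>)"
      using nbhd_one_Int[OF V(1) W(1)] by blast
  qed
  ultimately show ?thesis
    by (auto simp: BUC_left_def)
qed

lemma BUC_left_lim:
  assumes lim: "\<And>\<epsilon>. 0 < \<epsilon> \<Longrightarrow> \<exists>k\<in>BUC_left G T. \<forall>g\<in>carrier G. \<bar>h g - k g\<bar> < \<epsilon>"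
  shows "h \<in> BUC_left G T"
proof -
  obtain k C where k: "\<forall>g\<in>carrier G. \<bar>h g - k g\<bar> < 1" "\<forall>g\<in>carrier G. \<bar>k g\<bar> \<le> C"
    using lim[of 1] by (auto simp: BUC_left_def)
  have "\<bar>h x\<bar> \<le> C + 1" if "x \<in> carrier G" for x
    using k that by (smt (verit))
  moreover have "unif_cont_l G T h"
    unfolding unif_cont_l_def
  proof (intro allI impI)
    fix \<epsilon> :: real assume \<epsilon>: "0 < \<epsilon>"
    obtain k where k: "k \<in> BUC_left G T" "\<forall>g\<in>carrier G. \<bar>h g - k g\<bar> < \<epsilon> / 3"
      using lim[of "\<epsilon> / 3"] \<epsilon> by auto
    obtain V where V: "nbhd_one G T V"
      "\<And>x y. x \<in> carrier G \<Longrightarrow> y \<in> carrier G \<Longrightarrow> inv x \<otimes> y \<in> V \<Longrightarrow> \<bar>k x - k y\<bar> < \<epsilon> / 3"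
      using k(1) \<epsilon> unif_cont_lD[of G T k "\<epsilon> / 3"] unfolding BUC_left_def by auto
    have "\<bar>h x - h y\<bar> < \<epsilon>" if "x \<in> carrier G" "y \<in> carrier G" "inv x \<otimes> y \<in> V" for x y
      using V(2)[OF that] bspec[OF k(2) that(1)] bspec[OF k(2) that(2)] by linarith
    with V(1) show "\<exists>V. nbhd_one G T V \<and> (\<forall>x\<in>carrier G. \<forall>y\<in>carrier G. inv x \<otimes> y \<in> V \<longrightarrow> \<bar>h x - h y\<bar> < \<epsilon>)"
      by blast
  qed
  ultimately show ?thesis
    by (auto simp: BUC_left_def)
qed

lemma translation_continuous:
  assumes g: "g \<in> carrier G"
  shows left_translation_continuous: "continuous_map T T (\<lambda>x. g \<otimes> x)"
    and right_translation_continuous: "continuous_map T T (\<lambda>x. x \<otimes> g)"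
proof -
  have top: "topspace T = carrier G"
    and mult: "continuous_map (prod_topology T T) T (\<lambda>p. fst p \<otimes> snd p)"
    using tg by (auto simp: top_group_def)
  have "continuous_map T (prod_topology T T) (\<lambda>x. (g, x))" "continuous_map T (prod_topology T T) (\<lambda>x. (x, g))"
    using g top by (auto intro!: continuous_map_pairedI)
  from this[THEN continuous_map_compose, OF mult]
  show "continuous_map T T (\<lambda>x. g \<otimes> x)" "continuous_map T T (\<lambda>x. x \<otimes> g)"
    by (simp_all add: o_def)
qed

text \<open>Left translation by \<open>inv x\<close> pulls neighbourhoods of the unit back to
  neighbourhoods of \<open>x\<close>.\<close>

lemma BUC_left_continuous:
  assumes h: "h \<in> BUC_left G T"
  shows "continuous_map T euclideanreal h"
proof -
  have top: "topspace T = carrier G"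
    using tg by (simp add: top_group_def)
  have "\<exists>U. openin T U \<and> x \<in> U \<and> (\<forall>y\<in>U. \<bar>h y - h x\<bar> < \<epsilon>)" if x: "x \<in> carrier G" and \<epsilon>: "0 < \<epsilon>" for x \<epsilon>
  proof -
    obtain V where V: "nbhd_one G T V"
      "\<And>x y. x \<in> carrier G \<Longrightarrow> y \<in> carrier G \<Longrightarrow> inv x \<otimes> y \<in> V \<Longrightarrow> \<bar>h x - h y\<bar> < \<epsilon>"
      using h \<epsilon> unif_cont_lD[of G T h \<epsilon>] unfolding BUC_left_def by blast
    obtain W where W: "openin T W" "\<one> \<in> W" "W \<subseteq> V"
      using V(1) by (auto simp: nbhd_one_def)
    let ?U = "{y \<in> topspace T. inv x \<otimes> y \<in> W}"
    have "openin T ?U"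
      using x by (intro openin_continuous_map_preimage[OF left_translation_continuous W(1)]) simp
    moreover have "x \<in> ?U"
      using x W top by simp
    moreover have "\<bar>h y - h x\<bar> < \<epsilon>" if "y \<in> ?U" for y
      using V(2)[of x y] that x W(3) top by (auto simp: abs_minus_commute)
    ultimately show ?thesis by blast
  qed
  then have "\<exists>U. openin T U \<and> x \<in> U \<and> (\<forall>y\<in>U. h y \<in> B)" if "x \<in> carrier G" "open B" "h x \<in> B" for x B
    using that unfolding open_dist dist_real_def by meson
  then show ?thesis
    by (auto simp: continuous_map_eq_topcontinuous_at topcontinuous_at_def top)
qed

text \<open>Conjugation by \<open>inv x\<close> carries \<open>y \<otimes> inv x\<close> to
  \<open>inv x \<otimes> y\<close>, so a conjugation-invariant neighbourhood controls both at
  once.\<close>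

lemma SIN_unif_cont_r:
  assumes SIN: "SIN_group G T" and f: "unif_cont_l G T f"
  shows "unif_cont_r G T f"
  unfolding unif_cont_r_def
proof (intro allI impI)
  fix \<epsilon> :: real assume \<epsilon>: "0 < \<epsilon>"
  obtain U where U: "nbhd_one G T U"
    "\<And>x y. x \<in> carrier G \<Longrightarrow> y \<in> carrier G \<Longrightarrow> inv x \<otimes> y \<in> U \<Longrightarrow> \<bar>f x - f y\<bar> < \<epsilon>"
    using unif_cont_lD[OF f \<epsilon>] by blast
  obtain V where V: "nbhd_one G T V" "V \<subseteq> U" "\<forall>g\<in>carrier G. (\<lambda>v. g \<otimes> v \<otimes> inv g) ` V = V"
    using SIN U(1) unfolding SIN_group_def by blast
  have "\<bar>f x - f y\<bar> < \<epsilon>" if x: "x \<in> carrier G" and y: "y \<in> carrier G" and V': "y \<otimes> inv x \<in> V" for x y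
  proof (rule U(2)[OF x y])
    have "inv x \<otimes> (y \<otimes> inv x) \<otimes> inv (inv x) \<in> V"
      using V(3) V' x by blast
    moreover have "inv x \<otimes> (y \<otimes> inv x) \<otimes> inv (inv x) = inv x \<otimes> y"
      using x y by (simp add: m_assoc)
    ultimately show "inv x \<otimes> y \<in> U"
      using V(2) by auto
  qed
  with V(1) show "\<exists>V. nbhd_one G T V \<and> (\<forall>x\<in>carrier G. \<forall>y\<in>carrier G. y \<otimes> inv x \<in> V \<longrightarrow> \<bar>f x - f y\<bar> < \<epsilon>)"
    by blast
qed

section \<open>Properties of the mean common to the SIN and the locally compact case\<close>

definition mean_props :: "(('g \<Rightarrow> real) \<Rightarrow> real) \<Rightarrow> bool" where
  "mean_props Mn \<longleftrightarrow>
     (\<forall>h\<in>BUC_left G T. \<forall>k\<in>BUC_left G T. \<forall>a b. Mn (restrict (\<lambda>g. a * h g + b * k g) (carrier G))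
        = a * Mn (restrict h (carrier G)) + b * Mn (restrict k (carrier G))) \<and>
     (\<forall>h\<in>BUC_left G T. (\<forall>g\<in>carrier G. 0 \<le> h g) \<longrightarrow> 0 \<le> Mn (restrict h (carrier G))) \<and>
     Mn (restrict (\<lambda>_. 1) (carrier G)) = 1 \<and>
     (\<forall>h\<in>BUC_left G T. \<forall>g\<in>carrier G.
        Mn (restrict (\<lambda>x. h (x \<otimes> g)) (carrier G)) = Mn (restrict h (carrier G)))"

text \<open>The functions \<open>restrict h (carrier G)\<close> are in general not in the domain of the mean, since they
  are \<open>undefined\<close> off the carrier; invariance under left translation by the unit replaces them by
  the extension by zero.\<close>

lemma mean_props_SIN:
  assumes SIN: "SIN_group G T" and Mn: "bi_inv_mean_BUC G T Mn"
  shows "mean_props Mn"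
proof -
  define D where "D = {f. bounded_on_group G f \<and> unif_cont_l G T f \<and> unif_cont_r G T f}"
  define e where "e h = (\<lambda>x. if x \<in> carrier G then h x else 0)" for h :: "'g \<Rightarrow> real"
  have m: "mean_on G D Mn"
    and inv: "\<And>g f. g \<in> carrier G \<Longrightarrow> f \<in> D \<Longrightarrow> Mn (ltrans G g f) = Mn f \<and> Mn (rtrans G g f) = Mn f"
    using Mn by (auto simp: bi_inv_mean_BUC_def D_def Let_def)
  have lin: "\<And>f h a b. f \<in> D \<Longrightarrow> h \<in> D \<Longrightarrow> Mn (\<lambda>x. a * f x + b * h x) = a * Mn f + b * Mn h"
    and pos: "\<And>f. f \<in> D \<Longrightarrow> \<forall>x\<in>carrier G. 0 \<le> f x \<Longrightarrow> 0 \<le> Mn f"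
    using m by (auto simp: mean_on_def)
  have e_D: "e h \<in> D" if h: "h \<in> BUC_left G T" for h
  proof -
    have "unif_cont_l G T (e h)"
      using h by (simp add: BUC_left_def unif_cont_l_def e_def)
    then show ?thesis
      using h SIN_unif_cont_r[OF SIN] by (auto simp: D_def BUC_left_def bounded_on_group_def e_def)
  qed
  have e_Mn: "Mn (restrict h (carrier G)) = Mn (e h)" if h: "h \<in> BUC_left G T" for h
  proof -
    have "ltrans G \<one> (e h) = restrict h (carrier G)"
      by (auto simp: ltrans_def e_def)
    then show ?thesis
      using inv[OF one_closed e_D[OF h]] by simp
  qed
  show ?thesis
    unfolding mean_props_def
  proof (intro conjI ballI allI impI)
    fix h k and a b :: real assume h: "h \<in> BUC_left G T" and k: "k \<in> BUC_left G T"
    have "e (\<lambda>g. a * h g + b * k g) = (\<lambda>x. a * e h x + b * e k x)"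
      by (auto simp: e_def)
    then show "Mn (restrict (\<lambda>g. a * h g + b * k g) (carrier G))
        = a * Mn (restrict h (carrier G)) + b * Mn (restrict k (carrier G))"
      using lin[OF e_D[OF h] e_D[OF k]] by (simp add: e_Mn h k BUC_left_lin)
  next
    fix h assume "h \<in> BUC_left G T" "\<forall>g\<in>carrier G. 0 \<le> h g"
    then show "0 \<le> Mn (restrict h (carrier G))"
      using pos[OF e_D, of h] by (simp add: e_Mn) (simp add: e_def)
  next
    show "Mn (restrict (\<lambda>_. 1) (carrier G)) = 1"
      using m by (simp add: mean_on_def)
  next
    fix h g assume h: "h \<in> BUC_left G T" and g: "g \<in> carrier G"
    have "rtrans G g (e h) = restrict (\<lambda>x. h (x \<otimes> g)) (carrier G)"
      using g by (auto simp: rtrans_def e_def)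
    then show "Mn (restrict (\<lambda>x. h (x \<otimes> g)) (carrier G)) = Mn (restrict h (carrier G))"
      using inv[OF g e_D[OF h]] by (simp add: e_Mn h)
  qed
qed

text \<open>Haar measure is defined on the Borel sets, so continuity gives measurability. Both forms
  of the function occur: the mean is applied to the restriction, while translation invariance is
  stated for \<open>h\<close>.\<close>

lemma continuous_Linf:
  assumes haar: "haar_measure G T M" and h: "continuous_map T euclideanreal h"
    and bd: "\<forall>x\<in>carrier G. \<bar>h x\<bar> \<le> C"
  shows "h \<in> Linf M" and "restrict h (carrier G) \<in> Linf M"
proof -
  have sp: "space M = carrier G" and sets: "sets M = sigma_sets (carrier G) {U. openin T U}"
    using haar by (auto simp: haar_measure_def)
  have top: "topspace T = carrier G"
    using tg by (simp add: top_group_def)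
  have "h \<in> borel_measurable M"
  proof (rule borel_measurableI)
    fix U :: "real set" assume "open U"
    then have "openin T {x \<in> topspace T. h x \<in> U}"
      by (intro openin_continuous_map_preimage[OF h]) simp
    moreover have "{x \<in> topspace T. h x \<in> U} = h -` U \<inter> space M"
      by (auto simp: top sp)
    ultimately show "h -` U \<inter> space M \<in> sets M"
      by (simp add: sets sigma_sets.Basic)
  qed
  moreover from this have "restrict h (carrier G) \<in> borel_measurable M"
    by (subst measurable_cong[of M _ h]) (simp_all add: sp)
  moreover have "AE x in M. \<bar>h x\<bar> \<le> C" "AE x in M. \<bar>restrict h (carrier G) x\<bar> \<le> C"
    by (rule AE_I2; use bd in \<open>simp add: sp\<close>)+
  ultimately show "h \<in> Linf M" "restrict h (carrier G) \<in> Linf M"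
    unfolding Linf_def by blast+
qed

lemma mean_props_Linf:
  assumes haar: "haar_measure G T M" and Mn: "bi_inv_mean_Linf G M Mn"
  shows "mean_props Mn"
proof -
  have sp: "space M = carrier G"
    using haar by (simp add: haar_measure_def)
  have cong: "\<And>f h. f \<in> Linf M \<Longrightarrow> h \<in> Linf M \<Longrightarrow> AE x in M. f x = h x \<Longrightarrow> Mn f = Mn h"
    and lin: "\<And>f h a b. f \<in> Linf M \<Longrightarrow> h \<in> Linf M \<Longrightarrow> Mn (\<lambda>x. a * f x + b * h x) = a * Mn f + b * Mn h"
    and pos: "\<And>f. f \<in> Linf M \<Longrightarrow> AE x in M. 0 \<le> f x \<Longrightarrow> 0 \<le> Mn f"
    and one: "Mn (\<lambda>_. 1) = 1"
    and right: "\<And>g f. g \<in> carrier G \<Longrightarrow> f \<in> Linf M \<Longrightarrow> Mn (\<lambda>x. f (x \<otimes> g)) = Mn f"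
    using Mn unfolding bi_inv_mean_Linf_def by blast+
  \<comment> \<open>Formulated for bounded continuous functions so that it covers right translates
    as well, whose continuity is immediate.\<close>
  have res: "h \<in> Linf M \<and> Mn (restrict h (carrier G)) = Mn h"
    if "continuous_map T euclideanreal h" "\<forall>x\<in>carrier G. \<bar>h x\<bar> \<le> C" for h C
  proof
    show h: "h \<in> Linf M"
      by (rule continuous_Linf[OF haar that])
    show "Mn (restrict h (carrier G)) = Mn h"
      by (rule cong[OF continuous_Linf(2)[OF haar that] h], rule AE_I2) (simp add: sp)
  qed
  have BUC: "h \<in> Linf M \<and> Mn (restrict h (carrier G)) = Mn h" if "h \<in> BUC_left G T" for h
    using res[OF BUC_left_continuous[OF that]] that by (auto simp: BUC_left_def)
  show ?thesis
    unfolding mean_props_def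
  proof (intro conjI ballI allI impI)
    fix h k and a b :: real assume "h \<in> BUC_left G T" "k \<in> BUC_left G T"
    then show "Mn (restrict (\<lambda>g. a * h g + b * k g) (carrier G))
        = a * Mn (restrict h (carrier G)) + b * Mn (restrict k (carrier G))"
      by (simp add: BUC BUC_left_lin lin)
  next
    fix h assume "h \<in> BUC_left G T" "\<forall>g\<in>carrier G. 0 \<le> h g"
    then show "0 \<le> Mn (restrict h (carrier G))"
      using BUC[of h] by (auto intro!: pos AE_I2 simp: sp)
  next
    show "Mn (restrict (\<lambda>_. 1) (carrier G)) = 1"
      using BUC[OF BUC_left_one] one by simp
  next
    fix h g assume h: "h \<in> BUC_left G T" and g: "g \<in> carrier G"
    obtain C where C: "\<forall>x\<in>carrier G. \<bar>h x\<bar> \<le> C"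
      using h by (auto simp: BUC_left_def)
    have "continuous_map T euclideanreal (\<lambda>x. h (x \<otimes> g))"
      using continuous_map_compose[OF right_translation_continuous[OF g] BUC_left_continuous[OF h]]
      by (simp add: o_def)
    then have "Mn (restrict (\<lambda>x. h (x \<otimes> g)) (carrier G)) = Mn (\<lambda>x. h (x \<otimes> g))"
      using res[of "\<lambda>x. h (x \<otimes> g)" C] C g by simp
    then show "Mn (restrict (\<lambda>x. h (x \<otimes> g)) (carrier G)) = Mn (restrict h (carrier G))"
      using BUC[OF h] right[OF g] by simp
  qed
qed

text \<open>Since \<open>\<phi> a\<close> is an isometry, the distance from
  \<open>\<phi> a x\<close> to \<open>\<phi> b x\<close> depends only on
  \<open>inv a \<otimes> b\<close>; continuity of the action at the unit thus gives a uniform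
  estimate. Boundedness of the orbit bounds the function.\<close>

lemma orbit_function_BUC:
  assumes metric: "Metric_space S d" and base: "z \<in> S" and action: "group_action G S \<phi>"
    and cont: "continuous_map (prod_topology T (Metric_space.mtopology S d)) (Metric_space.mtopology S d)
                 (\<lambda>p. \<phi> (fst p) (snd p))"
    and isom: "\<And>g x y. g \<in> carrier G \<Longrightarrow> x \<in> S \<Longrightarrow> y \<in> S \<Longrightarrow> d (\<phi> g x) (\<phi> g y) = d x y"
    and bdd: "Metric_space.mbounded S d (orbit G \<phi> x)"
    and f: "f \<in> Lip0 S d z" and x: "x \<in> S"
  shows "(\<lambda>g. f (\<phi> g x)) \<in> BUC_left G T"
proof -
  interpret Metric_space S d by (rule metric)
  interpret group_action G S \<phi> by (rule action)
  interpret lip_space S d z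
    by unfold_locales (use base in \<open>auto simp: less_le\<close>)
  have top: "topspace T = carrier G"
    using tg by (simp add: top_group_def)
  have act: "\<phi> g x \<in> S" if "g \<in> carrier G" for g
    using element_image[OF that x] by simp
  obtain B where B: "\<And>a b. a \<in> orbit G \<phi> x \<Longrightarrow> b \<in> orbit G \<phi> x \<Longrightarrow> d a b \<le> B"
    using bdd by (auto simp: mbounded_alt)
  have "\<bar>f (\<phi> g x)\<bar> \<le> lc f * B + \<bar>f x\<bar>" if g: "g \<in> carrier G" for g
  proof -
    have "\<bar>f (\<phi> g x) - f x\<bar> \<le> lc f * d (\<phi> g x) x"
      by (rule lipc_bound[OF f act[OF g] x])
    also have "\<dots> \<le> lc f * B"
      using g x orbit_refl lipc_nonneg[OF f] by (intro mult_left_mono B) (auto simp: orbit_def)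
    finally show ?thesis by linarith
  qed
  moreover have "unif_cont_l G T (\<lambda>g. f (\<phi> g x))"
    unfolding unif_cont_l_def
  proof (intro allI impI)
    fix \<epsilon> :: real assume \<epsilon>: "0 < \<epsilon>"
    define e where "e = \<epsilon> / (lc f + 1)"
    have K: "0 < lc f + 1" using lipc_nonneg[OF f] by simp
    with \<epsilon> have e: "0 < e" by (simp add: e_def)
    let ?V = "{v \<in> topspace T. \<phi> v x \<in> mball x e}"
    have "continuous_map T (prod_topology T mtopology) (\<lambda>v. (v, x))"
      using x by (auto intro!: continuous_map_pairedI)
    from continuous_map_compose[OF this cont] have "continuous_map T mtopology (\<lambda>v. \<phi> v x)"
      by (simp add: o_def)
    then have "openin T ?V"
      by (rule openin_continuous_map_preimage) simp
    moreover have "\<phi> \<one> x = x"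
      using id_eq_one x by (metis restrict_apply')
    then have "\<one> \<in> ?V"
      using x e top by simp
    ultimately have V: "nbhd_one G T ?V"
      by (auto simp: nbhd_one_def)
    have "\<bar>f (\<phi> a x) - f (\<phi> b x)\<bar> < \<epsilon>"
      if a: "a \<in> carrier G" and b: "b \<in> carrier G" and ab: "inv a \<otimes> b \<in> ?V" for a b
    proof -
      have "\<phi> a (\<phi> (inv a \<otimes> b) x) = \<phi> b x"
        using a b x by (simp add: composition_rule[symmetric] m_assoc[symmetric])
      then have "d (\<phi> a x) (\<phi> b x) = d x (\<phi> (inv a \<otimes> b) x)"
        using isom[OF a x act, of "inv a \<otimes> b"] a b by simp
      then have "d (\<phi> a x) (\<phi> b x) \<le> e"
        using ab by simp
      then have "\<bar>f (\<phi> a x) - f (\<phi> b x)\<bar> \<le> lc f * e"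
        using lipc_bound[OF f act[OF a] act[OF b]] mult_left_mono[OF _ lipc_nonneg[OF f]]
        by (meson order_trans)
      also have "\<dots> < (lc f + 1) * e"
        using e by (simp add: algebra_simps)
      also have "\<dots> = \<epsilon>"
        using K by (simp add: e_def)
      finally show ?thesis .
    qed
    with V show "\<exists>V. nbhd_one G T V \<and>
        (\<forall>a\<in>carrier G. \<forall>b\<in>carrier G. inv a \<otimes> b \<in> V \<longrightarrow> \<bar>f (\<phi> a x) - f (\<phi> b x)\<bar> < \<epsilon>)"
      by blast
  qed
  ultimately show ?thesis
    by (auto simp: BUC_left_def)
qed

end

theorem theorem4p5:
  fixes G :: "'g monoid" and T :: "'g topology" and Mn :: "('g \<Rightarrow> real) \<Rightarrow> real"
    and S :: "'m set" and d :: "'m \<Rightarrow> 'm \<Rightarrow> real" and z :: 'm and \<phi> :: "'g \<Rightarrow> 'm \<Rightarrow> 'm"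
  assumes metric: "Metric_space S d" and base: "z \<in> S"
    and topgrp: "top_group G T" and haus: "Hausdorff_space T"
    and amen: "amenable_group G T"
    and action: "group_action G S \<phi>"
    and cont: "continuous_map (prod_topology T (Metric_space.mtopology S d)) (Metric_space.mtopology S d)
                 (\<lambda>p. \<phi> (fst p) (snd p))"
    and isom: "\<forall>g\<in>carrier G. \<forall>x\<in>S. \<forall>y\<in>S. d (\<phi> g x) (\<phi> g y) = d x y"
    and bdd_orbits: "\<forall>x\<in>S. Metric_space.mbounded S d (orbit G \<phi> x)"
    and mean: "(locally_compact_space T \<and> (\<exists>\<mu>. haar_measure G T \<mu> \<and> bi_inv_mean_Linf G \<mu> Mn))
               \<or> (SIN_group G T \<and> bi_inv_mean_BUC G T Mn)"
  shows "closed_subspace_dual S d z (RG G Mn S d z \<phi> ` FreeSp S d z)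
    \<and> (\<exists>U. lin_iso_onto (RG G Mn S d z \<phi> ` FreeSp S d z) (dnorm S d z)
              (FreeSp (quot_space G S d \<phi>) (quot_dist d) (orbit_cl G S d \<phi> z))
              (dnorm (quot_space G S d \<phi>) (quot_dist d) (orbit_cl G S d \<phi> z)) U)
    \<and> is_projection (Lip0 S d z) (PG_tilde G Mn S d z \<phi>)
    \<and> (\<forall>f\<in>Lip0 S d z. lipc S d (PG_tilde G Mn S d z \<phi> f) \<le> lipc S d f)
    \<and> PG_tilde G Mn S d z \<phi> ` Lip0 S d z = Lip0G G S d z \<phi>
    \<and> {\<mu> \<in> FreeSp S d z. RG G Mn S d z \<phi> \<mu> = (\<lambda>_. 0)}
        = cspan S d z {(\<lambda>f. delta S d z (\<phi> g x) f - delta S d z x f) | g x. g \<in> carrier G \<and> x \<in> S}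
    \<and> (\<exists>V P U. V \<subseteq> Lip0 S d z \<and> lin_subspace V \<and> is_projection (Lip0 S d z) P
              \<and> P ` Lip0 S d z = V \<and> (\<forall>f\<in>Lip0 S d z. lipc S d (P f) \<le> lipc S d f)
              \<and> lin_iso_onto (Lip0 (quot_space G S d \<phi>) (quot_dist d) (orbit_cl G S d \<phi> z))
                   (lipc (quot_space G S d \<phi>) (quot_dist d)) V (lipc S d) U)
    \<and> (Lip0G G S d z \<phi> \<inter> annihilator S d z (IG G S d z \<phi>) = {\<lambda>_. 0} \<longrightarrow>
        (\<exists>P. is_projection (FreeSp S d z) P \<and> P ` FreeSp S d z = IG G S d z \<phi>
             \<and> (\<forall>\<mu>\<in>FreeSp S d z. dnorm S d z (P \<mu>) \<le> dnorm S d z \<mu>)))"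
proof -
  have m: "mean_props G T Mn"
    using mean mean_props_SIN[OF topgrp] mean_props_Linf[OF topgrp] by blast
  interpret averaged_action S d G \<phi> z Mn "BUC_left G T"
  proof (intro averaged_action.intro averaged_action_axioms.intro metric action base)
    show "d (\<phi> g x) (\<phi> g y) = d x y" if "g \<in> carrier G" "x \<in> S" "y \<in> S" for g x y
      using isom that by blast
    show "(\<lambda>g. f (\<phi> g x)) \<in> BUC_left G T" if "f \<in> Lip0 S d z" "x \<in> S" for f x
      using orbit_function_BUC[OF topgrp metric base action cont _ _ that] isom bdd_orbits that(2) by blast
  qed (use m[unfolded mean_props_def[OF topgrp]] BUC_left_lin[OF topgrp] BUC_left_one[OF topgrp] BUC_left_lim[OF topgrp] in \<open>auto\<close>)
  show ?thesis
  proof (intro conjI impI)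
    show "\<exists>U. lin_iso_onto (R ` FS) dn quot.FS quot.dn U"
      using push_isometry by blast
    show "{\<mu> \<in> FS. R \<mu> = (\<lambda>_. 0)} = cspan S d z {(\<lambda>f. \<delta> (\<phi> g x) f - \<delta> x f) |g x. g \<in> carrier G \<and> x \<in> S}"
      using RG_kernel by (simp add: orbit_differences_def)
    have "LG \<subseteq> L0" "lin_subspace LG"
      using Lip0G_Lip0 lin_subspace_Lip0 by (auto simp: lin_subspace_def Lip0G_def)
    \<comment> \<open>The witnesses are the invariant functions, the averaging projection and
      composition with the quotient map.\<close>
    then show "\<exists>V P U. V \<subseteq> L0 \<and> lin_subspace V \<and> is_projection L0 P \<and> P ` L0 = V \<and>
        (\<forall>f\<in>L0. lc (P f) \<le> lc f) \<and> lin_iso_onto quot.L0 quot.lc V lc U"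
      using PG_projection PG_image lipc_PG lift_isometry by blast
    \<comment> \<open>The projection is \<open>R\<close> itself, which takes values in
      \<open>IX\<close> under the separation hypothesis.\<close>
    show "\<exists>P. is_projection FS P \<and> P ` FS = IX \<and> (\<forall>\<mu>\<in>FS. dn (P \<mu>) \<le> dn \<mu>)"
      if "LG \<inter> annihilator S d z IX = {\<lambda>_. 0}"
      using IG_complemented[OF that] dnorm_RG by blast
  qed (use RG_range_closed PG_projection lipc_PG PG_image in auto)
qed

end
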